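(* For any rank $3$ lattice $\Lambda\subset\mathbb{R}^3$, there exists a minimal basis of $\Lambda$ whose solid angle $\Omega$ satisfies $$\Omega_{\mathcal{A}_3}\le \Omega\le \Omega_{\mathcal{R}_3},$$ where $\Omega_{\mathcal{A}_3}=0.551285\ldots$ and $\Omega_{\mathcal{R}_3}=\frac{\pi}{2}$ are absolute constants. Similarly, for any rank $4$ lattice $\Lambda\subset\mathbb{R}^4$, there exists a minimal basis of $\Lambda$ whose solid angle $\Omega$ satisfies $$\Omega_{\mathcal{A}_4}\le \Omega\le \Omega_{\mathcal{R}_4},$$ where $\Omega_{\mathcal{A}_4}=0.193142\ldots$ and $\Omega_{\mathcal{R}_4}=\frac{\pi^2}{8}$. These bounds are sharp: $\Omega_{\mathcal{R}_3}$ and $\Omega_{\mathcal{R}_4}$ are attained (by the solid angle of a minimal basis) when $\Lambda$ is similar to $\mathcal{R}_3$ and $\mathcal{R}_4$ respectively, and $\Omega_{\mathcal{A}_3}$ and $\Omega_{\mathcal{A}_4}$ are attained when $\Lambda$ is similar to the alternating lattices $\mathcal{A}_3$ and $\mathcal{A}_4$ respectively.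
   Context: A rank $n$ lattice $\Lambda\subset\mathbb{R}^n$ is a discrete subgroup generated by $n$ linearly independent vectors. A minimal basis means a Minkowski reduced basis: an ordered basis $\{v_1,\dots,v_n\}$ generating $\Lambda$ over $\mathbb{Z}$ such that for every $1\le k\le n$ and every $(x_1,\dots,x_n)\in\mathbb{Z}^n$ with $\gcd(x_k,\dots,x_n)=1$ one has $\|v_k\|\le\|\sum_i x_iv_i\|$. A lattice may have many minimal bases. The solid angle of a basis is $\Omega=\mathrm{area}(K\cap\mathcal{S}^{n-1})$, where $K=\{x_1v_1+\dots+x_nv_n: x_i\in\mathbb{R}^+\}$, $\mathcal{S}^{n-1}$ is the unit sphere in $\mathbb{R}^n$, and area is the $(n-1)$-dimensional spherical area. Two lattices are similar if one can be obtained from the other by an orthogonal transformation followed by a scalar multiplication. $\mathcal{R}_n$ is the rectangular lattice generated by the standard basis vectors of $\mathbb{R}^n$; $\Omega_{\mathcal{R}_n}$ is the solid angle of the standard basis. $\mathcal{A}_n$ is the alternating lattice generated by unit vectors $v_1,\dots,v_n$ with $\langle v_i,v_j\rangle=\frac12$ for all $i\ne j$ (unique up to orthogonal transformation; for $n=3$ it is the face-centered cubic lattice generated by $(\frac{1}{\sqrt2},\frac{1}{\sqrt2},0),(\frac{1}{\sqrt2},0,\frac{1}{\sqrt2}),(0,\frac{1}{\sqrt2},\frac{1}{\sqrt2})$); $\Omega_{\mathcal{A}_n}$ is the solid angle of this basis $v_1,\dots,v_n$. *)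

theory Defs
  imports "HOL-Analysis.Analysis"
begin

text \<open>
  A basis of \<open>\<real>\<^sup>n\<close> is a family \<open>v :: 'n \<Rightarrow> real ^ 'n\<close>, where \<open>n = CARD('n)\<close>.  Where the basis is
  an ordered one (Minkowski reduction), the order is that of the index type \<open>'n\<close>.  For the numeral
  types \<open>3\<close> and \<open>4\<close> this is the order of the residues \<open>0 < 1 < 2\<close> and \<open>0 < 1 < 2 < 3\<close>, so the
  index \<open>k\<close> here plays the role of \<open>k + 1\<close> in the usual numbering \<open>1, \<dots>, n\<close>.
\<close>

definition int_span :: "('n \<Rightarrow> real ^ 'n) \<Rightarrow> (real ^ 'n) set" where
  "int_span v = {(\<Sum>i\<in>UNIV. of_int (x i) *\<^sub>R v i) | x :: 'n \<Rightarrow> int. True}"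

definition lin_indep :: "('n \<Rightarrow> real ^ 'n) \<Rightarrow> bool" where
  "lin_indep v \<longleftrightarrow> inj v \<and> independent (range v)"

definition lattice_basis :: "(real ^ 'n) set \<Rightarrow> ('n \<Rightarrow> real ^ 'n) \<Rightarrow> bool" where
  "lattice_basis L v \<longleftrightarrow> lin_indep v \<and> L = int_span v"

definition full_rank_lattice :: "(real ^ 'n) set \<Rightarrow> bool" where
  "full_rank_lattice L \<longleftrightarrow> discrete L \<and> (\<exists>v. lattice_basis L v)"

definition minimal_basis :: "(real ^ 'n::{finite,linorder}) set \<Rightarrow> ('n \<Rightarrow> real ^ 'n::_) \<Rightarrow> bool" where
  "minimal_basis L v \<longleftrightarrow> lattice_basis L v \<and>
     (\<forall>k. \<forall>x :: 'n \<Rightarrow> int. (GCD i\<in>{k..}. x i) = 1 \<longrightarrow>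
        norm (v k) \<le> norm (\<Sum>i\<in>UNIV. of_int (x i) *\<^sub>R v i))"

definition open_cone :: "('n \<Rightarrow> real ^ 'n) \<Rightarrow> (real ^ 'n) set" where
  "open_cone v = {(\<Sum>i\<in>UNIV. x i *\<^sub>R v i) | x :: 'n \<Rightarrow> real. \<forall>i. 0 < x i}"

text \<open>
  The \<open>(n - 1)\<close>-dimensional area of a subset \<open>A\<close> of the unit sphere: by integration in polar
  coordinates, the truncated cone over \<open>A\<close> has volume \<open>area A * (\<integral>r\<in>{0..1}. r ^ (n - 1)) = area A / n\<close>.
\<close>

definition spherical_area :: "(real ^ 'n) set \<Rightarrow> real" where
  "spherical_area A = real CARD('n) * measure lebesgue {t *\<^sub>R u | t u. 0 < t \<and> t \<le> 1 \<and> u \<in> A}"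

definition solid_angle :: "('n \<Rightarrow> real ^ 'n) \<Rightarrow> real" where
  "solid_angle v = spherical_area (open_cone v \<inter> sphere 0 1)"

definition similar :: "(real ^ 'n) set \<Rightarrow> (real ^ 'n) set \<Rightarrow> bool" where
  "similar L M \<longleftrightarrow> (\<exists>f c. orthogonal_transformation f \<and> c \<noteq> 0 \<and> L = (\<lambda>x. c *\<^sub>R f x) ` M)"

definition standard_basis :: "'n \<Rightarrow> real ^ 'n" where
  "standard_basis i = axis i 1"

definition rectangular_lattice :: "(real ^ 'n) set" where
  "rectangular_lattice = int_span standard_basis"

definition alternating_system :: "('n \<Rightarrow> real ^ 'n) \<Rightarrow> bool" where
  "alternating_system v \<longleftrightarrow> (\<forall>i. norm (v i) = 1) \<and> (\<forall>i j. i \<noteq> j \<longrightarrow> v i \<bullet> v j = 1 / 2)"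

text \<open>
  The choice below is harmless: alternating systems exist (\<open>alternating_system_exists\<close>), they are
  unique up to an orthogonal transformation (\<open>alternating_system_unique\<close>), and all of them have the
  same solid angle (\<open>alternating_system_solid_angle\<close>).
\<close>

definition alternating_basis :: "'n \<Rightarrow> real ^ 'n" where
  "alternating_basis = (SOME v. alternating_system v)"

definition alternating_lattice :: "(real ^ 'n) set" where
  "alternating_lattice = int_span alternating_basis"

lemma alternating_system_inner:
  assumes "alternating_system v"
  shows "v i \<bullet> v j = (if i = j then 1 else 1 / 2)"
  using assms by (auto simp: alternating_system_def dot_square_norm)

lemma alternating_system_exists: "\<exists>v :: 'n \<Rightarrow> real ^ 'n. alternating_system v"
proof -
  let ?n = "real CARD('n)"
  have n0: "?n > 0" by simp
  define c where "c = (sqrt (?n + 1) - 1) / ?n"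
  define u :: "real ^ 'n" where "u = (\<chi> k. 1)"
  define v :: "'n \<Rightarrow> real ^ 'n" where "v = (\<lambda>i. (1 / sqrt 2) *\<^sub>R (axis i 1 + c *\<^sub>R u))"
  have uu: "u \<bullet> u = ?n" by (simp add: inner_vec_def u_def)
  have ua: "axis i 1 \<bullet> u = 1" "u \<bullet> axis i 1 = 1" for i
    by (simp_all add: inner_axis inner_axis' u_def)
  have aa: "axis i (1::real) \<bullet> axis j 1 = (if i = j then 1 else 0)" for i j :: 'n
    by (simp add: inner_axis_axis)
  have nc: "?n * c = sqrt (?n + 1) - 1"
    using n0 by (simp add: c_def)
  have "?n * (2 * c + c * c * ?n) = (?n * c + 1)\<^sup>2 - 1"
    by (simp add: power2_eq_square algebra_simps)
  also have "\<dots> = ?n" using n0 by (simp add: nc)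
  finally have "2 * c + c * c * ?n = 1" using n0 by simp
  then have ip: "v i \<bullet> v j = (if i = j then 1 else 1 / 2)" for i j
    by (simp add: v_def inner_add_left inner_add_right aa ua uu algebra_simps)
  have "alternating_system v"
    unfolding alternating_system_def by (simp add: norm_eq_sqrt_inner ip)
  then show ?thesis by blast
qed

lemma alternating_system_alternating_basis: "alternating_system alternating_basis"
  unfolding alternating_basis_def by (rule someI_ex[OF alternating_system_exists])

lemma alternating_system_lin_indep:
  fixes v :: "'n \<Rightarrow> real ^ 'n"
  assumes "alternating_system v"
  shows "lin_indep v"
proof -
  note ip = alternating_system_inner[OF assms]
  have inj: "inj v"
  proof (rule injI)
    fix i j assume "v i = v j"
    then have "v i \<bullet> v j = v j \<bullet> v j" by simp
    then show "i = j" by (auto simp: ip split: if_splits)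
  qed
  have zero: "c i = 0" if "(\<Sum>i\<in>UNIV. c i *\<^sub>R v i) = 0" for c :: "'n \<Rightarrow> real" and i
  proof -
    let ?s = "\<Sum>i\<in>UNIV. c i"
    have eq: "c j + ?s = 0" for j
    proof -
      have "0 = (\<Sum>i\<in>UNIV. c i *\<^sub>R v i) \<bullet> v j" using that by simp
      also have "\<dots> = (\<Sum>i\<in>UNIV. c i * (if i = j then 1 else 1 / 2))"
        by (simp add: inner_sum_left ip)
      also have "\<dots> = (\<Sum>i\<in>UNIV. c i / 2 + (if i = j then c i / 2 else 0))"
        by (rule sum.cong) auto
      also have "\<dots> = ?s / 2 + c j / 2"
        by (simp add: sum.distrib sum_divide_distrib)
      finally show ?thesis by simp
    qed
    then have "(\<Sum>j\<in>UNIV. c j + ?s) = 0" by simp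
    then have "?s * (1 + real CARD('n)) = 0"
      by (simp add: sum.distrib algebra_simps)
    then have "?s = 0" by (metis mult_eq_0_iff of_nat_Suc of_nat_neq_0)
    with eq show ?thesis by simp
  qed
  have "independent (range v)"
  proof (rule independent_if_scalars_zero)
    fix f x assume s: "(\<Sum>x\<in>range v. f x *\<^sub>R x) = 0" and "x \<in> range v"
    then have "(\<Sum>i\<in>UNIV. f (v i) *\<^sub>R v i) = 0"
      by (simp add: sum.reindex[OF inj])
    from zero[OF this] \<open>x \<in> range v\<close> show "f x = 0" by auto
  qed simp
  with inj show ?thesis by (simp add: lin_indep_def)
qed

lemma lin_indep_span:
  fixes v :: "'n \<Rightarrow> real ^ 'n"
  assumes "lin_indep v"
  shows "span (range v) = UNIV"
proof -
  have "dim (UNIV :: (real ^ 'n) set) \<le> card (range v)"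
    using assms by (simp add: lin_indep_def card_image)
  then have "UNIV \<subseteq> span (range v)"
    using assms by (intro card_ge_dim_independent) (auto simp: lin_indep_def)
  then show ?thesis by blast
qed

lemma alternating_system_unique:
  fixes v w :: "'n \<Rightarrow> real ^ 'n"
  assumes v: "alternating_system v" and w: "alternating_system w"
  shows "\<exists>f. orthogonal_transformation f \<and> w = f \<circ> v"
proof -
  have iv: "inj v" and ind: "independent (range v)"
    using alternating_system_lin_indep[OF v] by (auto simp: lin_indep_def)
  obtain f where lf: "linear f" and "\<forall>x\<in>range v. f x = w (inv v x)"
    using linear_independent_extend[OF ind, of "\<lambda>x. w (inv v x)"] by blast
  then have fv: "f (v i) = w i" for i by (simp add: iv)
  have "f x \<bullet> f y = x \<bullet> y" for x y
  proof -
    have x: "x \<in> span (range v)" and y: "y \<in> span (range v)"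
      using lin_indep_span[OF alternating_system_lin_indep[OF v]] by auto
    have "f (v i) \<bullet> f z = v i \<bullet> z" if "z \<in> span (range v)" for z i
      using that
    proof (induction rule: span_induct_alt)
      case base
      then show ?case by (simp add: linear_0[OF lf])
    next
      case (step c b z)
      then show ?case
        using alternating_system_inner[OF v] alternating_system_inner[OF w]
        by (auto simp: linear_add[OF lf] linear_scale[OF lf] inner_add_right fv)
    qed
    note 1 = this[OF y]
    from x show ?thesis
    proof (induction rule: span_induct_alt)
      case base
      then show ?case by (simp add: linear_0[OF lf])
    next
      case (step c b z)
      then show ?case
        using 1 by (auto simp: linear_add[OF lf] linear_scale[OF lf] inner_add_left)
    qed
  qed
  with lf fv show ?thesis
    by (intro exI[of _ f]) (auto simp: orthogonal_transformation_def fun_eq_iff)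
qed

lemma measure_orthogonal_image_any:
  fixes f :: "real ^ 'n::{finite,wellorder} \<Rightarrow> real ^ 'n::_"
  assumes f: "orthogonal_transformation f"
  shows "measure lebesgue (f ` A) = measure lebesgue A"
proof (cases "A \<in> lmeasurable")
  case True
  then show ?thesis by (rule measure_orthogonal_image[OF f])
next
  case False
  have g: "orthogonal_transformation (inv f)"
    using f by (rule orthogonal_transformation_inv)
  have "inv f ` f ` A = A"
    using orthogonal_transformation_inj[OF f] by (rule image_inv_f_f)
  then have "f ` A \<notin> lmeasurable"
    using measurable_orthogonal_image[OF g] False by metis
  moreover have "measure lebesgue B = 0" if "B \<notin> lmeasurable" for B :: "(real ^ 'n::_) set"
  proof (cases "B \<in> sets lebesgue")
    case True
    with that have "emeasure lebesgue B = \<infinity>"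
      by (simp add: fmeasurable_def less_top[symmetric])
    then show ?thesis by (simp add: measure_def)
  qed (simp add: measure_notin_sets)
  ultimately show ?thesis using False by simp
qed

lemma solid_angle_orthogonal_transformation:
  fixes v :: "'n::{finite,wellorder} \<Rightarrow> real ^ 'n::_"
  assumes f: "orthogonal_transformation f"
  shows "solid_angle (f \<circ> v) = solid_angle v"
proof -
  let ?T = "\<lambda>A. {t *\<^sub>R u | t u. 0 < t \<and> t \<le> 1 \<and> u \<in> A} :: (real ^ 'n::_) set"
  have lf: "linear f" using f by (rule orthogonal_transformation_linear)
  have "open_cone (f \<circ> v) = f ` open_cone v"
  proof -
    have "(\<Sum>i\<in>UNIV. x i *\<^sub>R (f \<circ> v) i) = f (\<Sum>i\<in>UNIV. x i *\<^sub>R v i)" for x :: "'n \<Rightarrow> real"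
      by (simp add: linear_sum[OF lf] linear_scale[OF lf])
    then show ?thesis unfolding open_cone_def by auto
  qed
  then have "open_cone (f \<circ> v) \<inter> sphere 0 1 = f ` (open_cone v \<inter> sphere 0 1)"
    using orthogonal_transformation_norm[OF f] by auto
  moreover have "?T (f ` A) = f ` ?T A" for A
  proof (intro equalityI subsetI)
    fix y assume "y \<in> ?T (f ` A)"
    then obtain t u where "y = t *\<^sub>R f u" "0 < t" "t \<le> 1" "u \<in> A" by blast
    then show "y \<in> f ` ?T A"
      by (intro image_eqI[of _ _ "t *\<^sub>R u"]) (auto simp: linear_scale[OF lf])
  next
    fix y assume "y \<in> f ` ?T A"
    then obtain t u where "y = f (t *\<^sub>R u)" "0 < t" "t \<le> 1" "u \<in> A" by blast
    then show "y \<in> ?T (f ` A)"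
      by (auto simp: linear_scale[OF lf])
  qed
  ultimately show ?thesis
    by (simp add: solid_angle_def spherical_area_def measure_orthogonal_image_any[OF f])
qed

lemma alternating_system_solid_angle:
  fixes v :: "'n::{finite,wellorder} \<Rightarrow> real ^ 'n::_"
  assumes "alternating_system v"
  shows "solid_angle v = solid_angle (alternating_basis :: 'n \<Rightarrow> real ^ 'n::_)"
  using alternating_system_unique[OF alternating_system_alternating_basis assms]
  by (auto simp: solid_angle_orthogonal_transformation)

lemma spherical_area_sphere:
  "spherical_area (sphere (0 :: real ^ 'n) 1) = real CARD('n) * measure lebesgue (ball (0 :: real ^ 'n) 1)"
proof -
  have "{t *\<^sub>R u | t u. 0 < t \<and> t \<le> 1 \<and> u \<in> sphere (0 :: real ^ 'n) 1} = cball 0 1 - {0}"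
  proof (intro equalityI subsetI)
    fix x :: "real ^ 'n"
    assume "x \<in> cball 0 1 - {0}"
    then have "x = norm x *\<^sub>R sgn x" "0 < norm x" "norm x \<le> 1" "sgn x \<in> sphere 0 1"
      by (auto simp: sgn_div_norm)
    then show "x \<in> {t *\<^sub>R u | t u. 0 < t \<and> t \<le> 1 \<and> u \<in> sphere 0 1}" by blast
  qed auto
  moreover have "measure lebesgue (cball 0 1 - {0 :: real ^ 'n}) = measure lebesgue (ball (0 :: real ^ 'n) 1)"
  proof (rule measure_negligible_symdiff[OF lmeasurable_ball])
    have "negligible (sphere 0 1 \<union> {0 :: real ^ 'n})"
      by (intro negligible_Un negligible_sphere negligible_sing)
    then show "negligible (ball 0 1 - (cball 0 1 - {0}) \<union> (cball 0 1 - {0} - ball (0 :: real ^ 'n) 1))"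
      by (rule negligible_subset) auto
  qed
  ultimately show ?thesis by (simp add: spherical_area_def)
qed

end

(* Among the 2^n sign changes of a Minkowski reduced basis the cones are disjoint, so one of them has at
   most the solid angle of an orthant; this gives the upper bound. The lower bound holds for every
   Minkowski reduced basis. After normalization its Gram matrix G has off-diagonal entries at most 1/2,
   and the solid angle is n sqrt(det G) vol {x > 0. x^T G x <= 1}. For n = 3 the volume is monotone in G
   and det G >= 1/2, the value for the alternating basis. For n = 4 one has det G >= 1/4 (Minkowski's
   second theorem with Hermite's constant, which Mordell's duality argument reduces to dimension
   three). This falls short of the value 5/16 of the alternating basis, but the volume, an integral of
   (u^T G u)^(-2) / 4 over the standard simplex, is bounded below by linearization at the alternating
   Gram matrix, and this makes up for it; near that matrix det G is expanded instead.
   For the alternating basis u^T G u = (1 + |u|^2) / 2 on the simplex, so that Taylor polynomials in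
   |u|^2 and the Dirichlet integrals of monomials give the numerical values. *)

theory Submission
  imports Defs
begin

section \<open>Gram determinants in dimensions three and four\<close>

text \<open>In dimension four a comparison of determinants alone fails: a reduced basis of D_4
  scaled to minimal norm one has det G = 1/4, whereas the alternating basis has 5/16. So volume is
  traded against determinant. Both are measured by t, the sum over the six pairs of 1/2 minus the
  Gram entry. The volume grows at least by the factor 1 + 0.28 t, and what is needed is det G (1 +
  0.28 t)^2 >= 5/16. For t > 1/2 the bound 1/4 is enough, since 1.14^2 > 5/4; for t <= 1/2 the
  expansion gives det G >= (5 - 2 t) / 16. Minkowski's second theorem concerns successive minima. It
  applies to a reduced basis because in dimension at most four a lattice vector whose last nonzero
  coefficient has index k is never shorter than v_k, even if that coefficient is not a unit.
  Mordell's argument treats a lattice and its dual at once, so pairs of dual bases are moved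
  together by integer shears. The bounds are attained because both model bases consist of shortest
  nonzero lattice vectors, which makes them reduced.\<close>

lemma det_4:
  "det (A::'a::comm_ring_1^4^4) =
    A$1$1 * (A$2$2 * A$3$3 * A$4$4 + A$2$3 * A$3$4 * A$4$2 + A$2$4 * A$3$2 * A$4$3
           - A$2$2 * A$3$4 * A$4$3 - A$2$3 * A$3$2 * A$4$4 - A$2$4 * A$3$3 * A$4$2)
  - A$1$2 * (A$2$1 * A$3$3 * A$4$4 + A$2$3 * A$3$4 * A$4$1 + A$2$4 * A$3$1 * A$4$3
           - A$2$1 * A$3$4 * A$4$3 - A$2$3 * A$3$1 * A$4$4 - A$2$4 * A$3$3 * A$4$1)
  + A$1$3 * (A$2$1 * A$3$2 * A$4$4 + A$2$2 * A$3$4 * A$4$1 + A$2$4 * A$3$1 * A$4$2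
           - A$2$1 * A$3$4 * A$4$2 - A$2$2 * A$3$1 * A$4$4 - A$2$4 * A$3$2 * A$4$1)
  - A$1$4 * (A$2$1 * A$3$2 * A$4$3 + A$2$2 * A$3$3 * A$4$1 + A$2$3 * A$3$1 * A$4$2
           - A$2$1 * A$3$3 * A$4$2 - A$2$2 * A$3$1 * A$4$3 - A$2$3 * A$3$2 * A$4$1)"
proof -
  have f1: "finite {2::4, 3, 4}" "1 \<notin> {2::4, 3, 4}"
    and f2: "finite {3::4, 4}" "2 \<notin> {3::4, 4}"
    and f3: "finite {4::4}" "3 \<notin> {4::4}"
    by auto
  show ?thesis
    unfolding det_def UNIV_4
    unfolding sum_over_permutations_insert[OF f1]
    unfolding sum_over_permutations_insert[OF f2]
    unfolding sum_over_permutations_insert[OF f3]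
    unfolding permutes_sing
    by (simp add: sign_swap_id permutation_swap_id permutation_compose sign_compose sign_id swap_id_eq algebra_simps)
qed

text \<open>Here \<open>A\<close>, \<open>B\<close>, \<open>C\<close> are squared norms and
  \<open>a\<close>, \<open>b\<close>, \<open>c\<close> absolute inner products. The expression is
  affine in \<open>C\<close> with coefficient \<open>A*B/2 - a^2 >= 0\<close>, so
  \<open>C = B\<close> is the worst case. What remains is concave in \<open>c\<close> and is decided
  by the endpoints \<open>c = 0\<close> and \<open>c = B/2\<close>.\<close>

lemma gram3_aux_nonneg:
  fixes A B C a b c :: real
  assumes "0 < A" "A \<le> B" "B \<le> C" and a: "0 \<le> a" "2 * a \<le> A"
    and b: "0 \<le> b" "2 * b \<le> A" and c: "0 \<le> c" "2 * c \<le> B"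
  shows "0 \<le> A*B*C / 2 + 2*a*b*c - A*c^2 - B*b^2 - C*a^2"
proof -
  have "a^2 \<le> A^2/4" using a power_mono[of a "A/2" 2] by (simp add: power_divide)
  moreover have "A*A \<le> A*B" using assms by simp
  ultimately have "0 \<le> A*B/2 - a^2" by (simp add: power2_eq_square) (use zero_le_square[of A] in linarith)
  then have "(A*B/2 - a^2) * B \<le> (A*B/2 - a^2) * C" using assms by (simp add: mult_left_mono)
  then have 1: "A*B*B/2 - B*a^2 \<le> A*B*C/2 - C*a^2" by (simp add: algebra_simps power2_eq_square)
  \<comment> \<open>\<open>ab1\<close> is the endpoint \<open>c = 0\<close>, \<open>ab2\<close> the
    endpoint \<open>c = B/2\<close>.\<close>
  have ab1: "a^2 + b^2 \<le> A*B/2"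
  proof -
    have "b^2 \<le> A^2/4" using b power_mono[of b "A/2" 2] by (simp add: power_divide)
    with \<open>a^2 \<le> A^2/4\<close> \<open>A*A \<le> A*B\<close> show ?thesis by (simp add: power2_eq_square)
  qed
  have ab2: "a^2 - a*b + b^2 \<le> A*B/4"
  proof (cases "a \<le> b")
    case True
    then have "a * (b - a) \<ge> 0" using a by simp
    moreover have "b^2 \<le> A^2/4" using b power_mono[of b "A/2" 2] by (simp add: power_divide)
    ultimately show ?thesis using \<open>A*A \<le> A*B\<close> by (simp add: power2_eq_square algebra_simps)
  next
    case False
    then have "b * (a - b) \<ge> 0" using b by simp
    with \<open>a^2 \<le> A^2/4\<close> show ?thesis using \<open>A*A \<le> A*B\<close> by (simp add: power2_eq_square algebra_simps)
  qed
  have "0 \<le> A*c*(B/2 - c) * B" using assms by simp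
  moreover have "0 \<le> (2*c) * (B * (A*B/4 - (a^2 - a*b + b^2)))" using ab2 assms by simp
  moreover have "0 \<le> (B - 2*c) * (B * (A*B/2 - (a^2 + b^2)))" using ab1 assms by simp
  \<comment> \<open>Concave interpolation, multiplied by \<open>B\<close>: the first summand is the
    excess of the quadratic over its chord, the other two are the weighted endpoint values.\<close>
  moreover have "B * (A*B*B/2 + 2*a*b*c - A*c^2 - B*b^2 - B*a^2) =
     A*c*(B/2 - c) * B + (2*c) * (B * (A*B/4 - (a^2 - a*b + b^2))) + (B - 2*c) * (B * (A*B/2 - (a^2 + b^2)))"
    by (simp add: field_simps power2_eq_square)
  ultimately have "0 \<le> B * (A*B*B/2 + 2*a*b*c - A*c^2 - B*b^2 - B*a^2)"
    by (metis add_nonneg_nonneg)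
  then have "0 \<le> A*B*B/2 + 2*a*b*c - A*c^2 - B*b^2 - B*a^2"
    using assms by (simp add: zero_le_mult_iff)
  with 1 show ?thesis by linarith
qed

text \<open>The expression decreases in \<open>c\<close>, so \<open>c\<close> is pushed to its
  largest admissible value: \<open>B/2\<close> as long as \<open>a + b <= A/2\<close>, and otherwise
  the value \<open>d\<close> where \<open>s\<close> becomes an equality.\<close>

lemma gram3_aux_neg:
  fixes A B C a b c :: real
  assumes "0 < A" "A \<le> B" "B \<le> C" and a: "0 \<le> a" "2 * a \<le> A"
    and b: "0 \<le> b" "2 * b \<le> A" and c: "0 \<le> c" "2 * c \<le> B"
    and s: "2 * (a + b + c) \<le> A + B"
  shows "0 \<le> A*B*C / 2 - 2*a*b*c - A*c^2 - B*b^2 - C*a^2"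
proof -
  have "a^2 \<le> A^2/4" using a power_mono[of a "A/2" 2] by (simp add: power_divide)
  moreover have AAB: "A*A \<le> A*B" using assms by simp
  ultimately have "0 \<le> A*B/2 - a^2" by (simp add: power2_eq_square) (use zero_le_square[of A] in linarith)
  then have "(A*B/2 - a^2) * B \<le> (A*B/2 - a^2) * C" using assms by (simp add: mult_left_mono)
  then have 1: "A*B*B/2 - B*a^2 \<le> A*B*C/2 - C*a^2" by (simp add: algebra_simps power2_eq_square)
  have mono: "2*a*b*c + A*c^2 \<le> 2*a*b*d + A*d^2" if "c \<le> d" for d
  proof -
    have "2*a*b*c \<le> 2*a*b*d" using that a b by (intro mult_left_mono) auto
    moreover have "c^2 \<le> d^2" using that c by (intro power_mono) auto
    moreover have "A*c^2 \<le> A*d^2" using calculation assms by (intro mult_left_mono) auto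
    ultimately show ?thesis by linarith
  qed
  have "0 \<le> A*B*B/2 - 2*a*b*c - A*c^2 - B*b^2 - B*a^2"
  proof (cases "a + b \<le> A/2")
    case True
    have "(a+b)^2 \<le> (A/2)^2" using True a b by (intro power_mono) auto
    then have "(a+b)^2 \<le> A*B/4" using AAB by (simp add: power2_eq_square)
    then have "0 \<le> B * (A*B/4 - (a+b)^2)" using assms by simp
    moreover have "0 \<le> a*b*B" using a b assms by simp
    moreover have "2*a*b*c + A*c^2 \<le> 2*a*b*(B/2) + A*(B/2)^2" using c by (intro mono) simp
    ultimately show ?thesis by (simp add: power2_eq_square algebra_simps)
  next
    case False
    define d where "d = (A+B)/2 - (a+b)"
    have "2*a*b*c + A*c^2 \<le> 2*a*b*d + A*d^2" using s by (intro mono) (simp add: d_def field_simps)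
    moreover have "0 \<le> (A/2 - a) * (A/2 - b) * (B - d)"
      using a b assms False by (intro mult_nonneg_nonneg) (auto simp: d_def field_simps)
    moreover have "0 \<le> B * (a + b - A/2) * (A - (a+b))"
      using a b assms False by (intro mult_nonneg_nonneg) auto
    moreover have "0 \<le> A*B*(B-A)" using assms by simp
    moreover have "A*B*B/2 - 2*a*b*d - A*d^2 - B*b^2 - B*a^2 =
       2 * ((A/2 - a) * (A/2 - b) * (B - d)) + B * (a + b - A/2) * (A - (a+b)) + A*B*(B-A)/4"
      by (simp add: d_def field_simps power2_eq_square)
    ultimately show ?thesis by linarith
  qed
  with 1 show ?thesis by linarith
qed

text \<open>The four inequalities \<open>s\<close> correspond to the four sign patterns of
  (\<open>a\<close>, \<open>b\<close>, \<open>c\<close>) with negative product; in each pattern one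
  of them bounds the sum of the absolute values.\<close>

lemma gram3_reduced:
  fixes A B C a b c :: real
  assumes "0 < A" "A \<le> B" "B \<le> C" and a: "2 * \<bar>a\<bar> \<le> A"
    and b: "2 * \<bar>b\<bar> \<le> A" and c: "2 * \<bar>c\<bar> \<le> B"
    and s: "0 \<le> A + B + 2*(a+b+c)" "0 \<le> A + B + 2*(a-b-c)"
      "0 \<le> A + B + 2*(b-a-c)" "0 \<le> A + B + 2*(c-a-b)"
  shows "A*B*C \<le> 2 * (A*B*C + 2*a*b*c - A*c^2 - B*b^2 - C*a^2)"
proof (cases "a*b*c \<ge> 0")
  case True
  then have "a*b*c = \<bar>a\<bar>*\<bar>b\<bar>*\<bar>c\<bar>" by (metis abs_mult abs_of_nonneg)
  then show ?thesis using gram3_aux_nonneg[of A B C "\<bar>a\<bar>" "\<bar>b\<bar>" "\<bar>c\<bar>"] assms by simp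
next
  case False
  then have abc: "a*b*c = - (\<bar>a\<bar>*\<bar>b\<bar>*\<bar>c\<bar>)" by (metis abs_mult abs_of_nonpos linear minus_minus)
  have "2 * (\<bar>a\<bar> + \<bar>b\<bar> + \<bar>c\<bar>) \<le> A + B"
    using False s by (cases "a \<ge> 0"; cases "b \<ge> 0"; cases "c \<ge> 0"; auto simp: mult_le_0_iff zero_le_mult_iff)
  then show ?thesis using gram3_aux_neg[of A B C "\<bar>a\<bar>" "\<bar>b\<bar>" "\<bar>c\<bar>"] assms abc by simp
qed

text \<open>\<open>D\<close> is the Gram determinant of four unit vectors, the variables being 1
  minus twice the off-diagonal entries. To first order \<open>16 * D\<close> is 5 plus twice the sum
  of the variables. The claim thus leaves a linear slack of three times the sum, which pays for the
  quadratic terms while the sum is at most 1.\<close>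

lemma gram4_near_alternating:
  fixes a b c d e f :: real
  assumes nn: "0 \<le> a" "0 \<le> b" "0 \<le> c" "0 \<le> d" "0 \<le> e" "0 \<le> f"
    and s: "a + b + c + d + e + f \<le> 1"
    and D: "D = (let p = (1-a)/2; q = (1-b)/2; r = (1-c)/2; x = (1-d)/2; y = (1-e)/2; z = (1-f)/2 in
        1 - p\<^sup>2 - q\<^sup>2 - r\<^sup>2 - x\<^sup>2 - y\<^sup>2 - z\<^sup>2 + 2*p*q*x + 2*p*r*y + 2*q*r*z + 2*x*y*z
          + p\<^sup>2*z\<^sup>2 + q\<^sup>2*y\<^sup>2 + r\<^sup>2*x\<^sup>2 - 2*p*q*y*z - 2*p*r*x*z - 2*q*r*x*y)"
  shows "5 - (a + b + c + d + e + f) \<le> 16 * D"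
proof -
  have le1: "a \<le> 1" "b \<le> 1" "c \<le> 1" "d \<le> 1" "e \<le> 1" "f \<le> 1" using nn s by linarith+
  let ?s = "a + b + c + d + e + f"
  have "16 * D - (5 - ?s) = 3 * (?s * (1 - ?s))
      + 2*(a*f*(1-a)) + 2*(a*f*(1-f)) + 2*(b*e*(1-b)) + 2*(b*e*(1-e)) + 2*(c*d*(1-c)) + 2*(c*d*(1-d))
      + 4*(a*b*(1-d)) + 4*(a*c*(1-e)) + 4*(b*c*(1-f)) + 4*(d*e*(1-f))
      + 2*(a*d*(1-f*c)) + 2*(a*e*(1-f*b)) + 2*(b*d*(1-e*c))
      + (8*e*f + 8*d*f + 4*d*e + 8*c*f + 8*c*e + 2*c*d + 2*c*d*f + 2*c*d*e + c*c*d*d + 8*b*f + 2*b*e + 2*b*e*f + 6*b*d + 2*b*d*e + 4*b*c + 2*b*c*e + 2*b*c*d + b*b*e*e + 2*a*f + 6*a*e + 2*a*e*f + 6*a*d + 2*a*d*f + 4*a*c + 2*a*c*f + 2*a*c*d + 4*a*b + 2*a*b*f + 2*a*b*e + a*a*f*f)"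
    unfolding D Let_def by (simp add: field_simps power2_eq_square)
  also have "\<dots> \<ge> 0"
    using nn s le1 by (intro add_nonneg_nonneg mult_nonneg_nonneg) (simp_all add: mult_le_one)
  finally show ?thesis by simp
qed


section \<open>Three reduced vectors in an inner product space\<close>

definition gram3 :: "'a::real_inner \<Rightarrow> 'a \<Rightarrow> 'a \<Rightarrow> real" where
  "gram3 x y z = (x \<bullet> x) * (y \<bullet> y) * (z \<bullet> z) + 2 * (x \<bullet> y) * (x \<bullet> z) * (y \<bullet> z)
     - (x \<bullet> x) * (y \<bullet> z)\<^sup>2 - (y \<bullet> y) * (x \<bullet> z)\<^sup>2 - (z \<bullet> z) * (x \<bullet> y)\<^sup>2"

lemma norm_add_ge_inner:
  fixes x y :: "'a::real_inner"
  shows "norm x \<le> norm (x + y) \<longleftrightarrow> 0 \<le> y \<bullet> y + 2 * (x \<bullet> y)"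
  by (simp add: norm_le inner_add_left inner_add_right inner_commute) (simp add: add.commute)

lemma norm_diff_ge_inner:
  fixes x y :: "'a::real_inner"
  shows "norm x \<le> norm (x - y) \<longleftrightarrow> 0 \<le> y \<bullet> y - 2 * (x \<bullet> y)"
  using norm_add_ge_inner[of x "- y"] by simp

lemma gram3_ge_sorted:
  fixes x y z :: "'a::real_inner"
  assumes "x \<noteq> 0" "norm x \<le> norm y" "norm y \<le> norm z"
    and y: "\<And>s. s \<in> {-1, 1} \<Longrightarrow> norm y \<le> norm (y + s *\<^sub>R x)"
    and z: "\<And>s t. s \<in> {-1, 0, 1} \<Longrightarrow> t \<in> {-1, 0, 1} \<Longrightarrow> norm z \<le> norm (z + (s *\<^sub>R x + t *\<^sub>R y))"
  shows "(norm x)\<^sup>2 * (norm y)\<^sup>2 * (norm z)\<^sup>2 \<le> 2 * gram3 x y z"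
proof -
  note exp = norm_add_ge_inner norm_diff_ge_inner inner_diff_left inner_diff_right inner_add_left inner_add_right inner_commute
  have 1: "2 * \<bar>x \<bullet> y\<bar> \<le> x \<bullet> x" using y[of 1] y[of "-1"] by (simp add: exp)
  have 2: "2 * \<bar>x \<bullet> z\<bar> \<le> x \<bullet> x" using z[of 1 0] z[of "-1" 0] by (simp add: exp)
  have 3: "2 * \<bar>y \<bullet> z\<bar> \<le> y \<bullet> y" using z[of 0 1] z[of 0 "-1"] by (simp add: exp)
  have 4: "0 \<le> x \<bullet> x + y \<bullet> y + 2 * (x \<bullet> y + x \<bullet> z + y \<bullet> z)" using z[of 1 1] by (simp add: exp)
  have 5: "0 \<le> x \<bullet> x + y \<bullet> y + 2 * (x \<bullet> y - x \<bullet> z - y \<bullet> z)" using z[of "-1" "-1"] by (simp add: exp)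
  have 6: "0 \<le> x \<bullet> x + y \<bullet> y + 2 * (x \<bullet> z - x \<bullet> y - y \<bullet> z)" using z[of 1 "-1"] by (simp add: exp)
  have 7: "0 \<le> x \<bullet> x + y \<bullet> y + 2 * (y \<bullet> z - x \<bullet> y - x \<bullet> z)" using z[of "-1" 1] by (simp add: exp)
  have "x \<bullet> x \<le> y \<bullet> y" "y \<bullet> y \<le> z \<bullet> z" "0 < x \<bullet> x" using assms(1-3) by (simp_all add: norm_le)
  from gram3_reduced[OF this(3,1,2) 1 2 3 4 5 6 7] show ?thesis
    by (simp add: gram3_def power2_norm_eq_inner)
qed

lemma gram3_perm: "gram3 y x z = gram3 x y z" "gram3 x z y = gram3 x y z"
  by (simp_all add: gram3_def inner_commute algebra_simps)

text \<open>A basis that minimizes the sum of squared norms comes in no particular order of lengths.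
  By symmetry of the Gram determinant it may be sorted afterwards.\<close>

lemma gram3_ge:
  fixes x y z :: "'a::real_inner"
  assumes nz: "x \<noteq> 0" "y \<noteq> 0" "z \<noteq> 0"
    and x: "\<And>s t. s \<in> {-1, 0, 1} \<Longrightarrow> t \<in> {-1, 0, 1} \<Longrightarrow> norm x \<le> norm (x + (s *\<^sub>R y + t *\<^sub>R z))"
    and y: "\<And>s t. s \<in> {-1, 0, 1} \<Longrightarrow> t \<in> {-1, 0, 1} \<Longrightarrow> norm y \<le> norm (y + (s *\<^sub>R x + t *\<^sub>R z))"
    and z: "\<And>s t. s \<in> {-1, 0, 1} \<Longrightarrow> t \<in> {-1, 0, 1} \<Longrightarrow> norm z \<le> norm (z + (s *\<^sub>R x + t *\<^sub>R y))"
  shows "(norm x)\<^sup>2 * (norm y)\<^sup>2 * (norm z)\<^sup>2 \<le> 2 * gram3 x y z"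
proof -
  have sorted: "(norm x)\<^sup>2 * (norm y)\<^sup>2 * (norm z)\<^sup>2 \<le> 2 * gram3 x y z"
    if "x \<noteq> 0" "norm x \<le> norm y" "norm y \<le> norm z"
      "\<And>s t. s \<in> {-1, 0, 1} \<Longrightarrow> t \<in> {-1, 0, 1} \<Longrightarrow> norm y \<le> norm (y + (s *\<^sub>R x + t *\<^sub>R z))"
      "\<And>s t. s \<in> {-1, 0, 1} \<Longrightarrow> t \<in> {-1, 0, 1} \<Longrightarrow> norm z \<le> norm (z + (s *\<^sub>R x + t *\<^sub>R y))"
    for x y z :: 'a
    using that(4)[of _ 0] that(1,2,3,5) by (intro gram3_ge_sorted) auto
  have x': "norm x \<le> norm (x + (s *\<^sub>R z + t *\<^sub>R y))" if "s \<in> {-1, 0, 1}" "t \<in> {-1, 0, 1}" for s t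
    using x[OF that(2,1)] by (simp add: add.commute)
  have y': "norm y \<le> norm (y + (s *\<^sub>R z + t *\<^sub>R x))" if "s \<in> {-1, 0, 1}" "t \<in> {-1, 0, 1}" for s t
    using y[OF that(2,1)] by (simp add: add.commute)
  have z': "norm z \<le> norm (z + (s *\<^sub>R y + t *\<^sub>R x))" if "s \<in> {-1, 0, 1}" "t \<in> {-1, 0, 1}" for s t
    using z[OF that(2,1)] by (simp add: add.commute)
  consider "norm x \<le> norm y" "norm y \<le> norm z" | "norm x \<le> norm z" "norm z \<le> norm y"
    | "norm y \<le> norm x" "norm x \<le> norm z" | "norm y \<le> norm z" "norm z \<le> norm x"
    | "norm z \<le> norm x" "norm x \<le> norm y" | "norm z \<le> norm y" "norm y \<le> norm x"
    by linarith
  then show ?thesis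
  proof cases
    case 1 from sorted[OF nz(1) this y z] show ?thesis .
  next
    case 2 from sorted[OF nz(1) this z y] show ?thesis by (simp only: gram3_perm mult_ac)
  next
    case 3 from sorted[OF nz(2) this x z'] show ?thesis by (simp only: gram3_perm mult_ac)
  next
    case 4 from sorted[OF nz(2) this z' x] show ?thesis by (simp only: gram3_perm mult_ac)
  next
    case 5 from sorted[OF nz(3) this x' y'] show ?thesis by (simp only: gram3_perm mult_ac)
  next
    case 6 from sorted[OF nz(3) this y' x'] show ?thesis by (simp only: gram3_perm mult_ac)
  qed
qed

section \<open>Dual bases and shears\<close>

abbreviation fdet :: "('n::finite \<Rightarrow> real ^ 'n) \<Rightarrow> real" where
  "fdet v \<equiv> det (\<chi> i. v i)"

text \<open>Biorthogonality. With equal arguments it also expresses that a family is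
  orthonormal.\<close>

definition dual_pair :: "('n::finite \<Rightarrow> real ^ 'n) \<Rightarrow> ('n \<Rightarrow> real ^ 'n) \<Rightarrow> bool" where
  "dual_pair v w \<longleftrightarrow> (\<forall>i j. v i \<bullet> w j = (if i = j then 1 else 0))"

text \<open>A basis and its dual under the elementary matrices, the generators of SL_n(Z). The dual
  changes contragrediently: indices exchanged, sign reversed. Duality, determinant and membership in
  the lattice then follow by induction on the steps.\<close>

inductive shear_orbit :: "('n::finite \<Rightarrow> real ^ 'n) \<Rightarrow> ('n \<Rightarrow> real ^ 'n) \<Rightarrow> ('n \<Rightarrow> real ^ 'n) \<Rightarrow> ('n \<Rightarrow> real ^ 'n) \<Rightarrow> bool"
  for v\<^sub>0 w\<^sub>0 where
  base: "shear_orbit v\<^sub>0 w\<^sub>0 v\<^sub>0 w\<^sub>0"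
| step: "shear_orbit v\<^sub>0 w\<^sub>0 v w \<Longrightarrow> i \<noteq> j \<Longrightarrow>
    shear_orbit v\<^sub>0 w\<^sub>0 (v(i := v i + of_int c *\<^sub>R v j)) (w(j := w j - of_int c *\<^sub>R w i))"

lemma int_spanI: "(\<Sum>i\<in>UNIV. of_int (x i) *\<^sub>R v i) \<in> int_span v"
  unfolding int_span_def by blast

lemma int_span_base: "v i \<in> int_span v"
proof -
  have "v i = (\<Sum>j\<in>UNIV. of_int (if j = i then 1 else 0) *\<^sub>R v j)"
    by (simp add: if_distrib if_distribR sum.delta cong: if_cong)
  then show ?thesis using int_spanI by metis
qed

lemma int_span_add_scale:
  assumes "x \<in> int_span v" "y \<in> int_span v"
  shows "x + of_int c *\<^sub>R y \<in> int_span v"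
proof -
  obtain a b where "x = (\<Sum>i\<in>UNIV. of_int (a i) *\<^sub>R v i)" "y = (\<Sum>i\<in>UNIV. of_int (b i) *\<^sub>R v i)"
    using assms unfolding int_span_def by blast
  then have "x + of_int c *\<^sub>R y = (\<Sum>i\<in>UNIV. of_int (a i + c * b i) *\<^sub>R v i)"
    by (simp add: scaleR_sum_right sum.distrib scaleR_add_left)
  then show ?thesis using int_spanI by metis
qed

lemma shear_orbit_dual_pair: "shear_orbit v\<^sub>0 w\<^sub>0 v w \<Longrightarrow> dual_pair v\<^sub>0 w\<^sub>0 \<Longrightarrow> dual_pair v w"
proof (induction rule: shear_orbit.induct)
  case (step v w i j c)
  then show ?case
    by (simp add: dual_pair_def inner_add_left inner_diff_right inner_add_right inner_diff_left)
qed

lemma shear_orbit_int_span: "shear_orbit v\<^sub>0 w\<^sub>0 v w \<Longrightarrow> v k \<in> int_span v\<^sub>0"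
proof (induction arbitrary: k rule: shear_orbit.induct)
  case (step v w i j c)
  then show ?case by (simp add: int_span_add_scale)
qed (rule int_span_base)

text \<open>A step is also a step of the exchanged pair, with \<open>i\<close> and \<open>j\<close>
  swapped and \<open>c\<close> negated. In this way a bound for the lattice also serves for its
  dual.\<close>

lemma shear_orbit_sym: "shear_orbit v\<^sub>0 w\<^sub>0 v w \<Longrightarrow> shear_orbit w\<^sub>0 v\<^sub>0 w v"
proof (induction rule: shear_orbit.induct)
  case (step v w i j c)
  then show ?case using shear_orbit.step[OF step.IH, of j i "- c"] by (simp del: fun_upd_apply)
qed (rule shear_orbit.base)

lemma fdet_shear:
  assumes "i \<noteq> j"
  shows "fdet (v(i := v i + c *\<^sub>R v j)) = fdet v"
proof -
  have "fdet (v(i := v i + c *\<^sub>R v j))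
      = det (\<chi> k. if k = i then row i (\<chi> k. v k) + c *s row j (\<chi> k. v k) else row k (\<chi> k. v k))"
    by (rule arg_cong[of _ _ det]) (auto simp: vec_eq_iff row_def)
  also have "\<dots> = fdet v" by (rule det_row_operation[OF assms])
  finally show ?thesis .
qed

lemma shear_orbit_fdet: "shear_orbit v\<^sub>0 w\<^sub>0 v w \<Longrightarrow> fdet v = fdet v\<^sub>0"
proof (induction rule: shear_orbit.induct)
  case (step v w i j c)
  from fdet_shear[OF step.hyps(2)] step.IH show ?case by (rule trans)
qed simp

text \<open>Three shears compose to a quarter turn; the sign is forced because shears preserve the
  determinant.\<close>

lemma shear_orbit_swap:
  assumes "shear_orbit v\<^sub>0 w\<^sub>0 v w" "i \<noteq> j"
  shows "shear_orbit v\<^sub>0 w\<^sub>0 (v(i := v j, j := - v i)) (w(i := w j, j := - w i))"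
proof -
  let ?v1 = "v(i := v i + of_int 1 *\<^sub>R v j)" and ?w1 = "w(j := w j - of_int 1 *\<^sub>R w i)"
  let ?v2 = "?v1(j := ?v1 j + of_int (-1) *\<^sub>R ?v1 i)" and ?w2 = "?w1(i := ?w1 i - of_int (-1) *\<^sub>R ?w1 j)"
  let ?v3 = "?v2(i := ?v2 i + of_int 1 *\<^sub>R ?v2 j)" and ?w3 = "?w2(j := ?w2 j - of_int 1 *\<^sub>R ?w2 i)"
  have "shear_orbit v\<^sub>0 w\<^sub>0 ?v3 ?w3"
    by (intro shear_orbit.step assms assms(2)[symmetric])
  moreover have "?v3 = v(i := v j, j := - v i)" "?w3 = w(i := w j, j := - w i)"
    using assms(2) by (auto simp: fun_eq_iff)
  ultimately show ?thesis by simp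
qed

section \<open>Linear independence, determinants and dual bases\<close>

lemma lin_indep_sum_zero:
  assumes "lin_indep v" "(\<Sum>i\<in>UNIV. x i *\<^sub>R v i) = 0"
  shows "x k = 0"
proof -
  have inj: "inj v" and ind: "independent (range v)" using assms by (auto simp: lin_indep_def)
  have "(\<Sum>y\<in>range v. x (inv v y) *\<^sub>R y) = 0"
    using assms(2) by (simp add: sum.reindex[OF inj] inj)
  then have "x (inv v (v k)) = 0"
    using independentD[OF ind, of "range v" "\<lambda>y. x (inv v y)"] by auto
  then show ?thesis by (simp add: inj)
qed

lemma lin_indepI_dual: "dual_pair v w \<Longrightarrow> lin_indep v"
proof -
  assume d: "dual_pair v w"
  have inj: "inj v"
  proof (rule injI)
    fix i j assume "v i = v j"
    then have "v i \<bullet> w j = v j \<bullet> w j" by simp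
    then show "i = j" using d by (auto simp: dual_pair_def split: if_splits)
  qed
  have "independent (range v)"
  proof (rule independent_if_scalars_zero)
    fix f x assume s: "(\<Sum>x\<in>range v. f x *\<^sub>R x) = 0" and "x \<in> range v"
    then obtain k where k: "x = v k" by auto
    have "0 = (\<Sum>i\<in>UNIV. f (v i) *\<^sub>R v i) \<bullet> w k"
      using s by (simp add: sum.reindex[OF inj])
    also have "\<dots> = f (v k)"
      using d by (simp add: inner_sum_left dual_pair_def sum.delta if_distrib[of "times _"] cong: if_cong)
    finally show "f x = 0" using k by simp
  qed simp
  with inj show ?thesis by (simp add: lin_indep_def)
qed

lemma fdet_nonzero_dual_pair:
  fixes v :: "'n::finite \<Rightarrow> real ^ 'n"
  assumes "fdet v \<noteq> 0"
  shows "\<exists>w. dual_pair v w"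
proof -
  have "invertible (\<chi> i. v i)" using assms by (simp add: invertible_det_nz)
  then obtain B where B: "(\<chi> i. v i) ** B = mat 1" unfolding invertible_def by blast
  have "dual_pair v (\<lambda>j. column j B)"
    unfolding dual_pair_def
  proof (intro allI)
    fix i j
    have "((\<chi> i. v i) ** B) $ i $ j = v i \<bullet> column j B"
      by (simp add: matrix_matrix_mult_def inner_vec_def column_def)
    then show "v i \<bullet> column j B = (if i = j then 1 else 0)" using B by (simp add: mat_def)
  qed
  then show ?thesis by blast
qed

lemma lin_indep_iff_fdet: "lin_indep v \<longleftrightarrow> fdet v \<noteq> 0" for v :: "'n::finite \<Rightarrow> real ^ 'n"
proof
  assume v: "lin_indep v"
  show "fdet v \<noteq> 0"
  proof (rule ccontr)
    assume "\<not> fdet v \<noteq> 0"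
    then have "\<not> invertible (transpose (\<chi> i. v i))" by (simp add: invertible_det_nz det_transpose)
    then obtain x where "x \<noteq> 0" "transpose (\<chi> i. v i) *v x = 0"
      using matrix_left_invertible_ker invertible_left_inverse by blast
    then have "(\<Sum>i\<in>UNIV. x $ i *\<^sub>R v i) = 0"
      by (simp add: vec_eq_iff matrix_vector_mult_def transpose_def mult.commute)
    from lin_indep_sum_zero[OF v this] \<open>x \<noteq> 0\<close> show False by (simp add: vec_eq_iff)
  qed
qed (use fdet_nonzero_dual_pair lin_indepI_dual in blast)

lemma inner_matrix: "(\<chi> i. v i) ** transpose (\<chi> i. w i) = (\<chi> i j. v i \<bullet> w j)"
  for v w :: "'n::finite \<Rightarrow> real ^ 'n"
  by (simp add: vec_eq_iff matrix_matrix_mult_def transpose_def inner_vec_def)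

lemma fdet_mult: "fdet v * fdet w = det (\<chi> i j. v i \<bullet> w j)"
  unfolding inner_matrix[symmetric] by (simp only: det_mul det_transpose)

lemma dual_pair_exists:
  assumes "lin_indep v"
  obtains w where "dual_pair v w"
  using assms fdet_nonzero_dual_pair lin_indep_iff_fdet by blast

lemma dual_pair_fdet: "dual_pair v w \<Longrightarrow> fdet v * fdet w = 1"
  unfolding fdet_mult dual_pair_def by (simp add: mat_def[symmetric])

lemma dual_pair_sym: "dual_pair v w \<Longrightarrow> dual_pair w v"
  by (simp add: dual_pair_def inner_commute)

lemma dual_pair_nonzero: "dual_pair v w \<Longrightarrow> v i \<noteq> 0"
  unfolding dual_pair_def by (metis inner_zero_left zero_neq_one)

section \<open>Short lattice vectors and the existence of minimizers\<close>

text \<open>The integer coefficients are inner products with the dual basis, hence bounded by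
  Cauchy-Schwarz.\<close>

lemma finite_int_span_le:
  fixes v :: "'n::finite \<Rightarrow> real ^ 'n"
  assumes "lin_indep v"
  shows "finite {x \<in> int_span v. norm x \<le> r}"
proof -
  obtain w where w: "dual_pair v w" using dual_pair_exists[OF assms] .
  define K where "K = (\<Sum>i\<in>UNIV. \<lceil>\<bar>r\<bar> * norm (w i)\<rceil>)"
  have Kge: "\<bar>r\<bar> * norm (w i) \<le> of_int K" for i
  proof -
    have "\<lceil>\<bar>r\<bar> * norm (w i)\<rceil> \<le> K" unfolding K_def
      by (rule member_le_sum) (auto intro: order.strict_trans2[of _ 0])
    then show ?thesis by linarith
  qed
  have "{x \<in> int_span v. norm x \<le> r} \<subseteq> (\<lambda>a. \<Sum>i\<in>UNIV. of_int (a i) *\<^sub>R v i) ` (UNIV \<rightarrow>\<^sub>E {-K..K})"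
  proof
    fix x assume x: "x \<in> {x \<in> int_span v. norm x \<le> r}"
    then obtain a where a: "x = (\<Sum>i\<in>UNIV. of_int (a i) *\<^sub>R v i)" unfolding int_span_def by blast
    have "a i \<in> {-K..K}" for i
    proof -
      have "of_int (a i) = x \<bullet> w i"
        using w by (simp add: a inner_sum_left dual_pair_def sum.delta if_distrib[of "times _"] cong: if_cong)
      then have "\<bar>of_int (a i)\<bar> \<le> norm x * norm (w i)" by (simp add: Cauchy_Schwarz_ineq2)
      also have "\<dots> \<le> \<bar>r\<bar> * norm (w i)" using x by (intro mult_right_mono) auto
      finally have "\<bar>of_int (a i) :: real\<bar> \<le> of_int K" using Kge[of i] by linarith
      then show ?thesis by (simp add: abs_le_iff)
    qed
    then show "x \<in> (\<lambda>a. \<Sum>i\<in>UNIV. of_int (a i) *\<^sub>R v i) ` (UNIV \<rightarrow>\<^sub>E {-K..K})"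
      using a by auto
  qed
  moreover have "finite ((UNIV :: 'n set) \<rightarrow>\<^sub>E {-K..K})" by (intro finite_PiE) auto
  ultimately show ?thesis by (meson finite_imageI finite_subset)
qed

text \<open>Finiteness is asked of the values, not of the arguments: when only some vectors of a
  basis are minimized, the others stay free and infinitely many bases lie below a bound.\<close>

lemma ex_min_if_finite_below:
  fixes f :: "'b \<Rightarrow> real"
  assumes "x \<in> X" "\<And>r. finite (f ` {x \<in> X. f x \<le> r})"
  obtains y where "y \<in> X" "\<And>z. z \<in> X \<Longrightarrow> f y \<le> f z"
proof -
  let ?F = "f ` {z \<in> X. f z \<le> f x}"
  have ne: "?F \<noteq> {}" using assms(1) by auto
  have "Min ?F \<in> ?F" by (rule Min_in[OF assms(2) ne])
  then obtain y where y: "y \<in> X" "f y = Min ?F" by auto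
  have "f y \<le> f z" if "z \<in> X" for z
  proof (cases "f z \<le> f x")
    case True
    then show ?thesis unfolding y(2) using that by (intro Min_le[OF assms(2)]) auto
  next
    case False
    have "f y \<le> f x" unfolding y(2) using assms(1) by (intro Min_le[OF assms(2)]) auto
    with False show ?thesis by simp
  qed
  with y(1) show ?thesis by (rule that)
qed

lemma finite_sum_norm_int_span:
  fixes v\<^sub>0 :: "'n::finite \<Rightarrow> real ^ 'n"
  assumes "lin_indep v\<^sub>0" "finite I" and X: "\<And>v i. v \<in> X \<Longrightarrow> v i \<in> int_span v\<^sub>0"
  shows "finite ((\<lambda>v. \<Sum>i\<in>I. (norm (v i))\<^sup>2) ` {v \<in> X. (\<Sum>i\<in>I. (norm (v i))\<^sup>2) \<le> r})"
proof -
  let ?S = "{x \<in> int_span v\<^sub>0. norm x \<le> sqrt r}"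
  have "(\<lambda>v. \<Sum>i\<in>I. (norm (v i))\<^sup>2) ` {v \<in> X. (\<Sum>i\<in>I. (norm (v i))\<^sup>2) \<le> r}
     \<subseteq> (\<lambda>v. \<Sum>i\<in>I. (norm (v i))\<^sup>2) ` (I \<rightarrow>\<^sub>E ?S)"
  proof clarify
    fix v assume v: "v \<in> X" "(\<Sum>i\<in>I. (norm (v i))\<^sup>2) \<le> r"
    have "(norm (v i))\<^sup>2 \<le> r" if "i \<in> I" for i
      using member_le_sum[of i I "\<lambda>i. (norm (v i))\<^sup>2"] that v(2) assms(2) by simp
    then have "norm (v i) \<le> sqrt r" if "i \<in> I" for i
      using that by (simp add: real_le_rsqrt)
    then have "restrict v I \<in> I \<rightarrow>\<^sub>E ?S" using X[OF v(1)] by auto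
    then show "(\<Sum>i\<in>I. (norm (v i))\<^sup>2) \<in> (\<lambda>v. \<Sum>i\<in>I. (norm (v i))\<^sup>2) ` (I \<rightarrow>\<^sub>E ?S)"
      by (rule image_eqI[rotated]) simp
  qed
  moreover have "finite (I \<rightarrow>\<^sub>E ?S)" using finite_int_span_le[OF assms(1)] assms(2) by (intro finite_PiE) auto
  ultimately show ?thesis by (meson finite_imageI finite_subset)
qed

text \<open>The covolume of the sublattice orthogonal to a dual vector is the covolume of the
  lattice times the length of that vector. Replacing \<open>v 1\<close> by \<open>w 1\<close>, which
  is orthogonal to the other three vectors, gives \<open>?u\<close> with
  \<open>fdet ?u * fdet v = ?g\<close> and
  \<open>fdet ?u * fdet ?u = (w 1 \<bullet> w 1) * ?g\<close>. Eliminating \<open>fdet ?u\<close>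
  and cancelling \<open>?g\<close> leaves the formula.\<close>

lemma gram3_dual:
  fixes v w :: "4 \<Rightarrow> real ^ 4"
  assumes d: "dual_pair v w" and pos: "gram3 (v 2) (v 3) (v 4) \<noteq> 0"
  shows "gram3 (v 2) (v 3) (v 4) = (fdet v)\<^sup>2 * (norm (w 1))\<^sup>2"
proof -
  let ?u = "v(1 := w 1)" and ?g = "gram3 (v 2) (v 3) (v 4)"
  have vw: "v i \<bullet> w j = (if i = j then 1 else 0)" "w j \<bullet> v i = (if i = j then 1 else 0)" for i j
    using d dual_pair_sym[OF d] by (auto simp: dual_pair_def)
  note c = inner_commute[of "v 3" "v 2"] inner_commute[of "v 4" "v 2"] inner_commute[of "v 4" "v 3"]
  have ne: "(2::4) \<noteq> 1" "(3::4) \<noteq> 1" "(4::4) \<noteq> 1" "(1::4) \<noteq> 2" "(1::4) \<noteq> 3" "(1::4) \<noteq> 4" by simp_all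
  have "fdet ?u * fdet v =
      v 2 \<bullet> v 2 * (v 3 \<bullet> v 3) * (v 4 \<bullet> v 4) + v 2 \<bullet> v 3 * (v 3 \<bullet> v 4) * (v 4 \<bullet> v 2)
      + v 2 \<bullet> v 4 * (v 3 \<bullet> v 2) * (v 4 \<bullet> v 3) - v 2 \<bullet> v 2 * (v 3 \<bullet> v 4) * (v 4 \<bullet> v 3)
      - v 2 \<bullet> v 3 * (v 3 \<bullet> v 2) * (v 4 \<bullet> v 4) - v 2 \<bullet> v 4 * (v 3 \<bullet> v 3) * (v 4 \<bullet> v 2)"
    unfolding fdet_mult unfolding det_4 by (simp add: vw ne)
  then have 1: "fdet ?u * fdet v = ?g"
    unfolding c gram3_def power2_eq_square by (simp only: algebra_simps)
  have "fdet ?u * fdet ?u = (w 1 \<bullet> w 1) *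
     (v 2 \<bullet> v 2 * (v 3 \<bullet> v 3) * (v 4 \<bullet> v 4) + v 2 \<bullet> v 3 * (v 3 \<bullet> v 4) * (v 4 \<bullet> v 2)
      + v 2 \<bullet> v 4 * (v 3 \<bullet> v 2) * (v 4 \<bullet> v 3) - v 2 \<bullet> v 2 * (v 3 \<bullet> v 4) * (v 4 \<bullet> v 3)
      - v 2 \<bullet> v 3 * (v 3 \<bullet> v 2) * (v 4 \<bullet> v 4) - v 2 \<bullet> v 4 * (v 3 \<bullet> v 3) * (v 4 \<bullet> v 2))"
    unfolding fdet_mult unfolding det_4 by (simp add: vw ne)
  then have 2: "fdet ?u * fdet ?u = (w 1 \<bullet> w 1) * ?g"
    unfolding c gram3_def power2_eq_square by (simp only: algebra_simps)
  have "?g * ?g = (fdet ?u * fdet ?u) * (fdet v * fdet v)" by (simp only: 1[symmetric] mult_ac)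
  also have "\<dots> = ((fdet v)\<^sup>2 * (norm (w 1))\<^sup>2) * ?g"
    unfolding 2 power2_eq_square power2_norm_eq_inner[unfolded power2_eq_square] by (simp only: mult_ac)
  finally have "?g = (fdet v)\<^sup>2 * (norm (w 1))\<^sup>2 \<or> ?g = 0" unfolding mult_cancel_right by blast
  with pos show ?thesis by blast
qed

section \<open>Determinants of Minkowski reduced bases\<close>

lemma unit_coeff_int:
  assumes "s \<in> {-1, 0, 1 :: real}"
  shows "\<exists>c::int. s = of_int c"
proof -
  from assms consider "s = of_int (-1)" | "s = of_int 0" | "s = of_int 1" by auto
  then show ?thesis by cases blast+
qed

section \<open>Mordell's inequality and Hermite's constant in dimension four\<close>

lemma shear_orbit_index_one:
  fixes v\<^sub>0 w\<^sub>0 :: "4 \<Rightarrow> real ^ 4"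
  assumes "shear_orbit v\<^sub>0 w\<^sub>0 v w"
  obtains v' w' where "shear_orbit v\<^sub>0 w\<^sub>0 v' w'" "v' 1 = v i" "w' 1 = w i"
proof (cases "i = 1")
  case False
  from shear_orbit_swap[OF assms False[symmetric]] show ?thesis
    by (rule that) (use False in auto)
qed (use that assms in blast)

text \<open>Mordell's argument: a shortest vector of the dual lattice is orthogonal to a three-dimensional
  sublattice, whose determinant is bounded below by its reduced basis.\<close>

lemma mordell:
  fixes v\<^sub>0 w\<^sub>0 :: "4 \<Rightarrow> real ^ 4"
  assumes d: "dual_pair v\<^sub>0 w\<^sub>0"
    and m: "\<And>v w i. shear_orbit v\<^sub>0 w\<^sub>0 v w \<Longrightarrow> m \<le> (norm (v i))\<^sup>2" and m0: "0 < m"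
    and o: "shear_orbit v\<^sub>0 w\<^sub>0 v w"
  shows "m ^ 3 \<le> 2 * (fdet v\<^sub>0)\<^sup>2 * (norm (w i))\<^sup>2"
proof -
  obtain v1 w1 where o1: "shear_orbit v\<^sub>0 w\<^sub>0 v1 w1" "w1 1 = w i"
    by (rule shear_orbit_index_one[OF o]) blast
  define I where "I = {2, 3, 4 :: 4}"
  \<comment> \<open>All members of \<open>X\<close> have \<open>w i\<close> as dual vector at index
    1, so their vectors 2, 3, 4 lie in the hyperplane orthogonal to \<open>w i\<close>. Only these
    three are minimized.\<close>
  define X where "X = {v. \<exists>w'. shear_orbit v\<^sub>0 w\<^sub>0 v w' \<and> w' 1 = w i}"
  have v1X: "v1 \<in> X" using o1 by (auto simp: X_def)
  have span: "v k \<in> int_span v\<^sub>0" if "v \<in> X" for v k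
    using that shear_orbit_int_span by (auto simp: X_def)
  have fin: "finite ((\<lambda>v. \<Sum>i\<in>I. (norm (v i))\<^sup>2) ` {v \<in> X. (\<Sum>i\<in>I. (norm (v i))\<^sup>2) \<le> r})" for r
    by (rule finite_sum_norm_int_span[OF lin_indepI_dual[OF d]]) (auto simp: I_def intro: span)
  obtain y where y: "y \<in> X" "\<And>z. z \<in> X \<Longrightarrow> (\<Sum>i\<in>I. (norm (y i))\<^sup>2) \<le> (\<Sum>i\<in>I. (norm (z i))\<^sup>2)"
    by (rule ex_min_if_finite_below[OF v1X fin]) blast
  then obtain z where oz: "shear_orbit v\<^sub>0 w\<^sub>0 y z" "z 1 = w i" by (auto simp: X_def)
  \<comment> \<open>Adding a multiple of \<open>y' k\<close> changes the dual family only at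
    \<open>k\<close>, so \<open>w i\<close> stays in place at index 1 when \<open>k\<close> is
    another index.\<close>
  have shear: "\<exists>z'. shear_orbit v\<^sub>0 w\<^sub>0 (y'(j := y' j + of_int c *\<^sub>R y' k)) z' \<and> z' 1 = w i"
    if "\<exists>z'. shear_orbit v\<^sub>0 w\<^sub>0 y' z' \<and> z' 1 = w i" "j \<noteq> k" "k \<noteq> 1" for y' j k c
  proof -
    from that(1) obtain z' where z': "shear_orbit v\<^sub>0 w\<^sub>0 y' z'" "z' 1 = w i" by blast
    show ?thesis
      using shear_orbit.step[OF z'(1) that(2), of c] z'(2) that(3)
      by (intro exI[of _ "z'(k := z' k - of_int c *\<^sub>R z' j)"]) (simp add: fun_upd_other)
  qed
  \<comment> \<open>Two shears alter the vector at \<open>j\<close> alone, so minimality of the sum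
    is minimality of this one summand.\<close>
  have red: "norm (y j) \<le> norm (y j + (of_int c *\<^sub>R y k + of_int e *\<^sub>R y l))"
    if jkl: "{j, k, l} = I" "j \<noteq> k" "j \<noteq> l" "k \<noteq> l" for j k l c e
  proof -
    have "k \<in> I" "l \<in> I" using jkl(1) by auto
    then have ne1: "k \<noteq> 1" "l \<noteq> 1" by (auto simp: I_def)
    let ?y = "y(j := y j + (of_int c *\<^sub>R y k + of_int e *\<^sub>R y l))"
    let ?y1 = "y(j := y j + of_int c *\<^sub>R y k)"
    have "\<exists>z'. shear_orbit v\<^sub>0 w\<^sub>0 (?y1(j := ?y1 j + of_int e *\<^sub>R ?y1 l)) z' \<and> z' 1 = w i"
      using oz by (intro shear jkl ne1) blast
    moreover have "?y1(j := ?y1 j + of_int e *\<^sub>R ?y1 l) = ?y"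
      using jkl by (auto simp: fun_eq_iff)
    ultimately have "?y \<in> X" by (simp add: X_def)
    from y(2)[OF this] have "(\<Sum>i\<in>{j, k, l}. (norm (y i))\<^sup>2) \<le> (\<Sum>i\<in>{j, k, l}. (norm (?y i))\<^sup>2)"
      by (simp only: jkl(1))
    then have "(norm (y j))\<^sup>2 \<le> (norm (?y j))\<^sup>2" using jkl(2-4) by simp
    then show ?thesis by (simp add: power2_le_iff_abs_le)
  qed
  have red': "norm (y j) \<le> norm (y j + (s *\<^sub>R y k + t *\<^sub>R y l))"
    if "s \<in> {-1, 0, 1}" "t \<in> {-1, 0, 1}" "{j, k, l} = I" "j \<noteq> k" "j \<noteq> l" "k \<noteq> l" for j k l s t
    using red[OF that(3-6)] unit_coeff_int[OF that(1)] unit_coeff_int[OF that(2)] by blast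
  have dy: "dual_pair y z" using shear_orbit_dual_pair[OF oz(1) d] .
  let ?g = "gram3 (y 2) (y 3) (y 4)"
  have g: "(norm (y 2))\<^sup>2 * (norm (y 3))\<^sup>2 * (norm (y 4))\<^sup>2 \<le> 2 * ?g"
    by (intro gram3_ge red' dual_pair_nonzero[OF dy]) (auto simp: I_def)
  have "m ^ 3 = m * m * m" by (simp add: power3_eq_cube)
  also have "\<dots> \<le> (norm (y 2))\<^sup>2 * (norm (y 3))\<^sup>2 * (norm (y 4))\<^sup>2"
    using m[OF oz(1)] m0 by (intro mult_mono) auto
  finally have mg: "m ^ 3 \<le> 2 * ?g" using g by linarith
  then have "?g \<noteq> 0" using zero_less_power[OF m0, of 3] by linarith
  from gram3_dual[OF dy this] have "?g = (fdet v\<^sub>0)\<^sup>2 * (norm (w i))\<^sup>2"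
    using shear_orbit_fdet[OF oz(1)] oz(2) by simp
  with mg show ?thesis by simp
qed

lemma shear_orbit_min:
  fixes v\<^sub>0 w\<^sub>0 :: "'n::finite \<Rightarrow> real ^ 'n"
  assumes d: "dual_pair v\<^sub>0 w\<^sub>0"
  obtains v w i where "shear_orbit v\<^sub>0 w\<^sub>0 v w"
    "\<And>v' w' j. shear_orbit v\<^sub>0 w\<^sub>0 v' w' \<Longrightarrow> (norm (v i))\<^sup>2 \<le> (norm (v' j))\<^sup>2"
proof -
  define X where "X = {v i | v i. \<exists>w. shear_orbit v\<^sub>0 w\<^sub>0 v w}"
  have X: "v\<^sub>0 undefined \<in> X" using shear_orbit.base by (auto simp: X_def)
  have "{x \<in> X. norm x \<le> r} \<subseteq> {x \<in> int_span v\<^sub>0. norm x \<le> r}" for r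
    using shear_orbit_int_span by (auto simp: X_def)
  then have "finite {x \<in> X. norm x \<le> r}" for r
    using finite_int_span_le[OF lin_indepI_dual[OF d]] finite_subset by blast
  then have fin: "finite (norm ` {x \<in> X. norm x \<le> r})" for r by blast
  obtain x where x: "x \<in> X" "\<And>z. z \<in> X \<Longrightarrow> norm x \<le> norm z"
    by (rule ex_min_if_finite_below[OF X fin]) blast
  then obtain v i w where v: "x = v i" "shear_orbit v\<^sub>0 w\<^sub>0 v w" by (auto simp: X_def)
  have "(norm (v i))\<^sup>2 \<le> (norm (v' j))\<^sup>2" if "shear_orbit v\<^sub>0 w\<^sub>0 v' w'" for v' w' j
    using x(2)[of "v' j"] that by (auto simp: X_def v(1) intro!: power_mono)
  with v(2) show ?thesis by (rule that)
qed

text \<open>Let \<open>m\<close> and \<open>M\<close> be the least squared norms in the orbits of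
  the basis and of its dual. Mordell's inequality in both directions gives
  \<open>m^3 <= 2*D*M\<close> and \<open>M^3 <= 2*E*m\<close> with \<open>D*E = 1\<close>.
  Eliminating \<open>M\<close> yields \<open>m^8 <= 16*D^2\<close>, so the fourth power of Hermite's
  constant is at most 4, its value for D_4.\<close>

lemma hermite_4:
  fixes v\<^sub>0 w\<^sub>0 :: "4 \<Rightarrow> real ^ 4"
  assumes d: "dual_pair v\<^sub>0 w\<^sub>0"
    and ge1: "\<And>v w i. shear_orbit v\<^sub>0 w\<^sub>0 v w \<Longrightarrow> 1 \<le> norm (v i)"
  shows "1 \<le> 4 * (fdet v\<^sub>0)\<^sup>2"
proof -
  obtain v w i where vw: "shear_orbit v\<^sub>0 w\<^sub>0 v w"
    "\<And>v' w' j. shear_orbit v\<^sub>0 w\<^sub>0 v' w' \<Longrightarrow> (norm (v i))\<^sup>2 \<le> (norm (v' j))\<^sup>2"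
    by (rule shear_orbit_min[OF d]) blast
  obtain v' w' k where vw': "shear_orbit w\<^sub>0 v\<^sub>0 w' v'"
    "\<And>v'' w'' j. shear_orbit w\<^sub>0 v\<^sub>0 v'' w'' \<Longrightarrow> (norm (w' k))\<^sup>2 \<le> (norm (v'' j))\<^sup>2"
    by (rule shear_orbit_min[OF dual_pair_sym[OF d]]) blast
  define m where "m = (norm (v i))\<^sup>2"
  define M where "M = (norm (w' k))\<^sup>2"
  define D where "D = (fdet v\<^sub>0)\<^sup>2"
  define E where "E = (fdet w\<^sub>0)\<^sup>2"
  have DE: "D * E = 1" using dual_pair_fdet[OF d] by (simp add: D_def E_def power_mult_distrib[symmetric])
  have m1: "1 \<le> m" using ge1[OF vw(1)] by (simp add: m_def)
  have "dual_pair w' v'" using shear_orbit_dual_pair[OF vw'(1) dual_pair_sym[OF d]] .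
  then have M0: "0 < M" using dual_pair_nonzero by (simp add: M_def) blast
  have 1: "m ^ 3 \<le> 2 * D * M"
    unfolding D_def M_def
    by (rule mordell[OF d _ _ shear_orbit_sym[OF vw'(1)]]) (use vw(2) m1 in \<open>auto simp: m_def\<close>)
  have 2: "M ^ 3 \<le> 2 * E * m"
    unfolding E_def m_def
    by (rule mordell[OF dual_pair_sym[OF d] _ _ shear_orbit_sym[OF vw(1)]]) (use vw'(2) M0 in \<open>auto simp: M_def\<close>)
  have D0: "0 \<le> D" by (simp add: D_def)
  have "m ^ 9 = (m ^ 3) ^ 3" by simp
  also have "\<dots> \<le> (2 * D * M) ^ 3" using 1 m1 by (intro power_mono) auto
  also have "\<dots> = 8 * D ^ 3 * M ^ 3" by (simp add: power_mult_distrib)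
  also have "\<dots> \<le> 8 * D ^ 3 * (2 * E * m)" using 2 D0 by (intro mult_left_mono) auto
  also have "\<dots> = 16 * D ^ 2 * (D * E) * m" by (simp add: power2_eq_square power3_eq_cube)
  also have "\<dots> = 16 * D ^ 2 * m" by (simp add: DE)
  finally have "m ^ 8 * m \<le> 16 * D ^ 2 * m" by (simp add: power_Suc2[symmetric] del: power_Suc)
  then have "m ^ 8 \<le> 16 * D ^ 2" using m1 by simp
  moreover have "1 \<le> m ^ 8" using m1 by (rule one_le_power)
  ultimately have "1\<^sup>2 \<le> (4 * D)\<^sup>2" by (simp add: power_mult_distrib)
  then have "1 \<le> 4 * D" by (rule power2_le_imp_le) (use D0 in simp)
  then show ?thesis by (simp add: D_def)
qed

section \<open>Minkowski's second theorem for reduced bases\<close>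

text \<open>Gram-Schmidt: \<open>e k\<close> is a unit vector in the span of the vectors up to
  \<open>k\<close>, orthogonal to the span of those before \<open>k\<close>.\<close>

lemma orthonormal_flag:
  fixes v :: "'n::{finite,linorder} \<Rightarrow> real ^ 'n::_"
  assumes "lin_indep v"
  obtains e :: "'n \<Rightarrow> real ^ 'n::_"
    where "dual_pair e e" "\<And>i j. i < j \<Longrightarrow> v i \<bullet> e j = 0"
proof -
  have inj: "inj v" and ind: "independent (range v)" using assms by (auto simp: lin_indep_def)
  have "\<exists>e. norm e = 1 \<and> e \<in> span (v ` {..k}) \<and> (\<forall>y\<in>span (v ` {..<k}). orthogonal e y)" for k
  proof -
    have "v k \<notin> span (v ` {..<k})"
    proof
      assume "v k \<in> span (v ` {..<k})"
      moreover have "v ` {..<k} \<subseteq> range v - {v k}" using inj by (auto simp: inj_eq)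
      ultimately have "v k \<in> span (range v - {v k})" using span_mono by blast
      with ind show False unfolding dependent_def by auto
    qed
    moreover have "v k \<in> span (v ` {..k})" by (intro span_base) auto
    moreover have "span (v ` {..<k}) \<subseteq> span (v ` {..k})" by (intro span_mono) auto
    ultimately have "span (v ` {..<k}) \<subset> span (v ` {..k})" by blast
    then obtain x where x: "x \<noteq> 0" "x \<in> span (v ` {..k})" "\<And>y. y \<in> span (v ` {..<k}) \<Longrightarrow> orthogonal x y"
      using orthogonal_to_subspace_exists_gen by blast
    then show ?thesis
      by (intro exI[of _ "x /\<^sub>R norm x"]) (auto intro: span_mul simp: orthogonal_clauses)
  qed
  then obtain e where e: "\<And>k. norm (e k) = 1" "\<And>k. e k \<in> span (v ` {..k})"
    "\<And>k y. y \<in> span (v ` {..<k}) \<Longrightarrow> orthogonal (e k) y" by metis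
  have lt: "e j \<bullet> e i = 0" if "i < j" for i j
  proof -
    have "v ` {..i} \<subseteq> v ` {..<j}" using that by auto
    then have "e i \<in> span (v ` {..<j})" using e(2)[of i] span_mono by blast
    from e(3)[OF this] show ?thesis by (simp add: orthogonal_def)
  qed
  have "e i \<bullet> e j = (if i = j then 1 else 0)" for i j
    using lt[of i j] lt[of j i] e(1)[of i] by (cases i j rule: linorder_cases) (auto simp: inner_commute norm_eq_1)
  moreover have "v i \<bullet> e j = 0" if "i < j" for i j
    using e(3)[of "v i" j] that by (auto simp: orthogonal_def inner_commute intro: span_base)
  ultimately show ?thesis by (intro that[of e]) (auto simp: dual_pair_def)
qed

text \<open>Rounding a coefficient to one of its two integer neighbours, the mean of the two squared norms with
  weights making the mean shift zero is at most \<open>norm v\<close> squared over four.\<close>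

lemma rounding_step:
  fixes z v :: "'a::real_inner"
  obtains r :: int where "(norm (z + (of_int r - \<theta>) *\<^sub>R v))\<^sup>2 \<le> (norm z)\<^sup>2 + (norm v)\<^sup>2 / 4"
proof -
  define f where "f = frac \<theta>"
  have f: "0 \<le> f" "f \<le> 1" by (simp_all add: f_def frac_lt_1 less_imp_le)
  have e: "(norm (z + s *\<^sub>R v))\<^sup>2 = (norm z)\<^sup>2 + 2 * s * (z \<bullet> v) + s\<^sup>2 * (norm v)\<^sup>2" for s
    unfolding power2_norm_eq_inner by (simp add: inner_add_left inner_add_right inner_commute power2_eq_square)
  have "(1 - f) * (norm (z + (- f) *\<^sub>R v))\<^sup>2 + f * (norm (z + (1 - f) *\<^sub>R v))\<^sup>2
      = (norm z)\<^sup>2 + f * (1 - f) * (norm v)\<^sup>2"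
    unfolding e by (simp add: algebra_simps power2_eq_square)
  also have "\<dots> \<le> (norm z)\<^sup>2 + (norm v)\<^sup>2 / 4"
  proof -
    have "f * (1 - f) \<le> 1 / 4" using zero_le_power2[of "f - 1/2"] by (simp add: power2_eq_square algebra_simps)
    from mult_right_mono[OF this, of "(norm v)\<^sup>2"] show ?thesis by simp
  qed
  finally have le: "(1 - f) * (norm (z + (- f) *\<^sub>R v))\<^sup>2 + f * (norm (z + (1 - f) *\<^sub>R v))\<^sup>2
      \<le> (norm z)\<^sup>2 + (norm v)\<^sup>2 / 4" (is "_ * ?a + _ * ?b \<le> ?c") .
  have "?a \<le> ?c \<or> ?b \<le> ?c"
  proof (rule ccontr)
    assume "\<not> ?thesis"
    then have "?c < ?a" "?c < ?b" by auto
    then have a: "(1 - f) * ?c \<le> (1 - f) * ?a" and b: "?c < ?a" "?c < ?b"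
      using f by (auto intro: mult_left_mono)
    have c: "(1 - f) * ?c + f * ?c = ?c" by (simp only: distrib_right[symmetric]) simp
    show False
    \<comment> \<open>At \<open>f = 0\<close> the second weight vanishes, and the strict inequality
      has to come from the first neighbour.\<close>
    proof (cases "f = 0")
      case False
      then have "f * ?c < f * ?b" using f b by (intro mult_strict_left_mono) auto
      with a c le show False by linarith
    qed (use b le in simp)
  qed
  then show ?thesis
  proof
    assume "?a \<le> ?c" then show ?thesis by (intro that[of "\<lfloor>\<theta>\<rfloor>"]) (simp add: f_def frac_def)
  next
    assume "?b \<le> ?c" then show ?thesis by (intro that[of "\<lfloor>\<theta>\<rfloor> + 1"]) (simp add: f_def frac_def algebra_simps)
  qed
qed

text \<open>Each coefficient is rounded in turn and costs at most a quarter of the squared norm of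
  its vector. The vectors need not be orthogonal, since in each step the averaging removes the cross
  term.\<close>

lemma rounding:
  fixes v :: "'i \<Rightarrow> 'a::real_inner" and \<theta> :: "'i \<Rightarrow> real"
  assumes "finite I"
  shows "\<exists>r :: 'i \<Rightarrow> int. (norm (z + (\<Sum>i\<in>I. (of_int (r i) - \<theta> i) *\<^sub>R v i)))\<^sup>2
     \<le> (norm z)\<^sup>2 + (\<Sum>i\<in>I. (norm (v i))\<^sup>2 / 4)"
  using assms
proof (induction I)
  case (insert k I)
  then obtain r where r: "(norm (z + (\<Sum>i\<in>I. (of_int (r i) - \<theta> i) *\<^sub>R v i)))\<^sup>2
     \<le> (norm z)\<^sup>2 + (\<Sum>i\<in>I. (norm (v i))\<^sup>2 / 4)" by blast
  obtain q :: int where q: "(norm ((z + (\<Sum>i\<in>I. (of_int (r i) - \<theta> i) *\<^sub>R v i)) + (of_int q - \<theta> k) *\<^sub>R v k))\<^sup>2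
    \<le> (norm (z + (\<Sum>i\<in>I. (of_int (r i) - \<theta> i) *\<^sub>R v i)))\<^sup>2 + (norm (v k))\<^sup>2 / 4"
    by (rule rounding_step)
  let ?r = "r(k := q)"
  have "(\<Sum>i\<in>I. (of_int (?r i) - \<theta> i) *\<^sub>R v i) = (\<Sum>i\<in>I. (of_int (r i) - \<theta> i) *\<^sub>R v i)"
    using insert.hyps by (intro sum.cong) auto
  then show ?case
    using r q insert.hyps by (intro exI[of _ ?r]) (simp add: algebra_simps)
qed simp


lemma minimal_basis_le:
  fixes v :: "'n::{finite,linorder} \<Rightarrow> real ^ 'n::_"
  assumes "minimal_basis L v" "k \<le> j" "x j = 1 \<or> x j = -1"
  shows "norm (v k) \<le> norm (\<Sum>i\<in>UNIV. of_int (x i) *\<^sub>R v i)"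
proof -
  have "(GCD i\<in>{k..}. x i) = 1"
    by (rule Gcd_eq_1_I[of "x j"]) (use assms(2,3) in auto)
  with assms(1) show ?thesis unfolding minimal_basis_def by blast
qed

lemma minimal_basis_mono:
  fixes v :: "'n::{finite,linorder} \<Rightarrow> real ^ 'n::_"
  assumes "minimal_basis L v" "i \<le> j"
  shows "norm (v i) \<le> norm (v j)"
  using minimal_basis_le[OF assms, of "\<lambda>k. if k = j then 1 else 0"]
  by (simp add: sum.delta if_distrib[of of_int] if_distrib[of "\<lambda>c. c *\<^sub>R _"] cong: if_cong)

text \<open>Dimension four is the largest one in which this holds.\<close>

lemma minimal_basis_last_index:
  fixes v :: "'n::{finite,linorder} \<Rightarrow> real ^ 'n::_"
  assumes mb: "minimal_basis L v" and card: "CARD('n) \<le> 4"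
    and xk: "x k \<noteq> 0" and last: "\<And>i. k < i \<Longrightarrow> x i = 0"
  shows "norm (v k) \<le> norm (\<Sum>i\<in>UNIV. of_int (x i) *\<^sub>R v i)"
proof (cases "x k = 1 \<or> x k = -1")
  case True
  then show ?thesis using minimal_basis_le[OF mb order_refl] by blast
next
  case False
  define y where "y = (\<Sum>i\<in>UNIV. of_int (x i) *\<^sub>R v i)"
  define m where "m = (of_int (x k) :: real)"
  have "2 \<le> \<bar>x k\<bar>" using False xk by linarith
  then have m: "2 \<le> \<bar>m\<bar>" unfolding m_def by linarith
  have split: "(\<Sum>i\<in>UNIV. c i *\<^sub>R v i) = (\<Sum>i\<in>{..<k}. c i *\<^sub>R v i) + c k *\<^sub>R v k"
    if "\<And>i. k < i \<Longrightarrow> c i = 0" for c :: "'n \<Rightarrow> real"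
  proof -
    have "(\<Sum>i\<in>UNIV. c i *\<^sub>R v i) = (\<Sum>i\<in>{..k}. c i *\<^sub>R v i)"
      by (rule sum.mono_neutral_right) (use that in auto)
    also have "{..k} = insert k {..<k}" by auto
    finally show ?thesis by (simp add: add.commute)
  qed
  have y: "y = (\<Sum>i\<in>{..<k}. of_int (x i) *\<^sub>R v i) + m *\<^sub>R v k"
    unfolding y_def m_def by (rule split) (simp add: last)
  \<comment> \<open>Dividing by the last coefficient \<open>m\<close> and rounding the earlier ones
    produces a lattice vector with coefficient 1 at \<open>k\<close>, and to this one reducedness
    applies.\<close>
  obtain r :: "'n \<Rightarrow> int" where r: "(norm ((1 / m) *\<^sub>R y + (\<Sum>i\<in>{..<k}. (of_int (r i) - of_int (x i) / m) *\<^sub>R v i)))\<^sup>2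
     \<le> (norm ((1 / m) *\<^sub>R y))\<^sup>2 + (\<Sum>i\<in>{..<k}. (norm (v i))\<^sup>2 / 4)"
    using rounding[of "{..<k}" "(1 / m) *\<^sub>R y" "\<lambda>i. of_int (x i) / m" v] by auto
  define x' where "x' i = (if i < k then r i else if i = k then 1 else 0)" for i
  have "(\<Sum>i\<in>UNIV. of_int (x' i) *\<^sub>R v i) = (\<Sum>i\<in>{..<k}. of_int (x' i) *\<^sub>R v i) + of_int (x' k) *\<^sub>R v k"
    by (rule split) (auto simp: x'_def)
  also have "\<dots> = (1 / m) *\<^sub>R y + (\<Sum>i\<in>{..<k}. (of_int (r i) - of_int (x i) / m) *\<^sub>R v i)"
    using m by (auto simp: y x'_def scaleR_add_right scaleR_sum_right scaleR_diff_left sum_subtractf)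
  finally have "norm (v k) \<le> norm ((1 / m) *\<^sub>R y + (\<Sum>i\<in>{..<k}. (of_int (r i) - of_int (x i) / m) *\<^sub>R v i))"
    using minimal_basis_le[OF mb order_refl, of x' k] by (simp add: x'_def)
  then have "(norm (v k))\<^sup>2 \<le> (norm ((1 / m) *\<^sub>R y + (\<Sum>i\<in>{..<k}. (of_int (r i) - of_int (x i) / m) *\<^sub>R v i)))\<^sup>2"
    by (intro power_mono) auto
  also note r
  also have "(norm ((1 / m) *\<^sub>R y))\<^sup>2 \<le> (norm y)\<^sup>2 / 4"
  proof -
    have "norm ((1 / m) *\<^sub>R y) \<le> norm y / 2"
      using m mult_right_mono[OF m, of "norm y"] by (simp add: field_simps)
    then have "(norm ((1 / m) *\<^sub>R y))\<^sup>2 \<le> (norm y / 2)\<^sup>2" by (intro power_mono) auto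
    then show ?thesis by (simp add: power_divide)
  qed
  also have "(\<Sum>i\<in>{..<k}. (norm (v i))\<^sup>2 / 4) \<le> (\<Sum>i\<in>{..<k}. (norm (v k))\<^sup>2 / 4)"
    using minimal_basis_mono[OF mb] by (intro sum_mono divide_right_mono power_mono) auto
  \<comment> \<open>At most three vectors precede \<open>v k\<close>, so rounding costs at most 3/4
    of its squared norm. The remaining quarter matches the quarter of the squared norm of
    \<open>y\<close> left by dividing by \<open>m\<close>.\<close>
  also have "\<dots> \<le> 3 * ((norm (v k))\<^sup>2 / 4)"
  proof -
    have "card {..<k} < CARD('n)" by (rule psubset_card_mono) auto
    then have "real (card {..<k}) \<le> 3" using card by simp
    then show ?thesis by (simp add: mult_right_mono)
  qed
  finally have "(norm (v k))\<^sup>2 \<le> (norm y)\<^sup>2 / 4 + 3 * ((norm (v k))\<^sup>2 / 4)" by (simp only: add_mono)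
  then have "(norm (v k))\<^sup>2 \<le> (norm y)\<^sup>2" by linarith
  then show ?thesis unfolding y_def[symmetric] by (simp add: power2_le_iff_abs_le)
qed

lemma fdet_scale: "fdet (\<lambda>i. c i *\<^sub>R v i) = (\<Prod>i\<in>UNIV. c i) * fdet v"
proof -
  have "(\<chi> i. c i *\<^sub>R v i) = (\<chi> i. c i *s v i)" by (simp add: vec_eq_iff)
  then show ?thesis using det_rows_mul[of c v] by simp
qed

lemma parseval:
  fixes e :: "'n::finite \<Rightarrow> real ^ 'n"
  assumes "dual_pair e e"
  shows "(\<Sum>j\<in>UNIV. (y \<bullet> e j)\<^sup>2) = (norm y)\<^sup>2"
proof -
  let ?A = "\<chi> i. e i"
  have "?A ** transpose ?A = mat 1"
    unfolding inner_matrix using assms by (simp add: dual_pair_def mat_def)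
  then have "orthogonal_matrix ?A" by (simp add: orthogonal_matrix_def matrix_left_right_inverse)
  then have "orthogonal_transformation (matrix_vector_mult ?A)" by (simp add: orthogonal_transformation_matrix)
  then have "norm (?A *v y) = norm y" by (rule orthogonal_transformation_norm)
  then have "(norm y)\<^sup>2 = (?A *v y) \<bullet> (?A *v y)" by (metis power2_norm_eq_inner)
  also have "\<dots> = (\<Sum>j\<in>UNIV. (y \<bullet> e j)\<^sup>2)"
    by (simp add: inner_vec_def[of "?A *v y"] matrix_vector_mul_component inner_commute power2_eq_square)
  finally show ?thesis ..
qed

text \<open>Scaling the coordinates along the Gram--Schmidt flag as in Minkowski's second theorem.\<close>

lemma minimal_basis_det_4:
  fixes v :: "4 \<Rightarrow> real ^ 4"
  assumes mb: "minimal_basis L v"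
  shows "(\<Prod>i\<in>UNIV. (norm (v i))\<^sup>2) \<le> 4 * (fdet v)\<^sup>2"
proof -
  have li: "lin_indep v" using mb by (simp add: minimal_basis_def lattice_basis_def)
  obtain e :: "4 \<Rightarrow> real ^ 4" where e: "dual_pair e e" "\<And>i j. i < j \<Longrightarrow> v i \<bullet> e j = 0"
    by (rule orthonormal_flag[OF li]) blast
  obtain w where "dual_pair v w" using dual_pair_exists[OF li] .
  then have n0: "0 < norm (v i)" for i using dual_pair_nonzero[of v w i] by simp
  \<comment> \<open>Coordinates along the flag, the \<open>j\<close>-th one divided by
    \<open>norm (v j)\<close>. The squared determinant is divided by the product of the squared
    norms, so it suffices that the image lattice has minimal norm at least 1.\<close>
  define T where "T x = (\<chi> j. x \<bullet> ((1 / norm (v j)) *\<^sub>R e j))" for x :: "real ^ 4"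
  define v' where "v' i = T (v i)" for i
  have "fdet v' = fdet v * fdet (\<lambda>j. (1 / norm (v j)) *\<^sub>R e j)"
    unfolding fdet_mult by (simp add: v'_def T_def)
  also have "\<dots> = fdet v * ((\<Prod>j\<in>UNIV. 1 / norm (v j)) * fdet e)" by (simp only: fdet_scale)
  finally have "(fdet v')\<^sup>2 = (fdet v)\<^sup>2 * (\<Prod>j\<in>UNIV. 1 / norm (v j))\<^sup>2 * (fdet e * fdet e)"
    by (simp add: power_mult_distrib power2_eq_square)
  then have det': "(fdet v')\<^sup>2 = (fdet v)\<^sup>2 * (\<Prod>j\<in>UNIV. 1 / norm (v j))\<^sup>2"
    by (simp only: dual_pair_fdet[OF e(1)] mult_1_right)
  have "fdet v' \<noteq> 0"
  proof
    assume "fdet v' = 0"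
    with det' show False using li n0 by (simp add: lin_indep_iff_fdet)
  qed
  then have "lin_indep v'" by (simp add: lin_indep_iff_fdet)
  then obtain w' where w': "dual_pair v' w'" by (rule dual_pair_exists)
  have ge1: "1 \<le> norm (u i)" if o: "shear_orbit v' w' u z" for u z i
  proof -
    obtain x where x: "u i = (\<Sum>k\<in>UNIV. of_int (x k) *\<^sub>R v' k)"
      using shear_orbit_int_span[OF o, of i] unfolding int_span_def by blast
    have "u i \<noteq> 0" using dual_pair_nonzero[OF shear_orbit_dual_pair[OF o w']] .
    have "{k. x k \<noteq> 0} \<noteq> {}"
    proof
      assume "{k. x k \<noteq> 0} = {}"
      then have "x k = 0" for k by auto
      with \<open>u i \<noteq> 0\<close> show False by (simp add: x)
    qed
    then have "Max {k. x k \<noteq> 0} \<in> {k. x k \<noteq> 0}" by (intro Max_in) auto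
    moreover have "x j = 0" if "Max {k. x k \<noteq> 0} < j" for j
    proof (rule ccontr)
      assume "x j \<noteq> 0"
      then have "j \<le> Max {k. x k \<noteq> 0}" by (intro Max_ge) auto
      with that show False by simp
    qed
    ultimately obtain k where k: "x k \<noteq> 0" "\<And>j. k < j \<Longrightarrow> x j = 0" by blast
    define y where "y = (\<Sum>k\<in>UNIV. of_int (x k) *\<^sub>R v k)"
    have ny: "norm (v k) \<le> norm y"
      unfolding y_def using minimal_basis_last_index[where x = x, OF mb _ k] by simp
    have u: "u i = T y"
      by (simp add: x v'_def T_def y_def vec_eq_iff inner_sum_left sum_divide_distrib)
    have ye: "y \<bullet> e j = 0" if "k < j" for j
    proof -
      have "of_int (x i) * (v i \<bullet> e j) = 0" for i
        using e(2)[of i j] k(2)[of i] that by (cases "k < i") auto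
      then show ?thesis by (simp only: y_def inner_sum_left inner_scaleR_left sum.neutral_const)
    qed
    \<comment> \<open>Coordinates of \<open>y\<close> beyond \<open>k\<close> vanish, and up to
      \<open>k\<close> the divisors are at most \<open>norm (v k)\<close>; so \<open>T\<close>
      shrinks \<open>y\<close> by no more than that factor.\<close>
    have "1 \<le> (norm y)\<^sup>2 / (norm (v k))\<^sup>2" using ny n0[of k] by (simp add: power_mono)
    also have "\<dots> = (\<Sum>j\<in>UNIV. (y \<bullet> e j)\<^sup>2 / (norm (v k))\<^sup>2)"
      by (simp add: parseval[OF e(1), symmetric] sum_divide_distrib)
    also have "\<dots> \<le> (\<Sum>j\<in>UNIV. (y \<bullet> e j)\<^sup>2 / (norm (v j))\<^sup>2)"
    proof (rule sum_mono)
      fix j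
      show "(y \<bullet> e j)\<^sup>2 / (norm (v k))\<^sup>2 \<le> (y \<bullet> e j)\<^sup>2 / (norm (v j))\<^sup>2"
      proof (cases "k < j")
        case False
        then have "norm (v j) \<le> norm (v k)" using minimal_basis_mono[OF mb] by simp
        then show ?thesis using n0[of j] by (intro divide_left_mono power_mono mult_pos_pos zero_less_power) auto
      qed (simp add: ye)
    qed
    also have "\<dots> = (norm (T y))\<^sup>2"
      unfolding power2_norm_eq_inner[of "T y"] inner_vec_def[of "T y"] by (simp add: T_def power2_eq_square)
    finally have "1\<^sup>2 \<le> (norm (T y))\<^sup>2" by simp
    then show ?thesis unfolding u by (rule power2_le_imp_le) simp
  qed
  have "1 \<le> 4 * (fdet v')\<^sup>2" by (rule hermite_4[OF w']) (rule ge1)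
  then have "1 \<le> 4 * ((fdet v)\<^sup>2 / (\<Prod>j\<in>UNIV. norm (v j))\<^sup>2)"
    unfolding det' by (simp add: prod_dividef power_divide)
  moreover have "0 < (\<Prod>j\<in>UNIV. (norm (v j))\<^sup>2)" using n0 by (intro prod_pos) auto
  ultimately show ?thesis by (simp add: prod_power_distrib pos_le_divide_eq)
qed

lemma minimal_basis_det_3:
  fixes v :: "3 \<Rightarrow> real ^ 3"
  assumes mb: "minimal_basis L v"
  shows "(\<Prod>i\<in>UNIV. (norm (v i))\<^sup>2) \<le> 2 * (fdet v)\<^sup>2"
proof -
  have li: "lin_indep v" using mb by (simp add: minimal_basis_def lattice_basis_def)
  obtain w where "dual_pair v w" using dual_pair_exists[OF li] .
  then have nz: "v i \<noteq> 0" for i by (rule dual_pair_nonzero)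
  have ord: "(0::3) \<le> 1" "(1::3) \<le> 2" by (simp_all add: less_eq_bit1_def bit1.Rep_numeral bit1.Rep_0 bit1.Rep_1)
  \<comment> \<open>In the type \<open>3\<close> the numeral \<open>3\<close> is \<open>0\<close>,
    the least index, so an enumeration 1, 2, 3 is rotated to the increasing order 0, 1, 2.\<close>
  have three: "(3::3) = 0" by simp
  have U: "(\<Sum>i\<in>UNIV. f i) = f 0 + f 1 + f (2::3)" for f :: "3 \<Rightarrow> real ^ 3"
    by (simp only: sum_3 three add_ac)
  have "norm (v 1) \<le> norm (v 1 + s *\<^sub>R v 0)" if s: "s \<in> {-1, 1}" for s
  proof -
    from s unit_coeff_int obtain c where c: "s = of_int c" by blast
    show ?thesis
      using minimal_basis_le[OF mb order_refl, of "\<lambda>i. if i = 0 then c else if i = 1 then 1 else 0" 1]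
      by (simp add: U c add.commute)
  qed
  moreover have "norm (v 2) \<le> norm (v 2 + (s *\<^sub>R v 0 + t *\<^sub>R v 1))" if s: "s \<in> {-1, 0, 1}" "t \<in> {-1, 0, 1}" for s t
  proof -
    from s unit_coeff_int obtain c d where c: "s = of_int c" "t = of_int d" by blast
    show ?thesis
      using minimal_basis_le[OF mb order_refl, of "\<lambda>i. if i = 0 then c else if i = 1 then d else 1" 2]
      by (simp add: U c add_ac)
  qed
  ultimately have "(norm (v 0))\<^sup>2 * (norm (v 1))\<^sup>2 * (norm (v 2))\<^sup>2 \<le> 2 * gram3 (v 0) (v 1) (v 2)"
    by (intro gram3_ge_sorted nz minimal_basis_mono[OF mb] ord)
  moreover have "gram3 (v 0) (v 1) (v 2) = (fdet v)\<^sup>2"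
    unfolding power2_eq_square[of "fdet v"] fdet_mult unfolding det_3
    by (simp only: vec_lambda_beta three gram3_def power2_eq_square inner_commute[of "v 1" "v 0"]
        inner_commute[of "v 2" "v 0"] inner_commute[of "v 2" "v 1"]) (simp only: algebra_simps)
  moreover have "(\<Prod>i\<in>UNIV. (norm (v i))\<^sup>2) = (norm (v 0))\<^sup>2 * (norm (v 1))\<^sup>2 * (norm (v 2))\<^sup>2"
    unfolding UNIV_3 by (simp add: three)
  ultimately show ?thesis by simp
qed

section \<open>Existence of Minkowski reduced bases\<close>

lemma int_span_subset:
  assumes "\<And>i. v i \<in> int_span w"
  shows "int_span v \<subseteq> int_span w"
proof -
  have zero: "0 \<in> int_span w" using int_spanI[of "\<lambda>_. 0" w] by simp
  have "(\<Sum>i\<in>A. of_int (x i) *\<^sub>R v i) \<in> int_span w" if "finite A" for A :: "'a set" and x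
    using that
  proof (induction A)
    case (insert i A)
    from int_span_add_scale[OF insert.IH assms, of "x i" i] insert.hyps show ?case
      by (simp add: add.commute)
  qed (simp add: zero)
  then show ?thesis unfolding int_span_def[of v] by auto
qed

text \<open>Since \<open>v\<close> is an integer matrix times \<open>w\<close>, multiplicativity
  makes the determinant of \<open>w\<close> nonzero as well.\<close>

lemma lattice_basisI:
  fixes v w :: "'n::finite \<Rightarrow> real ^ 'n"
  assumes v: "lattice_basis L v" and wv: "\<And>i. w i \<in> int_span v" and vw: "\<And>i. v i \<in> int_span w"
  shows "lattice_basis L w"
proof -
  have "\<forall>i. \<exists>x. v i = (\<Sum>j\<in>UNIV. of_int (x j) *\<^sub>R w j)"
    using vw unfolding int_span_def by blast
  then obtain x :: "'n \<Rightarrow> 'n \<Rightarrow> int" where x: "\<And>i. v i = (\<Sum>j\<in>UNIV. of_int (x i j) *\<^sub>R w j)"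
    by metis
  have "(\<chi> i. v i) = (\<chi> i j. of_int (x i j)) ** (\<chi> j. w j)"
    by (simp add: vec_eq_iff matrix_matrix_mult_def x)
  then have "fdet v = det (\<chi> i j. of_int (x i j)) * fdet w" by (simp only: det_mul)
  moreover have "fdet v \<noteq> 0" using v by (simp add: lattice_basis_def lin_indep_iff_fdet)
  ultimately have "lin_indep w" by (simp add: lin_indep_iff_fdet)
  moreover have "int_span v = int_span w" using int_span_subset wv vw by blast
  ultimately show ?thesis using v by (simp add: lattice_basis_def)
qed

lemma lattice_basis_shear:
  fixes v :: "'n::finite \<Rightarrow> real ^ 'n"
  assumes "lattice_basis L v" "i \<noteq> j"
  shows "lattice_basis L (v(j := v j + of_int c *\<^sub>R v i))" (is "lattice_basis L ?w")
proof (rule lattice_basisI[OF assms(1)])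
  show "?w k \<in> int_span v" for k by (simp add: int_span_add_scale int_span_base)
  show "v k \<in> int_span ?w" for k
  proof (cases "k = j")
    case True
    have "?w j + of_int (- c) *\<^sub>R ?w i \<in> int_span ?w" by (intro int_span_add_scale int_span_base)
    then show ?thesis using True assms(2) by simp
  next
    case False
    then show ?thesis using int_span_base[of ?w k] by simp
  qed
qed

lemma lattice_basis_permute:
  fixes v :: "'n::finite \<Rightarrow> real ^ 'n"
  assumes "lattice_basis L v" "bij p"
  shows "lattice_basis L (v \<circ> p)"
proof (rule lattice_basisI[OF assms(1)])
  show "(v \<circ> p) k \<in> int_span v" for k by (simp add: int_span_base)
  show "v k \<in> int_span (v \<circ> p)" for k
    using int_span_base[of "v \<circ> p" "inv p k"] assms(2) by (simp add: bij_is_surj surj_f_inv_f)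
qed

lemma lattice_basis_sign:
  fixes v :: "'n::finite \<Rightarrow> real ^ 'n"
  assumes v: "lattice_basis L v" and e: "\<And>i. e i = 1 \<or> e i = (-1 :: int)"
  shows "lattice_basis L (\<lambda>i. of_int (e i) *\<^sub>R v i)" (is "lattice_basis L ?w")
proof (rule lattice_basisI[OF v])
  have zero: "0 \<in> int_span w" for w :: "'n \<Rightarrow> real ^ 'n" using int_spanI[of "\<lambda>_. 0" w] by simp
  show "?w k \<in> int_span v" for k
    using int_span_add_scale[OF zero int_span_base, of "e k" v k] by simp
  have "of_int (e k) *\<^sub>R ?w k = v k" for k using e[of k] by auto
  then show "v k \<in> int_span ?w" for k
    using int_span_add_scale[OF zero int_span_base, of "e k" ?w k] by simp
qed

lemma lattice_basis_replace:
  fixes v :: "'n::finite \<Rightarrow> real ^ 'n"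
  assumes v: "lattice_basis L v" and xj: "x j = 1 \<or> x j = (-1 :: int)"
    and u: "u = (\<Sum>i\<in>UNIV. of_int (x i) *\<^sub>R v i)"
  shows "lattice_basis L (v(j := u))" (is "lattice_basis L ?w")
proof (rule lattice_basisI[OF v])
  show "?w k \<in> int_span v" for k by (simp add: u int_spanI int_span_base)
  show "v k \<in> int_span ?w" for k
  proof (cases "k = j")
    case True
    have "u = of_int (x j) *\<^sub>R v j + (\<Sum>i\<in>UNIV - {j}. of_int (x i) *\<^sub>R v i)"
      unfolding u by (rule sum.remove) auto
    moreover have "(of_int (x j) * of_int (x j) :: real) = 1" using xj by auto
    ultimately have "v j = of_int (x j) *\<^sub>R u - of_int (x j) *\<^sub>R (\<Sum>i\<in>UNIV - {j}. of_int (x i) *\<^sub>R v i)"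
      by (simp add: scaleR_add_right)
    also have "\<dots> = (\<Sum>i\<in>UNIV. of_int (if i = j then x j else - x j * x i) *\<^sub>R ?w i)"
      by (subst sum.remove[of UNIV j]) (simp_all add: scaleR_sum_right sum_negf)
    finally show ?thesis using True int_spanI by metis
  next
    case False
    then show ?thesis using int_span_base[of ?w k] by simp
  qed
qed

lemma Gcd_eq_1_iff_common_divisor:
  "Gcd A = (1::int) \<longleftrightarrow> (\<forall>d. (\<forall>a\<in>A. d dvd a) \<longrightarrow> d dvd 1)"
proof
  assume "Gcd A = 1"
  then show "\<forall>d. (\<forall>a\<in>A. d dvd a) \<longrightarrow> d dvd 1" by (metis Gcd_greatest)
next
  assume "\<forall>d. (\<forall>a\<in>A. d dvd a) \<longrightarrow> d dvd 1"
  then have "Gcd A dvd 1" by (blast intro: Gcd_dvd)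
  then show "Gcd A = 1" using Gcd_int_greater_eq_0[of A] by auto
qed

text \<open>Euclid's algorithm on the coefficients from \<open>k\<close> on. Subtracting one from
  another is compensated by a shear of the basis, so the represented vector stays the same, and
  vectors below \<open>k\<close> are never touched. The sum of absolute values drops until a single
  coefficient remains, which the gcd condition makes a unit.\<close>

lemma primitive_completion:
  fixes v :: "'n::{finite,linorder} \<Rightarrow> real ^ 'n::_"
  assumes "lattice_basis L v" "(GCD i\<in>{k..}. x i) = 1"
  shows "\<exists>w. lattice_basis L w \<and> (\<forall>i<k. w i = v i) \<and> w k = (\<Sum>i\<in>UNIV. of_int (x i) *\<^sub>R v i)"
  using assms
proof (induction "nat (\<Sum>i\<in>{k..}. \<bar>x i\<bar>)" arbitrary: v x rule: less_induct)
  case less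
  show ?case
  proof (cases "\<exists>i j. i \<noteq> j \<and> k \<le> i \<and> k \<le> j \<and> x i \<noteq> 0 \<and> x j \<noteq> 0")
    case True
    then obtain a b where ab: "a \<noteq> b" "k \<le> a" "k \<le> b" "x a \<noteq> 0" "x b \<noteq> 0" by blast
    obtain i j where ij: "i \<noteq> j" "k \<le> i" "k \<le> j" "x j \<noteq> 0" "\<bar>x j\<bar> \<le> \<bar>x i\<bar>"
    proof (cases "\<bar>x b\<bar> \<le> \<bar>x a\<bar>")
      case True
      with ab show ?thesis by (intro that[of a b]) auto
    next
      case False
      with ab show ?thesis by (intro that[of b a]) auto
    qed
    \<comment> \<open>The sign for which subtracting \<open>s * x j\<close> moves \<open>x i\<close>
      towards zero.\<close>
    define s where "s = sgn (x i) * sgn (x j)"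
    have s: "\<bar>x i - s * x j\<bar> < \<bar>x i\<bar>"
      using ij(4,5) by (auto simp: s_def sgn_if abs_if split: if_splits)
    define x' where "x' = x(i := x i - s * x j)"
    let ?v = "v(j := v j + of_int s *\<^sub>R v i)"
    have lb: "lattice_basis L ?v" using less.prems(1) ij(1) by (rule lattice_basis_shear)
    have "(\<Sum>l\<in>{k..}. \<bar>x' l\<bar>) < (\<Sum>l\<in>{k..}. \<bar>x l\<bar>)"
      by (rule sum_strict_mono_ex1) (use s ij in \<open>auto simp: x'_def less_imp_le\<close>)
    moreover have "0 \<le> (\<Sum>l\<in>{k..}. \<bar>x' l\<bar>)" by (intro sum_nonneg) auto
    ultimately have dec: "nat (\<Sum>l\<in>{k..}. \<bar>x' l\<bar>) < nat (\<Sum>l\<in>{k..}. \<bar>x l\<bar>)" by linarith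
    have "d dvd 1" if d: "\<forall>a\<in>x' ` {k..}. d dvd a" for d
    proof -
      have d': "d dvd x' l" if "k \<le> l" for l using d that by auto
      have "d dvd x j" using d'[OF ij(3)] ij(1) by (simp add: x'_def)
      moreover have "d dvd x i - s * x j" using d'[OF ij(2)] by (simp add: x'_def)
      ultimately have "d dvd (x i - s * x j) + s * x j" by (intro dvd_add dvd_mult)
      then have "d dvd x i" by simp
      then have "d dvd x l" if "k \<le> l" for l
        using d'[OF that] by (cases "l = i") (auto simp: x'_def)
      then show ?thesis using less.prems(2) unfolding Gcd_eq_1_iff_common_divisor by auto
    qed
    then have gcd: "(GCD l\<in>{k..}. x' l) = 1" unfolding Gcd_eq_1_iff_common_divisor by blast
    have sum: "(\<Sum>l\<in>UNIV. of_int (x' l) *\<^sub>R ?v l) = (\<Sum>l\<in>UNIV. of_int (x l) *\<^sub>R v l)"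
    proof -
      have split: "(\<Sum>l\<in>UNIV. f l) = f i + f j + (\<Sum>l\<in>UNIV - {i} - {j}. f l)" for f :: "'n \<Rightarrow> real ^ 'n::_"
      proof -
        have "(\<Sum>l\<in>UNIV. f l) = f i + (\<Sum>l\<in>UNIV - {i}. f l)" by (rule sum.remove) auto
        also have "(\<Sum>l\<in>UNIV - {i}. f l) = f j + (\<Sum>l\<in>UNIV - {i} - {j}. f l)"
          by (rule sum.remove) (use ij(1) in auto)
        finally show ?thesis by (simp only: add.assoc)
      qed
      have "(\<Sum>l\<in>UNIV - {i} - {j}. of_int (x' l) *\<^sub>R ?v l) = (\<Sum>l\<in>UNIV - {i} - {j}. of_int (x l) *\<^sub>R v l)"
        by (rule sum.cong) (auto simp: x'_def)
      then show ?thesis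
        unfolding split using ij(1)
        by (simp add: x'_def scaleR_diff_left scaleR_add_right mult.commute)
    qed
    from less.hyps[OF dec lb gcd] obtain w where
      "lattice_basis L w" "\<forall>i<k. w i = ?v i" "w k = (\<Sum>i\<in>UNIV. of_int (x' i) *\<^sub>R ?v i)" by blast
    with ij(3) show ?thesis unfolding sum by (intro exI[of _ w]) auto
  next
    case False
    define u where "u = (\<Sum>i\<in>UNIV. of_int (x i) *\<^sub>R v i)"
    have "\<exists>j\<ge>k. x j \<noteq> 0"
    proof (rule ccontr)
      assume "\<not> ?thesis"
      then have "\<forall>a\<in>x ` {k..}. 0 dvd a" by auto
      then show False using less.prems(2) unfolding Gcd_eq_1_iff_common_divisor by (metis dvd_0_left_iff zero_neq_one)
    qed
    then obtain j where j: "k \<le> j" "x j \<noteq> 0" by blast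
    have "x l = 0 \<or> l = j" if "k \<le> l" for l using False j that by blast
    then have "\<forall>a\<in>x ` {k..}. x j dvd a" by fastforce
    then have "x j dvd 1" using less.prems(2) unfolding Gcd_eq_1_iff_common_divisor by blast
    then have "x j = 1 \<or> x j = -1" by auto
    from lattice_basis_replace[OF less.prems(1) this u_def]
    \<comment> \<open>The new vector enters at \<open>j\<close> and is moved to \<open>k\<close> by
      a transposition; as \<open>k <= j\<close>, the vectors below \<open>k\<close> keep their
      places.\<close>
    have "lattice_basis L (v(j := u) \<circ> Transposition.transpose j k)"
      by (rule lattice_basis_permute) simp
    then show ?thesis
      using j(1) by (intro exI[of _ "v(j := u) \<circ> Transposition.transpose j k"])
        (auto simp: u_def[symmetric] Transposition.transpose_def)
  qed
qed

text \<open>A greedy choice: \<open>Q v i\<close> says that \<open>v i\<close> is shortest among the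
  bases agreeing with \<open>v\<close> below \<open>i\<close>. It depends on the entries of
  \<open>v\<close> up to \<open>i\<close> only, so later choices do not disturb it. By
  \<open>primitive_completion\<close> every vector tested in Minkowski's condition occurs in such a
  basis.\<close>

lemma minimal_basis_exists:
  fixes L :: "(real ^ 'n::{finite,wellorder}) set"
  assumes "lattice_basis L v\<^sub>0"
  obtains v where "minimal_basis L v"
proof -
  define Q where "Q v i \<longleftrightarrow> (\<forall>w. lattice_basis L w \<and> (\<forall>j<i. w j = v j) \<longrightarrow> norm (v i) \<le> norm (w i))"
    for v :: "'n \<Rightarrow> real ^ 'n::_" and i
  have *: "\<exists>v. lattice_basis L v \<and> (\<forall>i\<le>k. Q v i)" for k
  proof (induction k rule: less_induct)
    case (less k)
    have "\<exists>v. lattice_basis L v \<and> (\<forall>i<k. Q v i)"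
    proof (cases "{..<k} = {}")
      case True
      then show ?thesis using assms by (intro exI[of _ v\<^sub>0]) auto
    next
      case False
      have "Max {..<k} < k" using Max_in[of "{..<k}"] False by auto
      from less.IH[OF this] obtain v where v: "lattice_basis L v" "\<forall>i\<le>Max {..<k}. Q v i" by blast
      moreover have "i \<le> Max {..<k}" if "i < k" for i using that by (intro Max_ge) auto
      ultimately show ?thesis by blast
    qed
    then obtain v where v: "lattice_basis L v" "\<forall>i<k. Q v i" by blast
    define X where "X = {w. lattice_basis L w \<and> (\<forall>j<k. w j = v j)}"
    have vX: "v \<in> X" using v by (simp add: X_def)
    have fin: "finite ((\<lambda>w. norm (w k)) ` {w \<in> X. norm (w k) \<le> r})" for r
    proof -
      have "(\<lambda>w. norm (w k)) ` {w \<in> X. norm (w k) \<le> r} \<subseteq> norm ` {x \<in> int_span v. norm x \<le> r}"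
        using v(1) by (auto simp: X_def lattice_basis_def intro!: imageI int_span_base)
      moreover have "finite {x \<in> int_span v. norm x \<le> r}"
        using v(1) by (intro finite_int_span_le) (simp add: lattice_basis_def)
      ultimately show ?thesis by (meson finite_imageI finite_subset)
    qed
    obtain w where w: "w \<in> X" "\<And>z. z \<in> X \<Longrightarrow> norm (w k) \<le> norm (z k)"
      by (rule ex_min_if_finite_below[OF vX fin]) blast
    have "Q w i" if "i \<le> k" for i
    proof (cases "i = k")
      case True
      then show ?thesis using w by (auto simp: Q_def X_def)
    next
      case False
      then have "i < k" using that by simp
      then have "w i = v i" "\<And>j. j < i \<Longrightarrow> w j = v j" using w(1) by (auto simp: X_def)
      then show ?thesis using v(2) \<open>i < k\<close> by (auto simp: Q_def)
    qed
    then show ?case using w(1) by (auto simp: X_def)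
  qed
  obtain v where v: "lattice_basis L v" "\<And>i. Q v i"
    using *[of "Max UNIV"] by (metis Max_ge UNIV_I finite)
  have "minimal_basis L v"
    unfolding minimal_basis_def
  proof (intro conjI allI impI v(1))
    fix k and x :: "'n \<Rightarrow> int" assume "(GCD i\<in>{k..}. x i) = 1"
    from primitive_completion[OF v(1) this] obtain w where
      "lattice_basis L w" "\<forall>i<k. w i = v i" "w k = (\<Sum>i\<in>UNIV. of_int (x i) *\<^sub>R v i)" by blast
    then show "norm (v k) \<le> norm (\<Sum>i\<in>UNIV. of_int (x i) *\<^sub>R v i)"
      using v(2)[of k] unfolding Q_def by metis
  qed
  then show ?thesis by (rule that)
qed

text \<open>This allows the sign pattern with a small solid angle to be picked without leaving the
  reduced bases.\<close>

lemma minimal_basis_sign: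
  fixes v :: "'n::{finite,linorder} \<Rightarrow> real ^ 'n::_"
  assumes v: "minimal_basis L v" and e: "\<And>i. e i = 1 \<or> e i = (-1 :: int)"
  shows "minimal_basis L (\<lambda>i. of_int (e i) *\<^sub>R v i)"
  unfolding minimal_basis_def
proof (intro conjI allI impI)
  show "lattice_basis L (\<lambda>i. of_int (e i) *\<^sub>R v i)"
    using v e by (intro lattice_basis_sign) (auto simp: minimal_basis_def)
next
  fix k and x :: "'n \<Rightarrow> int" assume g: "(GCD i\<in>{k..}. x i) = 1"
  have "d dvd x i" if "d dvd x i * e i" for d i using e[of i] that by auto
  then have "(GCD i\<in>{k..}. x i * e i) = 1"
    using g unfolding Gcd_eq_1_iff_common_divisor by fastforce
  then have "norm (v k) \<le> norm (\<Sum>i\<in>UNIV. of_int (x i * e i) *\<^sub>R v i)"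
    using v unfolding minimal_basis_def by blast
  moreover have "\<bar>real_of_int (e k)\<bar> = 1" using e[of k] by auto
  ultimately show "norm (of_int (e k) *\<^sub>R v k) \<le> norm (\<Sum>i\<in>UNIV. of_int (x i) *\<^sub>R of_int (e i) *\<^sub>R v i)"
    by simp
qed

section \<open>Solid angles as volumes in coordinates\<close>

definition trunc_cone :: "('n \<Rightarrow> real ^ 'n) \<Rightarrow> (real ^ 'n) set" where
  "trunc_cone v = {x \<in> open_cone v. norm x \<le> 1}"

text \<open>The truncated cone in the coordinates of the basis. It depends on \<open>v\<close> only
  through its Gram matrix, which makes different bases comparable.\<close>

definition coord_body :: "('n::finite \<Rightarrow> real ^ 'n) \<Rightarrow> (real ^ 'n) set" where
  "coord_body v = {x. (\<forall>i. 0 < x $ i) \<and> (norm (\<Sum>i\<in>UNIV. x $ i *\<^sub>R v i))\<^sup>2 \<le> 1}"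

lemma open_cone_scale: "0 < s \<Longrightarrow> x \<in> open_cone v \<Longrightarrow> s *\<^sub>R x \<in> open_cone v"
  unfolding open_cone_def
proof clarify
  fix a :: "'a \<Rightarrow> real" assume "0 < s" "\<forall>i. 0 < a i"
  then show "\<exists>b. s *\<^sub>R (\<Sum>i\<in>UNIV. a i *\<^sub>R v i) = (\<Sum>i\<in>UNIV. b i *\<^sub>R v i) \<and> (\<forall>i. 0 < b i)"
    by (intro exI[of _ "\<lambda>i. s * a i"]) (simp add: scaleR_sum_right)
qed

lemma zero_notin_open_cone: "lin_indep v \<Longrightarrow> 0 \<notin> open_cone v"
  unfolding open_cone_def using lin_indep_sum_zero by force

lemma solid_angle_trunc_cone:
  fixes v :: "'n::finite \<Rightarrow> real ^ 'n"
  assumes "lin_indep v"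
  shows "solid_angle v = CARD('n) * measure lebesgue (trunc_cone v)"
proof -
  have "{t *\<^sub>R u | t u. 0 < t \<and> t \<le> 1 \<and> u \<in> open_cone v \<inter> sphere 0 1} = trunc_cone v"
  proof (intro equalityI subsetI)
    fix x assume "x \<in> trunc_cone v"
    then have x: "x \<in> open_cone v" "norm x \<le> 1" by (auto simp: trunc_cone_def)
    then have "x \<noteq> 0" using zero_notin_open_cone[OF assms] by auto
    then have "x = norm x *\<^sub>R ((1 / norm x) *\<^sub>R x)" "0 < norm x" "(1 / norm x) *\<^sub>R x \<in> open_cone v \<inter> sphere 0 1"
      using x open_cone_scale[of "1 / norm x" x v] by auto
    with x(2) show "x \<in> {t *\<^sub>R u | t u. 0 < t \<and> t \<le> 1 \<and> u \<in> open_cone v \<inter> sphere 0 1}" by blast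
  qed (auto simp: trunc_cone_def open_cone_scale)
  then show ?thesis by (simp add: solid_angle_def spherical_area_def)
qed

lemma linear_combination: "linear (\<lambda>x :: real ^ 'n. \<Sum>i\<in>UNIV. x $ i *\<^sub>R (v i :: real ^ 'n::finite))"
  by (rule linearI) (simp_all add: scaleR_add_left sum.distrib scaleR_sum_right)

lemma trunc_cone_eq_image:
  "trunc_cone v = (\<lambda>x. \<Sum>i\<in>UNIV. x $ i *\<^sub>R v i) ` coord_body v"
proof (intro equalityI subsetI)
  fix y assume "y \<in> trunc_cone v"
  then obtain a where a: "y = (\<Sum>i\<in>UNIV. a i *\<^sub>R v i)" "\<forall>i. 0 < a i" "norm y \<le> 1"
    by (auto simp: trunc_cone_def open_cone_def)
  then show "y \<in> (\<lambda>x. \<Sum>i\<in>UNIV. x $ i *\<^sub>R v i) ` coord_body v"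
    by (intro image_eqI[of _ _ "\<chi> i. a i"]) (auto simp: coord_body_def power_le_one_iff abs_square_le_1)
next
  fix y assume "y \<in> (\<lambda>x. \<Sum>i\<in>UNIV. x $ i *\<^sub>R v i) ` coord_body v"
  then obtain x where "y = (\<Sum>i\<in>UNIV. x $ i *\<^sub>R v i)" "\<forall>i. 0 < x $ i" "norm y \<le> 1"
    by (auto simp: coord_body_def abs_square_le_1)
  then show "y \<in> trunc_cone v" unfolding trunc_cone_def open_cone_def by auto
qed

lemma borel_positive_orthant: "{x :: real ^ 'n::finite. \<forall>i. 0 < x $ i} \<in> sets borel"
proof -
  have "{x :: real ^ 'n. \<forall>i. 0 < x $ i} = (\<Inter>i. {x. x $ i > 0})" by auto
  moreover have "open (\<Inter>i. {x :: real ^ 'n. x $ i > 0})"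
    by (intro open_INT) (auto intro: open_halfspace_component_gt_cart)
  ultimately show ?thesis by simp
qed

lemma borel_coord_body: "coord_body v \<in> sets borel"
proof -
  have "closed {x :: real ^ 'a. (norm (\<Sum>i\<in>UNIV. x $ i *\<^sub>R v i))\<^sup>2 \<le> 1}"
    by (intro closed_Collect_le continuous_intros)
  then have "{x. \<forall>i. 0 < x $ i} \<inter> {x :: real ^ 'a. (norm (\<Sum>i\<in>UNIV. x $ i *\<^sub>R v i))\<^sup>2 \<le> 1} \<in> sets borel"
    by (intro sets.Int borel_positive_orthant borel_closed)
  then show ?thesis by (simp add: coord_body_def Collect_conj_eq)
qed

text \<open>Boundedness: a coordinate is the inner product of a vector of the unit ball with a dual
  basis vector.\<close>

lemma lmeasurable_coord_body:
  assumes "lin_indep v"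
  shows "coord_body v \<in> lmeasurable"
proof -
  obtain w where w: "dual_pair v w" using dual_pair_exists[OF assms] .
  have "norm x \<le> (\<Sum>j\<in>UNIV. norm (w j))" if "x \<in> coord_body v" for x
  proof -
    have "norm x \<le> (\<Sum>j\<in>UNIV. \<bar>x $ j\<bar>)" by (rule norm_le_l1_cart)
    also have "\<dots> \<le> (\<Sum>j\<in>UNIV. norm (w j))"
    proof (rule sum_mono)
      fix j
      let ?y = "\<Sum>i\<in>UNIV. x $ i *\<^sub>R v i"
      have "x $ j = ?y \<bullet> w j"
        using w by (simp add: inner_sum_left dual_pair_def if_distrib[of "times _"] cong: if_cong)
      then have "\<bar>x $ j\<bar> \<le> norm ?y * norm (w j)" by (simp only: Cauchy_Schwarz_ineq2)
      also have "\<dots> \<le> 1 * norm (w j)"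
        using that by (intro mult_right_mono) (auto simp: coord_body_def abs_square_le_1)
      finally show "\<bar>x $ j\<bar> \<le> norm (w j)" by simp
    qed
    finally show ?thesis .
  qed
  then have "bounded (coord_body v)" by (auto simp: bounded_iff)
  then show ?thesis using sets_completionI_sets[of "coord_body v" lborel] borel_coord_body[of v]
    by (intro bounded_set_imp_lmeasurable) simp_all
qed

lemma solid_angle_coord_body:
  fixes v :: "'n::{finite,wellorder} \<Rightarrow> real ^ 'n::_"
  assumes "lin_indep v"
  shows "solid_angle v = CARD('n) * (\<bar>fdet v\<bar> * measure lebesgue (coord_body v))"
proof -
  let ?f = "\<lambda>x. \<Sum>i\<in>UNIV. x $ i *\<^sub>R v i"
  have "matrix ?f = transpose (\<chi> i. v i)"
    by (simp add: matrix_def transpose_def vec_eq_iff axis_def if_distrib[of "\<lambda>c. c * _"] cong: if_cong)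
  then show ?thesis
    unfolding solid_angle_trunc_cone[OF assms] trunc_cone_eq_image
    using measure_linear_image[OF linear_combination lmeasurable_coord_body[OF assms], of v]
    by (simp add: det_transpose)
qed

section \<open>Integration over a section of a cone\<close>

lemma borel_measurable_lborel_pair:
  fixes g :: "'a::euclidean_space \<times> 'b::euclidean_space \<Rightarrow> ennreal"
  assumes "g \<in> borel_measurable (borel \<Otimes>\<^sub>M borel)"
  shows "g \<in> borel_measurable (lborel \<Otimes>\<^sub>M lborel)"
  using assms by (simp add: lborel_prod borel_prod)

lemma nn_integral_lborel_scale:
  fixes g :: "'a::euclidean_space \<Rightarrow> ennreal"
  assumes [measurable]: "g \<in> borel_measurable borel" and s: "0 < s"
  shows "(\<integral>\<^sup>+x. g x \<partial>lborel) = (\<integral>\<^sup>+u. ennreal (s ^ DIM('a)) * g (s *\<^sub>R u) \<partial>lborel)"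
proof -
  have "(\<integral>\<^sup>+x. g x \<partial>lborel) = (\<integral>\<^sup>+x. g x \<partial>density (distr lborel borel (\<lambda>x. 0 + s *\<^sub>R x)) (\<lambda>_. \<bar>s\<bar> ^ DIM('a)))"
    by (rule arg_cong[OF lborel_affine]) (use s in simp)
  also have "\<dots> = (\<integral>\<^sup>+u. ennreal (s ^ DIM('a)) * g (s *\<^sub>R u) \<partial>lborel)"
    using s by (simp add: nn_integral_density nn_integral_distr)
  finally show ?thesis .
qed

text \<open>Polar coordinates adapted to the section \<open>\<sigma> x + w = 1\<close> of the cone \<open>P\<close>.\<close>

lemma emeasure_cone_section:
  fixes J :: "'a::euclidean_space \<times> real \<Rightarrow> 'b::euclidean_space" and \<sigma> :: "'a \<Rightarrow> real"
  defines "U \<equiv> \<lambda>u. J (u, 1 - \<sigma> u)" and "d \<equiv> DIM('a)"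
  assumes J: "lborel = distr lborel borel J" "linear J" and \<sigma>: "linear \<sigma>"
    and P: "P \<in> sets borel" "\<And>s x. 0 < s \<Longrightarrow> s *\<^sub>R x \<in> P \<longleftrightarrow> x \<in> P"
      "\<And>x w. J (x, w) \<in> P \<Longrightarrow> 0 < \<sigma> x + w"
    and q: "q \<in> borel_measurable borel" "\<And>s x. q (s *\<^sub>R x) = s\<^sup>2 * q x" "\<And>x. x \<in> P \<Longrightarrow> 0 < q x"
  shows "emeasure lborel {x \<in> P. q x \<le> 1} =
    (\<integral>\<^sup>+u. ennreal (1 / (real (d + 1) * sqrt (q (U u)) ^ (d + 1))) * indicator P (U u) \<partial>lborel)"
proof -
  define f :: "'b \<Rightarrow> ennreal" where "f = indicator {x \<in> P. q x \<le> 1}"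
  have Jb: "J \<in> borel_measurable borel" and [measurable]: "\<sigma> \<in> borel_measurable borel" "q \<in> borel_measurable borel" "P \<in> sets borel"
    using J(2) \<sigma> q(1) P(1)
    by (auto intro!: borel_measurable_continuous_onI linear_continuous_on simp: linear_conv_bounded_linear)
  then have [measurable]: "J \<in> borel_measurable (borel \<Otimes>\<^sub>M borel)" by (simp add: borel_prod)
  have fm [measurable]: "f \<in> borel_measurable borel" unfolding f_def by measurable
  have "emeasure lborel {x \<in> P. q x \<le> 1} = (\<integral>\<^sup>+x. f x \<partial>lborel)"
    by (simp add: f_def)
  also have "\<dots> = (\<integral>\<^sup>+p. f (J p) \<partial>(lborel \<Otimes>\<^sub>M lborel))"
    by (subst J(1)) (simp add: nn_integral_distr Jb lborel_prod)
  also have "\<dots> = (\<integral>\<^sup>+a. (\<integral>\<^sup>+w. f (J (a, w)) \<partial>lborel) \<partial>lborel)"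
    by (subst lborel.nn_integral_fst[symmetric]) (auto intro!: borel_measurable_lborel_pair)
  \<comment> \<open>For fixed \<open>a\<close> the last coordinate is replaced by the level
    \<open>s = \<sigma> a + w\<close>.\<close>
  also have "\<dots> = (\<integral>\<^sup>+a. (\<integral>\<^sup>+s. f (J (a, s - \<sigma> a)) \<partial>lborel) \<partial>lborel)"
  proof (rule nn_integral_cong)
    fix a
    have "(\<lambda>w. f (J (a, w))) \<in> borel_measurable borel" by measurable
    from nn_integral_real_affine[OF this, of 1 "- \<sigma> a"]
    show "(\<integral>\<^sup>+w. f (J (a, w)) \<partial>lborel) = (\<integral>\<^sup>+s. f (J (a, s - \<sigma> a)) \<partial>lborel)"
      by (simp add: add.commute)
  qed
  also have "\<dots> = (\<integral>\<^sup>+s. (\<integral>\<^sup>+a. f (J (a, s - \<sigma> a)) \<partial>lborel) \<partial>lborel)"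
    by (rule lborel_pair.Fubini', rule borel_measurable_lborel_pair) measurable
  also have "\<dots> = (\<integral>\<^sup>+s. (\<integral>\<^sup>+u. indicator {0<..} s * ennreal (s ^ d) * f (s *\<^sub>R U u) \<partial>lborel) \<partial>lborel)"
  proof (rule nn_integral_cong)
    fix s :: real
    show "(\<integral>\<^sup>+a. f (J (a, s - \<sigma> a)) \<partial>lborel) = (\<integral>\<^sup>+u. indicator {0<..} s * ennreal (s ^ d) * f (s *\<^sub>R U u) \<partial>lborel)"
    proof (cases "0 < s")
      case False
      then have "f (J (a, s - \<sigma> a)) = 0" for a using P(3)[of a "s - \<sigma> a"] by (auto simp: f_def indicator_def)
      then show ?thesis using False by simp
    next
      case True
      \<comment> \<open>Rescaling \<open>a\<close> by \<open>s\<close> carries the slice at level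
        \<open>s\<close> to the slice at level 1 and contributes the factor
        \<open>s ^ d\<close>.\<close>
      have "J (s *\<^sub>R u, s - \<sigma> (s *\<^sub>R u)) = s *\<^sub>R U u" for u
        using linear_scale[OF J(2), of s "(u, 1 - \<sigma> u)"] linear_scale[OF \<sigma>, of s u]
        by (simp add: U_def algebra_simps)
      moreover have "(\<lambda>a. f (J (a, s - \<sigma> a))) \<in> borel_measurable borel" by measurable
      from nn_integral_lborel_scale[OF this True]
      have "(\<integral>\<^sup>+a. f (J (a, s - \<sigma> a)) \<partial>lborel) =
          (\<integral>\<^sup>+u. ennreal (s ^ d) * f (J (s *\<^sub>R u, s - \<sigma> (s *\<^sub>R u))) \<partial>lborel)"
        by (simp only: d_def)
      ultimately have "(\<integral>\<^sup>+a. f (J (a, s - \<sigma> a)) \<partial>lborel) = (\<integral>\<^sup>+u. ennreal (s ^ d) * f (s *\<^sub>R U u) \<partial>lborel)"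
        by (simp only:)
      then show ?thesis using True by simp
    qed
  qed
  also have "\<dots> = (\<integral>\<^sup>+u. (\<integral>\<^sup>+s. indicator {0<..} s * ennreal (s ^ d) * f (s *\<^sub>R U u) \<partial>lborel) \<partial>lborel)"
    unfolding U_def by (rule lborel_pair.Fubini', rule borel_measurable_lborel_pair) measurable
  also have "\<dots> = (\<integral>\<^sup>+u. ennreal (1 / (real (d + 1) * sqrt (q (U u)) ^ (d + 1))) * indicator P (U u) \<partial>lborel)"
  proof (rule nn_integral_cong)
    fix u
    show "(\<integral>\<^sup>+s. indicator {0<..} s * ennreal (s ^ d) * f (s *\<^sub>R U u) \<partial>lborel)
        = ennreal (1 / (real (d + 1) * sqrt (q (U u)) ^ (d + 1))) * indicator P (U u)"
    proof (cases "U u \<in> P")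
      case False
      then have z: "indicator {0<..} s * ennreal (s ^ d) * f (s *\<^sub>R U u) = 0" for s
        using P(2)[of s "U u"] by (auto simp: f_def indicator_def)
      show ?thesis unfolding z using False by simp
    next
      case True
      define r where "r = 1 / sqrt (q (U u))"
      have r: "0 < r" using q(3)[OF True] by (simp add: r_def)
      have iff: "s\<^sup>2 * q (U u) \<le> 1 \<longleftrightarrow> s \<le> r" if "0 < s" for s
      proof -
        have "s\<^sup>2 * q (U u) = (s / r)\<^sup>2" using q(3)[OF True] by (simp add: r_def power_mult_distrib)
        also have "\<dots> \<le> 1 \<longleftrightarrow> s / r \<le> 1" using that r by (simp add: abs_square_le_1)
        finally show ?thesis using r by simp
      qed
      \<comment> \<open>Used at \<open>s = 0\<close>, which belongs to the closed interval on the
        right-hand side: \<open>0 ^ d\<close> has to vanish there.\<close>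
      have "0 < d" by (simp add: d_def)
      then have "indicator {0<..} s * ennreal (s ^ d) * f (s *\<^sub>R U u) = ennreal (s ^ d) * indicator {0..r} s" for s
        using iff[of s] P(2)[of s "U u"] True by (cases "s = 0") (auto simp: f_def indicator_def q(2))
      then have "(\<integral>\<^sup>+s. indicator {0<..} s * ennreal (s ^ d) * f (s *\<^sub>R U u) \<partial>lborel)
          = (\<integral>\<^sup>+s. ennreal (s ^ d) * indicator {0..r} s \<partial>lborel)" by (simp only:)
      also have "\<dots> = ennreal (r ^ (d + 1) / real (d + 1) - 0 ^ (d + 1) / real (d + 1))"
      proof (rule nn_integral_FTC_Icc)
        show "((\<lambda>x. x ^ (d + 1) / real (d + 1)) has_real_derivative x ^ d) (at x)" for x :: real
        proof -
          have "((\<lambda>x. x ^ (d + 1) / real (d + 1)) has_real_derivative real (d + 1) * x ^ (d + 1 - 1) / real (d + 1)) (at x)"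
            using DERIV_cdivide[OF DERIV_pow[of "d + 1" x UNIV], of "real (d + 1)"] by simp
          then show ?thesis by simp
        qed
      qed (use r in auto)
      finally show ?thesis using True by (simp add: r_def power_divide mult.commute)
    qed
  qed
  finally show ?thesis .
qed

section \<open>Integration over the standard simplex\<close>

text \<open>Nested pairs carry product measures. The last coordinate is kept apart because
  normalizing the coordinate sum to 1 eliminates it.\<close>

definition join3 :: "(real \<times> real) \<times> real \<Rightarrow> real ^ 3" where
  "join3 = (\<lambda>((x, y), w). \<chi> i. if i = 1 then x else if i = 2 then y else w)"

definition join4 :: "(real \<times> real \<times> real) \<times> real \<Rightarrow> real ^ 4" where
  "join4 = (\<lambda>((x, y, z), w). \<chi> i. if i = 1 then x else if i = 2 then y else if i = 3 then z else w)"

definition bary3 :: "real \<times> real \<Rightarrow> real ^ 3" where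
  "bary3 = (\<lambda>(x, y). join3 ((x, y), 1 - (x + y)))"

definition bary4 :: "real \<times> real \<times> real \<Rightarrow> real ^ 4" where
  "bary4 = (\<lambda>(x, y, z). join4 ((x, y, z), 1 - (x + y + z)))"

lemma join3_nth [simp]:
  "join3 ((x, y), w) $ 1 = x" "join3 ((x, y), w) $ 2 = y" "join3 ((x, y), w) $ 3 = w"
  by (simp_all add: join3_def)

lemma join4_nth [simp]:
  "join4 ((x, y, z), w) $ 1 = x" "join4 ((x, y, z), w) $ 2 = y" "join4 ((x, y, z), w) $ 3 = z" "join4 ((x, y, z), w) $ 4 = w"
  by (simp_all add: join4_def)

lemma bary3_nth [simp]: "bary3 (x, y) $ 1 = x" "bary3 (x, y) $ 2 = y" "bary3 (x, y) $ 3 = 1 - (x + y)"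
  by (simp_all add: bary3_def)

lemma bary4_nth [simp]:
  "bary4 (x, y, z) $ 1 = x" "bary4 (x, y, z) $ 2 = y" "bary4 (x, y, z) $ 3 = z" "bary4 (x, y, z) $ 4 = 1 - (x + y + z)"
  by (simp_all add: bary4_def)

lemma linear_join3: "linear join3"
  by (rule linearI) (auto simp: vec_eq_iff forall_3)

lemma linear_join4: "linear join4"
  by (rule linearI) (auto simp: vec_eq_iff forall_4)

lemma prod_Basis_vec: "(\<Prod>b\<in>Basis. (u - l) \<bullet> b) = (\<Prod>i\<in>UNIV. u $ i - l $ i)" for u l :: "real ^ 'n::finite"
proof -
  have B: "(Basis :: (real ^ 'n) set) = (\<lambda>i. axis i 1) ` UNIV" by (auto simp: Basis_vec_def)
  have inj: "inj (\<lambda>i. axis i 1 :: real ^ 'n)" by (auto simp: inj_on_def axis_eq_axis)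
  show ?thesis unfolding B by (simp add: prod.reindex[OF inj] inner_axis)
qed

lemma prod_4: "(\<Prod>i\<in>UNIV. f i) = f 1 * f 2 * f 3 * f (4::4)" for f :: "4 \<Rightarrow> real"
  unfolding UNIV_4 by (simp add: mult_ac)

lemma prod_3: "(\<Prod>i\<in>UNIV. f i) = f 1 * f 2 * f (3::3)" for f :: "3 \<Rightarrow> real"
  unfolding UNIV_3 by (simp add: mult_ac)

lemma borel_linear: "linear f \<Longrightarrow> f \<in> borel_measurable borel" for f :: "'a::euclidean_space \<Rightarrow> 'b::euclidean_space"
  by (intro borel_measurable_continuous_onI linear_continuous_on) (simp add: linear_conv_bounded_linear)

lemma emeasure_lborel_Times:
  fixes A :: "'a::euclidean_space set" and B :: "'b::euclidean_space set"
  assumes "A \<in> sets borel" "B \<in> sets borel"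
  shows "emeasure lborel (A \<times> B) = emeasure lborel A * emeasure lborel B"
  unfolding lborel_prod[symmetric] using assms by (intro lborel.emeasure_pair_measure_Times) auto

lemma component_le:
  fixes l u :: "real ^ 'n::finite"
  assumes "\<And>b. b \<in> Basis \<Longrightarrow> l \<bullet> b \<le> u \<bullet> b"
  shows "l $ i \<le> u $ i"
  using assms[of "axis i 1"] by (simp add: inner_axis axis_in_Basis_iff)

lemma lborel_join3: "lborel = distr lborel borel join3"
proof (rule lborel_eqI)
  fix l u :: "real ^ 3" assume "\<And>b. b \<in> Basis \<Longrightarrow> l \<bullet> b \<le> u \<bullet> b"
  then have le: "l $ i \<le> u $ i" for i by (rule component_le)
  have "join3 -` box l u = (({l $ 1<..<u $ 1} \<times> {l $ 2<..<u $ 2}) \<times> {l $ 3<..<u $ 3})"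
    by (auto simp: mem_box_cart forall_3)
  then show "emeasure (distr lborel borel join3) (box l u) = (\<Prod>b\<in>Basis. (u - l) \<bullet> b)"
    unfolding prod_Basis_vec prod_3 using le
    by (simp add: emeasure_distr borel_linear[OF linear_join3] emeasure_lborel_Times borel_Times ennreal_mult mult_ac)
qed simp

lemma lborel_join4: "lborel = distr lborel borel join4"
proof (rule lborel_eqI)
  fix l u :: "real ^ 4" assume "\<And>b. b \<in> Basis \<Longrightarrow> l \<bullet> b \<le> u \<bullet> b"
  then have le: "l $ i \<le> u $ i" for i by (rule component_le)
  have "join4 -` box l u = (({l $ 1<..<u $ 1} \<times> {l $ 2<..<u $ 2} \<times> {l $ 3<..<u $ 3}) \<times> {l $ 4<..<u $ 4})"
    by (auto simp: mem_box_cart forall_4)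
  then show "emeasure (distr lborel borel join4) (box l u) = (\<Prod>b\<in>Basis. (u - l) \<bullet> b)"
    unfolding prod_Basis_vec prod_4 using le
    by (simp add: emeasure_distr borel_linear[OF linear_join4] emeasure_lborel_Times borel_Times ennreal_mult mult_ac)
qed simp

definition simplex3 :: "(real \<times> real) set" where
  "simplex3 = {(x, y). 0 < x \<and> 0 < y \<and> x + y < 1}"

definition simplex4 :: "(real \<times> real \<times> real) set" where
  "simplex4 = {(x, y, z). 0 < x \<and> 0 < y \<and> 0 < z \<and> x + y + z < 1}"

lemma bary3_pos_iff: "(\<forall>i. 0 < bary3 u $ i) \<longleftrightarrow> u \<in> simplex3"
  by (cases u) (auto simp: forall_3 simplex3_def)

lemma bary4_pos_iff: "(\<forall>i. 0 < bary4 u $ i) \<longleftrightarrow> u \<in> simplex4"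
  by (cases u) (auto simp: forall_4 simplex4_def)

lemma open_simplex3: "open simplex3"
proof -
  have "simplex3 = {u. 0 < fst u} \<inter> {u. 0 < snd u} \<inter> {u. fst u + snd u < 1}" by (auto simp: simplex3_def)
  also have "open \<dots>" by (intro open_Int open_Collect_less continuous_intros)
  finally show ?thesis .
qed

lemma open_simplex4: "open simplex4"
proof -
  have "simplex4 = {u. 0 < fst u} \<inter> {u. 0 < fst (snd u)} \<inter> {u. 0 < snd (snd u)} \<inter> {u. fst u + fst (snd u) + snd (snd u) < 1}"
    by (auto simp: simplex4_def)
  also have "open \<dots>" by (intro open_Int open_Collect_less continuous_intros)
  finally show ?thesis .
qed

lemma coord_body_alt: "coord_body v = {x \<in> {x. \<forall>i. 0 < x $ i}. (norm (\<Sum>i\<in>UNIV. x $ i *\<^sub>R v i))\<^sup>2 \<le> 1}"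
  by (auto simp: coord_body_def)

lemma quadratic_form_props:
  fixes v :: "'n::finite \<Rightarrow> real ^ 'n"
  assumes "lin_indep v"
  shows "(\<lambda>x. (norm (\<Sum>i\<in>UNIV. x $ i *\<^sub>R v i))\<^sup>2) \<in> borel_measurable borel"
    and "(norm (\<Sum>i\<in>UNIV. (s *\<^sub>R x) $ i *\<^sub>R v i))\<^sup>2 = s\<^sup>2 * (norm (\<Sum>i\<in>UNIV. x $ i *\<^sub>R v i))\<^sup>2"
    and "\<forall>i. 0 < x $ i \<Longrightarrow> 0 < (norm (\<Sum>i\<in>UNIV. x $ i *\<^sub>R v i))\<^sup>2"
proof -
  show "(\<lambda>x. (norm (\<Sum>i\<in>UNIV. x $ i *\<^sub>R v i))\<^sup>2) \<in> borel_measurable borel"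
    by (intro borel_measurable_continuous_onI continuous_intros)
  have "(\<Sum>i\<in>UNIV. (s *\<^sub>R x) $ i *\<^sub>R v i) = s *\<^sub>R (\<Sum>i\<in>UNIV. x $ i *\<^sub>R v i)"
    by (simp add: scaleR_sum_right)
  then show "(norm (\<Sum>i\<in>UNIV. (s *\<^sub>R x) $ i *\<^sub>R v i))\<^sup>2 = s\<^sup>2 * (norm (\<Sum>i\<in>UNIV. x $ i *\<^sub>R v i))\<^sup>2"
    by (simp add: power_mult_distrib)
  show "0 < (norm (\<Sum>i\<in>UNIV. x $ i *\<^sub>R v i))\<^sup>2" if "\<forall>i. 0 < x $ i"
    using lin_indep_sum_zero[OF assms, of "\<lambda>i. x $ i"] that by force
qed

text \<open>The cone section at coordinate sum 1, where the positive orthant becomes the open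
  standard simplex.\<close>

lemma emeasure_coord_body_3:
  fixes v :: "3 \<Rightarrow> real ^ 3"
  assumes "lin_indep v"
  shows "emeasure lborel (coord_body v) =
    (\<integral>\<^sup>+u. ennreal (1 / (3 * norm (\<Sum>i\<in>UNIV. bary3 u $ i *\<^sub>R v i) ^ 3)) * indicator simplex3 u \<partial>lborel)"
proof -
  have lin: "linear (\<lambda>(x :: real, y :: real). x + y)" by (rule linearI) (auto simp: algebra_simps)
  have eq: "join3 (u, 1 - (case u of (x, y) \<Rightarrow> x + y)) = bary3 u" for u
    by (cases u) (simp add: bary3_def)
  have ind: "indicator {x. \<forall>i. 0 < x $ i} (bary3 u) = (indicator simplex3 u :: ennreal)" for u
    by (simp add: indicator_def bary3_pos_iff)
  have d: "real (DIM(real \<times> real) + 1) = 3" "DIM(real \<times> real) + 1 = 3" by simp_all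
  have "emeasure lborel {x \<in> {x. \<forall>i. 0 < x $ i}. (norm (\<Sum>i\<in>UNIV. x $ i *\<^sub>R v i))\<^sup>2 \<le> 1} =
    (\<integral>\<^sup>+u. ennreal (1 / (real (DIM(real \<times> real) + 1) *
        sqrt ((norm (\<Sum>i\<in>UNIV. join3 (u, 1 - (case u of (x, y) \<Rightarrow> x + y)) $ i *\<^sub>R v i))\<^sup>2) ^ (DIM(real \<times> real) + 1)))
      * indicator {x. \<forall>i. 0 < x $ i} (join3 (u, 1 - (case u of (x, y) \<Rightarrow> x + y))) \<partial>lborel)"
    by (rule emeasure_cone_section[OF lborel_join3 linear_join3 lin borel_positive_orthant _ _ quadratic_form_props[OF assms]])
      (auto simp: forall_3 zero_less_mult_iff)
  then show ?thesis
    unfolding coord_body_alt by (simp only: eq ind d real_sqrt_abs abs_norm_cancel of_nat_numeral)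
qed

lemma emeasure_coord_body_4:
  fixes v :: "4 \<Rightarrow> real ^ 4"
  assumes "lin_indep v"
  shows "emeasure lborel (coord_body v) =
    (\<integral>\<^sup>+u. ennreal (1 / (4 * norm (\<Sum>i\<in>UNIV. bary4 u $ i *\<^sub>R v i) ^ 4)) * indicator simplex4 u \<partial>lborel)"
proof -
  have lin: "linear (\<lambda>(x :: real, y :: real, z :: real). x + y + z)" by (rule linearI) (auto simp: algebra_simps)
  have eq: "join4 (u, 1 - (case u of (x, y, z) \<Rightarrow> x + y + z)) = bary4 u" for u
    by (cases u) (simp add: bary4_def)
  have ind: "indicator {x. \<forall>i. 0 < x $ i} (bary4 u) = (indicator simplex4 u :: ennreal)" for u
    by (simp add: indicator_def bary4_pos_iff)
  have d: "real (DIM(real \<times> real \<times> real) + 1) = 4" "DIM(real \<times> real \<times> real) + 1 = 4" by simp_all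
  have "emeasure lborel {x \<in> {x. \<forall>i. 0 < x $ i}. (norm (\<Sum>i\<in>UNIV. x $ i *\<^sub>R v i))\<^sup>2 \<le> 1} =
    (\<integral>\<^sup>+u. ennreal (1 / (real (DIM(real \<times> real \<times> real) + 1) *
        sqrt ((norm (\<Sum>i\<in>UNIV. join4 (u, 1 - (case u of (x, y, z) \<Rightarrow> x + y + z)) $ i *\<^sub>R v i))\<^sup>2) ^ (DIM(real \<times> real \<times> real) + 1)))
      * indicator {x. \<forall>i. 0 < x $ i} (join4 (u, 1 - (case u of (x, y, z) \<Rightarrow> x + y + z))) \<partial>lborel)"
    by (rule emeasure_cone_section[OF lborel_join4 linear_join4 lin borel_positive_orthant _ _ quadratic_form_props[OF assms]])
      (auto simp: forall_4 zero_less_mult_iff)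
  then show ?thesis
    unfolding coord_body_alt by (simp only: eq ind d real_sqrt_abs abs_norm_cancel of_nat_numeral)
qed

section \<open>Beta and Dirichlet integrals\<close>

text \<open>Integration by parts trades a factor \<open>r - y\<close> for a factor \<open>y\<close>;
  hence the induction on \<open>c\<close> with \<open>b\<close> arbitrary.\<close>

lemma has_integral_beta:
  fixes r :: real
  assumes "0 \<le> r"
  shows "((\<lambda>y. y ^ b * (r - y) ^ c) has_integral (fact b * fact c / fact (b + c + 1) * r ^ (b + c + 1))) {0..r}"
proof (induction c arbitrary: b)
  case 0
  have "((\<lambda>y. y ^ b) has_integral (r ^ (b + 1) / real (b + 1) - 0 ^ (b + 1) / real (b + 1))) {0..r}"
  proof (rule fundamental_theorem_of_calculus[OF assms])
    fix x :: real
    have "((\<lambda>x. x ^ (b + 1) / real (b + 1)) has_real_derivative real (b + 1) * x ^ (b + 1 - 1) / real (b + 1)) (at x within {0..r})"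
      by (rule DERIV_cdivide) (use DERIV_pow[of "b + 1" x "{0..r}"] in simp)
    then show "((\<lambda>x. x ^ (b + 1) / real (b + 1)) has_vector_derivative x ^ b) (at x within {0..r})"
      by (simp add: has_real_derivative_iff_has_vector_derivative[symmetric])
  qed
  moreover have "fact (b + 1) = real (b + 1) * fact b" by simp
  ultimately show ?case by (simp del: of_nat_add of_nat_Suc add: divide_simps)
next
  case (Suc c)
  let ?F = "\<lambda>y. y ^ Suc b * (r - y) ^ Suc c / real (Suc b)"
  have "((\<lambda>y. y ^ b * (r - y) ^ Suc c - real (Suc c) / real (Suc b) * (y ^ Suc b * (r - y) ^ c)) has_integral (?F r - ?F 0)) {0..r}"
  proof (rule fundamental_theorem_of_calculus[OF assms])
    fix x :: real
    have "(?F has_real_derivative (real (Suc b) * x ^ b * (r - x) ^ Suc c + x ^ Suc b * (real (Suc c) * (r - x) ^ c * (0 - 1))) / real (Suc b)) (at x within {0..r})"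
      by (rule derivative_eq_intros refl | simp del: power_Suc of_nat_Suc add: mult_ac)+
    also have "(real (Suc b) * x ^ b * (r - x) ^ Suc c + x ^ Suc b * (real (Suc c) * (r - x) ^ c * (0 - 1))) / real (Suc b)
       = x ^ b * (r - x) ^ Suc c - real (Suc c) / real (Suc b) * (x ^ Suc b * (r - x) ^ c)"
      by (simp add: field_simps del: power_Suc of_nat_Suc)
    finally show "(?F has_vector_derivative x ^ b * (r - x) ^ Suc c - real (Suc c) / real (Suc b) * (x ^ Suc b * (r - x) ^ c)) (at x within {0..r})"
      by (simp only: has_real_derivative_iff_has_vector_derivative)
  qed
  from has_integral_add[OF this has_integral_mult_right[OF Suc.IH[of "Suc b"], of "real (Suc c) / real (Suc b)"]]
  have "((\<lambda>y. y ^ b * (r - y) ^ Suc c) has_integral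
     (real (Suc c) / real (Suc b) * (fact (Suc b) * fact c / fact (Suc b + c + 1) * r ^ (Suc b + c + 1)))) {0..r}"
    by simp
  moreover have "real (Suc c) / real (Suc b) * (fact (Suc b) * fact c / fact (Suc b + c + 1) * r ^ (Suc b + c + 1))
     = fact b * fact (Suc c) / fact (b + Suc c + 1) * r ^ (b + Suc c + 1)"
    by (simp add: field_simps del: of_nat_Suc)
  ultimately show ?case by (simp only:)
qed

lemma nn_integral_beta:
  fixes r :: real
  assumes "0 \<le> r"
  shows "(\<integral>\<^sup>+y. ennreal (y ^ b * (r - y) ^ c) * indicator {0<..<r} y \<partial>lborel)
     = ennreal (fact b * fact c / fact (b + c + 1) * r ^ (b + c + 1))"
proof -
  have "(\<integral>\<^sup>+y. ennreal (y ^ b * (r - y) ^ c) * indicator {0<..<r} y \<partial>lborel)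
      = (\<integral>\<^sup>+y. ennreal (y ^ b * (r - y) ^ c) * indicator {0..r} y \<partial>lborel)"
  proof (rule nn_integral_cong_AE)
    have "AE y in lborel. y \<noteq> 0 \<and> y \<noteq> r" by (intro AE_conjI AE_lborel_singleton)
    then show "AE y in lborel. ennreal (y ^ b * (r - y) ^ c) * indicator {0<..<r} y = ennreal (y ^ b * (r - y) ^ c) * indicator {0..r} y"
      by eventually_elim (auto simp: indicator_def)
  qed
  also have "\<dots> = ennreal (fact b * fact c / fact (b + c + 1) * r ^ (b + c + 1))"
    using has_integral_beta[OF assms] by (rule nn_integral_has_integral_lebesgue'[rotated]) auto
  finally show ?thesis .
qed


lemma nn_integral_lborel_pair:
  fixes f :: "'a::euclidean_space \<times> 'b::euclidean_space \<Rightarrow> ennreal"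
  assumes "f \<in> borel_measurable borel"
  shows "(\<integral>\<^sup>+p. f p \<partial>lborel) = (\<integral>\<^sup>+x. (\<integral>\<^sup>+y. f (x, y) \<partial>lborel) \<partial>lborel)"
proof -
  have "f \<in> borel_measurable (lborel \<Otimes>\<^sub>M lborel)" using assms by (simp add: lborel_prod)
  from lborel.nn_integral_fst[OF this] show ?thesis by (simp add: lborel_prod)
qed

lemma borel_triangle: "{(x :: real, y). 0 < x \<and> 0 < y \<and> x + y < r} \<in> sets borel"
proof -
  have "{(x, y). 0 < x \<and> 0 < y \<and> x + y < r} = {u. 0 < fst u} \<inter> {u. 0 < snd u} \<inter> {u. fst u + snd u < r}" by auto
  also have "open \<dots>" by (intro open_Int open_Collect_less continuous_intros)
  finally show ?thesis by simp
qed

text \<open>The side length \<open>r\<close> is kept general because the slices of the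
  three-dimensional simplex are triangles of side \<open>1 - x\<close>.\<close>

lemma nn_integral_dirichlet2:
  fixes r :: real
  assumes "0 \<le> r"
  shows "(\<integral>\<^sup>+p. ennreal (fst p ^ a * snd p ^ b * (r - (fst p + snd p)) ^ c)
      * indicator {(x, y). 0 < x \<and> 0 < y \<and> x + y < r} p \<partial>lborel)
     = ennreal (fact a * fact b * fact c / fact (a + b + c + 2) * r ^ (a + b + c + 2))" (is "integral\<^sup>N _ ?f = _")
proof -
  note borel_triangle[of r]
  moreover have "(\<lambda>p. fst p ^ a * snd p ^ b * (r - (fst p + snd p)) ^ c) \<in> borel_measurable (borel :: (real \<times> real) measure)"
    by (intro borel_measurable_continuous_onI continuous_intros)
  ultimately have "?f \<in> borel_measurable borel" by measurable
  then have "integral\<^sup>N lborel ?f = (\<integral>\<^sup>+x. (\<integral>\<^sup>+y. ?f (x, y) \<partial>lborel) \<partial>lborel)"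
    by (rule nn_integral_lborel_pair)
  also have "\<dots> = (\<integral>\<^sup>+x. ennreal (fact b * fact c / fact (b + c + 1)) * (ennreal (x ^ a * (r - x) ^ (b + c + 1)) * indicator {0<..<r} x) \<partial>lborel)"
  proof (rule nn_integral_cong)
    fix x :: real
    show "(\<integral>\<^sup>+y. ?f (x, y) \<partial>lborel) = ennreal (fact b * fact c / fact (b + c + 1)) * (ennreal (x ^ a * (r - x) ^ (b + c + 1)) * indicator {0<..<r} x)"
    proof (cases "0 < x \<and> x < r")
      case True
      have "?f (x, y) = ennreal (x ^ a) * (ennreal (y ^ b * ((r - x) - y) ^ c) * indicator {0<..<r - x} y)" for y
        using True by (auto simp: indicator_def ennreal_mult[symmetric] mult.assoc diff_diff_eq)
      then have "(\<integral>\<^sup>+y. ?f (x, y) \<partial>lborel) = ennreal (x ^ a) * ennreal (fact b * fact c / fact (b + c + 1) * (r - x) ^ (b + c + 1))"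
        using True nn_integral_beta[of "r - x" b c] by (simp add: nn_integral_cmult)
      then show ?thesis using True by (simp add: ennreal_mult[symmetric] mult_ac)
    next
      case False
      then have "(\<integral>\<^sup>+y. ?f (x, y) \<partial>lborel) = (\<integral>\<^sup>+y. 0 \<partial>(lborel :: real measure))"
        by (intro nn_integral_cong) (auto simp: indicator_def)
      moreover have "indicator {0<..<r} x = (0 :: ennreal)" using False by auto
      ultimately show ?thesis by (simp only: nn_integral_const mult_zero_left mult_zero_right)
    qed
  qed
  also have "\<dots> = ennreal (fact b * fact c / fact (b + c + 1)) * ennreal (fact a * fact (b + c + 1) / fact (a + (b + c + 1) + 1) * r ^ (a + (b + c + 1) + 1))"
    using nn_integral_beta[OF assms, of a "b + c + 1"] by (subst nn_integral_cmult) (simp_all only:, measurable)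
  also have "\<dots> = ennreal (fact a * fact b * fact c / fact (a + b + c + 2) * r ^ (a + b + c + 2))"
    using assms by (simp add: ennreal_mult[symmetric] add_ac del: fact_Suc power_Suc)
  finally show ?thesis .
qed

lemma nn_integral_dirichlet3:
  shows "(\<integral>\<^sup>+p. ennreal (fst p ^ a * fst (snd p) ^ b * snd (snd p) ^ c * (1 - (fst p + fst (snd p) + snd (snd p))) ^ d)
      * indicator simplex4 p \<partial>lborel)
     = ennreal (fact a * fact b * fact c * fact d / fact (a + b + c + d + 3))" (is "integral\<^sup>N _ ?f = _")
proof -
  have "simplex4 \<in> sets borel" using open_simplex4 by simp
  moreover have "(\<lambda>p. fst p ^ a * fst (snd p) ^ b * snd (snd p) ^ c * (1 - (fst p + fst (snd p) + snd (snd p))) ^ d)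
      \<in> borel_measurable (borel :: (real \<times> real \<times> real) measure)"
    by (intro borel_measurable_continuous_onI continuous_intros)
  ultimately have "?f \<in> borel_measurable borel" by measurable
  then have "integral\<^sup>N lborel ?f = (\<integral>\<^sup>+x. (\<integral>\<^sup>+q. ?f (x, q) \<partial>lborel) \<partial>lborel)"
    by (rule nn_integral_lborel_pair)
  also have "\<dots> = (\<integral>\<^sup>+x. ennreal (fact b * fact c * fact d / fact (b + c + d + 2)) * (ennreal (x ^ a * (1 - x) ^ (b + c + d + 2)) * indicator {0<..<1} x) \<partial>lborel)"
  proof (rule nn_integral_cong)
    fix x :: real
    show "(\<integral>\<^sup>+q. ?f (x, q) \<partial>lborel) = ennreal (fact b * fact c * fact d / fact (b + c + d + 2)) * (ennreal (x ^ a * (1 - x) ^ (b + c + d + 2)) * indicator {0<..<1} x)"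
    proof (cases "0 < x \<and> x < 1")
      case True
      define g where "g q = ennreal (fst q ^ b * snd q ^ c * ((1 - x) - (fst q + snd q)) ^ d)
          * indicator {(y, z). 0 < y \<and> 0 < z \<and> y + z < 1 - x} q" for q :: "real \<times> real"
      note borel_triangle[of "1 - x"]
      moreover have "(\<lambda>q. fst q ^ b * snd q ^ c * ((1 - x) - (fst q + snd q)) ^ d) \<in> borel_measurable (borel :: (real \<times> real) measure)"
        by (intro borel_measurable_continuous_onI continuous_intros)
      ultimately have g: "g \<in> borel_measurable borel" unfolding g_def by measurable
      have "(\<integral>\<^sup>+q. ?f (x, q) \<partial>lborel) = (\<integral>\<^sup>+q. ennreal (x ^ a) * g q \<partial>lborel)"
        using True
        by (intro nn_integral_cong) (auto simp: g_def simplex4_def indicator_def ennreal_mult[symmetric] mult.assoc diff_diff_eq add.assoc)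
      also have "\<dots> = ennreal (x ^ a) * (\<integral>\<^sup>+q. g q \<partial>lborel)"
        using g by (intro nn_integral_cmult) simp
      also have "(\<integral>\<^sup>+q. g q \<partial>lborel) = ennreal (fact b * fact c * fact d / fact (b + c + d + 2) * (1 - x) ^ (b + c + d + 2))"
        unfolding g_def using True by (intro nn_integral_dirichlet2) simp
      finally have "(\<integral>\<^sup>+q. ?f (x, q) \<partial>lborel) = ennreal (x ^ a) * ennreal (fact b * fact c * fact d / fact (b + c + d + 2) * (1 - x) ^ (b + c + d + 2))" .
      then show ?thesis using True by (simp add: ennreal_mult[symmetric] mult_ac)
    next
      case False
      then have "(\<integral>\<^sup>+q. ?f (x, q) \<partial>lborel) = (\<integral>\<^sup>+q. 0 \<partial>(lborel :: (real \<times> real) measure))"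
        by (intro nn_integral_cong) (auto simp: simplex4_def indicator_def)
      moreover have "indicator {0<..<1} x = (0 :: ennreal)" using False by auto
      ultimately show ?thesis by (simp only: nn_integral_const mult_zero_left mult_zero_right)
    qed
  qed
  also have "\<dots> = ennreal (fact b * fact c * fact d / fact (b + c + d + 2)) * ennreal (fact a * fact (b + c + d + 2) / fact (a + (b + c + d + 2) + 1) * 1 ^ (a + (b + c + d + 2) + 1))"
    using nn_integral_beta[of 1 a "b + c + d + 2"] by (subst nn_integral_cmult) (simp_all, measurable)
  also have "\<dots> = ennreal (fact a * fact b * fact c * fact d / fact (a + b + c + d + 3))"
  proof -
    have e: "a + (b + c + d + 2) + 1 = a + b + c + d + 3" by simp
    show ?thesis unfolding e by (simp add: ennreal_mult[symmetric] del: fact_Suc)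
  qed
  finally show ?thesis .
qed

section \<open>Moments over the simplex\<close>

text \<open>Lebesgue measure on the simplex without normalization; the total masses are 1/2 here and
  1/6 in the next dimension.\<close>

definition simplex_measure3 :: "(real \<times> real) measure" where
  "simplex_measure3 = density lborel (indicator simplex3)"

definition simplex_measure4 :: "(real \<times> real \<times> real) measure" where
  "simplex_measure4 = density lborel (indicator simplex4)"

lemma bary3_sel: "bary3 u $ 1 = fst u" "bary3 u $ 2 = snd u" "bary3 u $ 3 = 1 - (fst u + snd u)"
  by (cases u; simp)+

lemma bary4_sel: "bary4 u $ 1 = fst u" "bary4 u $ 2 = fst (snd u)" "bary4 u $ 3 = snd (snd u)"
  "bary4 u $ 4 = 1 - (fst u + fst (snd u) + snd (snd u))"
  by (cases u; simp)+

lemma borel_simplex: "simplex3 \<in> sets borel" "simplex4 \<in> sets borel"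
  using open_simplex3 open_simplex4 by auto

lemma sets_simplex_measure [measurable_cong]: "sets simplex_measure3 = sets borel" "sets simplex_measure4 = sets borel"
  by (simp_all add: simplex_measure3_def simplex_measure4_def)

lemma AE_simplex_measure3: "AE u in simplex_measure3. u \<in> simplex3"
  unfolding simplex_measure3_def using borel_simplex by (subst AE_density) (auto simp: indicator_def)

lemma AE_simplex_measure4: "AE u in simplex_measure4. u \<in> simplex4"
  unfolding simplex_measure4_def using borel_simplex by (subst AE_density) (auto simp: indicator_def)

lemma continuous_bary3: "continuous_on UNIV (\<lambda>u. bary3 u $ i)"
proof -
  consider "i = 1" | "i = 2" | "i = 3" using exhaust_3 by blast
  then show ?thesis by cases (auto simp: bary3_sel intro!: continuous_intros)
qed

lemma continuous_bary4: "continuous_on UNIV (\<lambda>u. bary4 u $ i)"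
proof -
  consider "i = 1" | "i = 2" | "i = 3" | "i = 4" using exhaust_4 by blast
  then show ?thesis by cases (auto simp: bary4_sel intro!: continuous_intros)
qed

lemma borel_bary [measurable]:
  "(\<lambda>u. bary3 u $ i) \<in> borel_measurable borel" "(\<lambda>u. bary4 u $ j) \<in> borel_measurable borel"
  by (intro borel_measurable_continuous_onI continuous_bary3 continuous_bary4)+

lemma nn_integral_simplex_measure3:
  assumes "f \<in> borel_measurable borel"
  shows "(\<integral>\<^sup>+u. f u \<partial>simplex_measure3) = (\<integral>\<^sup>+u. f u * indicator simplex3 u \<partial>lborel)"
  unfolding simplex_measure3_def using assms borel_simplex
  by (subst nn_integral_density) (auto simp: mult.commute)

lemma nn_integral_simplex_measure4:
  assumes "f \<in> borel_measurable borel"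
  shows "(\<integral>\<^sup>+u. f u \<partial>simplex_measure4) = (\<integral>\<^sup>+u. f u * indicator simplex4 u \<partial>lborel)"
  unfolding simplex_measure4_def using assms borel_simplex
  by (subst nn_integral_density) (auto simp: mult.commute)

lemma simplex_moment3:
  "has_bochner_integral simplex_measure3 (\<lambda>u. bary3 u $ 1 ^ a * bary3 u $ 2 ^ b * bary3 u $ 3 ^ c)
     (fact a * fact b * fact c / fact (a + b + c + 2))"
proof (rule has_bochner_integral_nn_integral)
  show "AE u in simplex_measure3. 0 \<le> bary3 u $ 1 ^ a * bary3 u $ 2 ^ b * bary3 u $ 3 ^ c"
    using AE_simplex_measure3 by eventually_elim (auto simp: simplex3_def)
  have "(\<integral>\<^sup>+u. ennreal (bary3 u $ 1 ^ a * bary3 u $ 2 ^ b * bary3 u $ 3 ^ c) \<partial>simplex_measure3)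
     = (\<integral>\<^sup>+p. ennreal (fst p ^ a * snd p ^ b * (1 - (fst p + snd p)) ^ c)
          * indicator {(x, y). 0 < x \<and> 0 < y \<and> x + y < 1} p \<partial>lborel)"
    by (subst nn_integral_simplex_measure3, measurable) (simp add: bary3_sel simplex3_def)
  then show "(\<integral>\<^sup>+u. ennreal (bary3 u $ 1 ^ a * bary3 u $ 2 ^ b * bary3 u $ 3 ^ c) \<partial>simplex_measure3)
     = ennreal (fact a * fact b * fact c / fact (a + b + c + 2))"
    using nn_integral_dirichlet2[of 1 a b c] by simp
qed simp_all

lemma simplex_moment4:
  "has_bochner_integral simplex_measure4 (\<lambda>u. bary4 u $ 1 ^ a * bary4 u $ 2 ^ b * bary4 u $ 3 ^ c * bary4 u $ 4 ^ d)
     (fact a * fact b * fact c * fact d / fact (a + b + c + d + 3))"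
proof (rule has_bochner_integral_nn_integral)
  show "AE u in simplex_measure4. 0 \<le> bary4 u $ 1 ^ a * bary4 u $ 2 ^ b * bary4 u $ 3 ^ c * bary4 u $ 4 ^ d"
    using AE_simplex_measure4 by eventually_elim (auto simp: simplex4_def)
  have "(\<integral>\<^sup>+u. ennreal (bary4 u $ 1 ^ a * bary4 u $ 2 ^ b * bary4 u $ 3 ^ c * bary4 u $ 4 ^ d) \<partial>simplex_measure4)
     = (\<integral>\<^sup>+p. ennreal (fst p ^ a * fst (snd p) ^ b * snd (snd p) ^ c * (1 - (fst p + fst (snd p) + snd (snd p))) ^ d)
      * indicator simplex4 p \<partial>lborel)"
    by (subst nn_integral_simplex_measure4, measurable) (simp add: bary4_sel)
  then show "(\<integral>\<^sup>+u. ennreal (bary4 u $ 1 ^ a * bary4 u $ 2 ^ b * bary4 u $ 3 ^ c * bary4 u $ 4 ^ d) \<partial>simplex_measure4)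
     = ennreal (fact a * fact b * fact c * fact d / fact (a + b + c + d + 3))"
    using nn_integral_dirichlet3[of a b c d] by simp
qed simp_all

lemma measure_coord_body_3:
  fixes v :: "3 \<Rightarrow> real ^ 3"
  assumes "lin_indep v"
  defines "f \<equiv> \<lambda>u. 1 / (3 * norm (\<Sum>i\<in>UNIV. bary3 u $ i *\<^sub>R v i) ^ 3)"
  shows "has_bochner_integral simplex_measure3 f (measure lebesgue (coord_body v))"
proof (rule has_bochner_integral_nn_integral)
  have m: "f \<in> borel_measurable borel" unfolding f_def by measurable
  then show "f \<in> borel_measurable simplex_measure3" by simp
  have "(\<integral>\<^sup>+u. ennreal (f u) \<partial>simplex_measure3) = emeasure lborel (coord_body v)"
    unfolding emeasure_coord_body_3[OF assms(1)] using m by (subst nn_integral_simplex_measure3) (auto simp: f_def)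
  also have "\<dots> = emeasure lebesgue (coord_body v)" using borel_coord_body[of v] by simp
  also have "\<dots> = ennreal (measure lebesgue (coord_body v))"
    using lmeasurable_coord_body[OF assms(1)] by (intro emeasure_eq_measure2 fmeasurableD)
  finally show "(\<integral>\<^sup>+u. ennreal (f u) \<partial>simplex_measure3) = ennreal (measure lebesgue (coord_body v))" .
qed (auto simp: f_def)

lemma measure_coord_body_4:
  fixes v :: "4 \<Rightarrow> real ^ 4"
  assumes "lin_indep v"
  defines "f \<equiv> \<lambda>u. 1 / (4 * norm (\<Sum>i\<in>UNIV. bary4 u $ i *\<^sub>R v i) ^ 4)"
  shows "has_bochner_integral simplex_measure4 f (measure lebesgue (coord_body v))"
proof (rule has_bochner_integral_nn_integral)
  have m: "f \<in> borel_measurable borel" unfolding f_def by measurable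
  then show "f \<in> borel_measurable simplex_measure4" by simp
  have "(\<integral>\<^sup>+u. ennreal (f u) \<partial>simplex_measure4) = emeasure lborel (coord_body v)"
    unfolding emeasure_coord_body_4[OF assms(1)] using m by (subst nn_integral_simplex_measure4) (auto simp: f_def)
  also have "\<dots> = emeasure lebesgue (coord_body v)" using borel_coord_body[of v] by simp
  also have "\<dots> = ennreal (measure lebesgue (coord_body v))"
    using lmeasurable_coord_body[OF assms(1)] by (intro emeasure_eq_measure2 fmeasurableD)
  finally show "(\<integral>\<^sup>+u. ennreal (f u) \<partial>simplex_measure4) = ennreal (measure lebesgue (coord_body v))" .
qed (auto simp: f_def)

definition sq_sum3 :: "real \<times> real \<Rightarrow> real" where
  "sq_sum3 u = (bary3 u $ 1)\<^sup>2 + (bary3 u $ 2)\<^sup>2 + (bary3 u $ 3)\<^sup>2"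

text \<open>Bracketed in pairs, so that the binomial theorem applies to each pair and both
  contribute the same numbers \<open>half_fact_conv\<close>.\<close>

definition sq_sum4 :: "real \<times> real \<times> real \<Rightarrow> real" where
  "sq_sum4 u = ((bary4 u $ 1)\<^sup>2 + (bary4 u $ 2)\<^sup>2) + ((bary4 u $ 3)\<^sup>2 + (bary4 u $ 4)\<^sup>2)"

definition half_fact :: "nat \<Rightarrow> real" where
  "half_fact i = fact (2 * i) / fact i"

definition half_fact_conv :: "nat \<Rightarrow> real" where
  "half_fact_conv m = (\<Sum>i\<le>m. half_fact i * half_fact (m - i))"

text \<open>In the multinomial expansion of the \<open>k\<close>-th power, the Dirichlet integral
  gives each variable with exponent \<open>2 * i\<close> the weight
  \<open>fact (2 * i) / fact i\<close>. The moments are therefore iterated convolutions of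
  \<open>half_fact\<close>.\<close>

definition sq_moment3 :: "nat \<Rightarrow> real" where
  "sq_moment3 k = fact k / fact (2 * k + 2) * (\<Sum>m\<le>k. half_fact_conv m * half_fact (k - m))"

definition sq_moment4 :: "nat \<Rightarrow> real" where
  "sq_moment4 k = fact k / fact (2 * k + 3) * (\<Sum>m\<le>k. half_fact_conv m * half_fact_conv (k - m))"

lemma binomial_fact_ring: "(x + y :: real) ^ m = (\<Sum>i\<le>m. fact m / (fact i * fact (m - i)) * (x ^ i * y ^ (m - i)))"
  unfolding binomial_ring by (rule sum.cong) (auto simp: binomial_fact)

lemma power_even: "x ^ (2 * i) = (x\<^sup>2) ^ i" for x :: real
  by (rule power_mult)

lemma sq_sum3_moment: "has_bochner_integral simplex_measure3 (\<lambda>u. sq_sum3 u ^ k) (sq_moment3 k)"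
proof -
  let ?c = "\<lambda>m i. fact m / (fact i * fact (m - i)) :: real"
  have "sq_sum3 u ^ k = (\<Sum>m\<le>k. \<Sum>i\<le>m. ?c k m * ?c m i *
      (bary3 u $ 1 ^ (2 * i) * bary3 u $ 2 ^ (2 * (m - i)) * bary3 u $ 3 ^ (2 * (k - m))))" for u
  proof -
    have "sq_sum3 u ^ k = (\<Sum>m\<le>k. ?c k m * (((bary3 u $ 1)\<^sup>2 + (bary3 u $ 2)\<^sup>2) ^ m * ((bary3 u $ 3)\<^sup>2) ^ (k - m)))"
      unfolding sq_sum3_def by (rule binomial_fact_ring)
    also have "\<dots> = (\<Sum>m\<le>k. \<Sum>i\<le>m. ?c k m * ?c m i *
      (bary3 u $ 1 ^ (2 * i) * bary3 u $ 2 ^ (2 * (m - i)) * bary3 u $ 3 ^ (2 * (k - m))))"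
      unfolding power_even by (intro sum.cong refl)
        (simp only: binomial_fact_ring sum_distrib_left sum_distrib_right mult_ac)
    finally show ?thesis .
  qed
  moreover have "has_bochner_integral simplex_measure3 (\<lambda>u. \<Sum>m\<le>k. \<Sum>i\<le>m. ?c k m * ?c m i *
      (bary3 u $ 1 ^ (2 * i) * bary3 u $ 2 ^ (2 * (m - i)) * bary3 u $ 3 ^ (2 * (k - m))))
    (\<Sum>m\<le>k. \<Sum>i\<le>m. ?c k m * ?c m i *
      (fact (2 * i) * fact (2 * (m - i)) * fact (2 * (k - m)) / fact (2 * i + 2 * (m - i) + 2 * (k - m) + 2)))"
    by (intro has_bochner_integral_sum has_bochner_integral_mult_right simplex_moment3)
  moreover have "(\<Sum>m\<le>k. \<Sum>i\<le>m. ?c k m * ?c m i *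
      (fact (2 * i) * fact (2 * (m - i)) * fact (2 * (k - m)) / fact (2 * i + 2 * (m - i) + 2 * (k - m) + 2))) = sq_moment3 k"
  proof -
    have "(\<Sum>i\<le>m. ?c k m * ?c m i *
      (fact (2 * i) * fact (2 * (m - i)) * fact (2 * (k - m)) / fact (2 * i + 2 * (m - i) + 2 * (k - m) + 2)))
      = fact k / fact (2 * k + 2) * (half_fact_conv m * half_fact (k - m))" if "m \<le> k" for m
      unfolding half_fact_conv_def sum_distrib_left sum_distrib_right
    proof (rule sum.cong[OF refl])
      fix i assume "i \<in> {..m}"
      then have e: "2 * i + 2 * (m - i) + 2 * (k - m) + 2 = 2 * k + 2" using that by auto
      show "?c k m * ?c m i * (fact (2 * i) * fact (2 * (m - i)) * fact (2 * (k - m)) / fact (2 * i + 2 * (m - i) + 2 * (k - m) + 2))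
        = fact k / fact (2 * k + 2) * (half_fact i * half_fact (m - i) * half_fact (k - m))"
        unfolding e half_fact_def by (simp del: fact_Suc)
    qed
    then show ?thesis unfolding sq_moment3_def sum_distrib_left by (intro sum.cong) auto
  qed
  ultimately show ?thesis by (simp only:)
qed

lemma sq_sum4_moment: "has_bochner_integral simplex_measure4 (\<lambda>u. sq_sum4 u ^ k) (sq_moment4 k)"
proof -
  let ?c = "\<lambda>m i. fact m / (fact i * fact (m - i)) :: real"
  have "sq_sum4 u ^ k = (\<Sum>m\<le>k. \<Sum>i\<le>m. \<Sum>l\<le>k - m. ?c k m * ?c m i * ?c (k - m) l *
      (bary4 u $ 1 ^ (2 * i) * bary4 u $ 2 ^ (2 * (m - i)) * bary4 u $ 3 ^ (2 * l) * bary4 u $ 4 ^ (2 * (k - m - l))))" for u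
  proof -
    have "sq_sum4 u ^ k = (\<Sum>m\<le>k. ?c k m * (((bary4 u $ 1)\<^sup>2 + (bary4 u $ 2)\<^sup>2) ^ m * ((bary4 u $ 3)\<^sup>2 + (bary4 u $ 4)\<^sup>2) ^ (k - m)))"
      unfolding sq_sum4_def by (rule binomial_fact_ring)
    also have "\<dots> = (\<Sum>m\<le>k. \<Sum>i\<le>m. \<Sum>l\<le>k - m. ?c k m * ?c m i * ?c (k - m) l *
      (bary4 u $ 1 ^ (2 * i) * bary4 u $ 2 ^ (2 * (m - i)) * bary4 u $ 3 ^ (2 * l) * bary4 u $ 4 ^ (2 * (k - m - l))))"
      unfolding power_even by (intro sum.cong refl, simp only: binomial_fact_ring sum_product)
        (simp only: sum_distrib_left, intro sum.cong refl, simp only: mult_ac)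
    finally show ?thesis .
  qed
  moreover have "has_bochner_integral simplex_measure4 (\<lambda>u. \<Sum>m\<le>k. \<Sum>i\<le>m. \<Sum>l\<le>k - m. ?c k m * ?c m i * ?c (k - m) l *
      (bary4 u $ 1 ^ (2 * i) * bary4 u $ 2 ^ (2 * (m - i)) * bary4 u $ 3 ^ (2 * l) * bary4 u $ 4 ^ (2 * (k - m - l))))
    (\<Sum>m\<le>k. \<Sum>i\<le>m. \<Sum>l\<le>k - m. ?c k m * ?c m i * ?c (k - m) l *
      (fact (2 * i) * fact (2 * (m - i)) * fact (2 * l) * fact (2 * (k - m - l)) / fact (2 * i + 2 * (m - i) + 2 * l + 2 * (k - m - l) + 3)))"
    by (intro has_bochner_integral_sum has_bochner_integral_mult_right simplex_moment4)
  moreover have "(\<Sum>m\<le>k. \<Sum>i\<le>m. \<Sum>l\<le>k - m. ?c k m * ?c m i * ?c (k - m) l *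
      (fact (2 * i) * fact (2 * (m - i)) * fact (2 * l) * fact (2 * (k - m - l)) / fact (2 * i + 2 * (m - i) + 2 * l + 2 * (k - m - l) + 3)))
     = sq_moment4 k"
  proof -
    have "(\<Sum>i\<le>m. \<Sum>l\<le>k - m. ?c k m * ?c m i * ?c (k - m) l *
      (fact (2 * i) * fact (2 * (m - i)) * fact (2 * l) * fact (2 * (k - m - l)) / fact (2 * i + 2 * (m - i) + 2 * l + 2 * (k - m - l) + 3)))
      = fact k / fact (2 * k + 3) * (half_fact_conv m * half_fact_conv (k - m))" if "m \<le> k" for m
      unfolding half_fact_conv_def sum_product unfolding sum_distrib_left
    proof (intro sum.cong[OF refl])
      fix i l assume "i \<in> {..m}" "l \<in> {..k - m}"
      then have e: "2 * i + 2 * (m - i) + 2 * l + 2 * (k - m - l) + 3 = 2 * k + 3" using that by auto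
      show "?c k m * ?c m i * ?c (k - m) l *
          (fact (2 * i) * fact (2 * (m - i)) * fact (2 * l) * fact (2 * (k - m - l)) / fact (2 * i + 2 * (m - i) + 2 * l + 2 * (k - m - l) + 3))
        = fact k / fact (2 * k + 3) * (half_fact i * half_fact (m - i) * (half_fact l * half_fact (k - m - l)))"
        unfolding e half_fact_def by (simp del: fact_Suc add: mult_ac)
    qed
    then show ?thesis unfolding sq_moment4_def sum_distrib_left by (intro sum.cong) auto
  qed
  ultimately show ?thesis by (simp only:)
qed

section \<open>Numerical integration\<close>

text \<open>The generalized binomial coefficient of \<open>- p\<close> over
  \<open>m\<close>.\<close>

definition powr_coeff :: "real \<Rightarrow> nat \<Rightarrow> real" where
  "powr_coeff p m = (\<Prod>i<m. - (p + real i)) / fact m"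

text \<open>For even \<open>n\<close> the \<open>n\<close>-th derivative of the power is positive
  and decreasing, and the power of \<open>x - c\<close> in the remainder is nonnegative. So the
  Taylor sum bounds from below, and taking the derivative at the lower limit \<open>a\<close> bounds
  from above. Both bounds are polynomials in \<open>x\<close>, which moments can integrate.\<close>

lemma powr_taylor:
  fixes p c a x :: real
  assumes n: "0 < n" "even n" and p: "0 < p" and a: "0 < a" "a \<le> c" "a \<le> x"
  defines "T \<equiv> \<Sum>m<n. powr_coeff p m * c powr (- p - real m) * (x - c) ^ m"
  shows "T \<le> x powr - p" "x powr - p \<le> T + powr_coeff p n * a powr (- p - real n) * (x - c) ^ n"
proof -
  define df where "df m t = (\<Prod>i<m. - (p + real i)) * t powr (- p - real m)" for m t
  have nn: "0 \<le> powr_coeff p n"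
  proof -
    have "(\<Prod>i<n. - (p + real i)) = (-1) ^ n * (\<Prod>i<n. p + real i)"
      by (induction n) (simp_all add: algebra_simps)
    also have "\<dots> \<ge> 0" using n(2) p by (simp add: prod_nonneg)
    finally show ?thesis by (simp add: powr_coeff_def)
  qed
  have "\<exists>t\<ge>a. x powr - p = T + powr_coeff p n * t powr (- p - real n) * (x - c) ^ n"
  \<comment> \<open>The Lagrange form of the remainder presupposes a point different from the
    centre.\<close>
  proof (cases "x = c")
    case True
    have "T = (\<Sum>m\<in>{0}. powr_coeff p m * c powr (- p - real m) * (x - c) ^ m)"
      unfolding T_def by (rule sum.mono_neutral_right) (use n True in auto)
    then have "T = x powr - p" using True by (simp add: powr_coeff_def)
    then show ?thesis using n True by (intro exI[of _ a]) auto
  next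
    case False
    have "\<exists>t. (if x < c then x < t \<and> t < c else c < t \<and> t < x) \<and>
        x powr - p = (\<Sum>m<n. (df m c / fact m) * (x - c) ^ m) + (df n t / fact n) * (x - c) ^ n"
    proof (rule Taylor[OF n(1), of df "\<lambda>x. x powr - p" "a" "max c x" c x])
      show "df 0 = (\<lambda>x. x powr - p)" by (rule ext) (simp add: df_def)
      show "\<forall>m t. m < n \<and> a \<le> t \<and> t \<le> max c x \<longrightarrow> (df m has_real_derivative df (Suc m) t) (at t)"
      proof (intro allI impI)
        fix m t assume "m < n \<and> a \<le> t \<and> t \<le> max c x"
        then have "0 < t" using a by linarith
        then have "((\<lambda>t. t powr (- p - real m)) has_real_derivative (- p - real m) * t powr (- p - real m - 1)) (at t)"
          by (rule has_real_derivative_powr)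
        from DERIV_cmult[OF this, of "\<Prod>i<m. - (p + real i)"]
        show "(df m has_real_derivative df (Suc m) t) (at t)"
          by (simp add: df_def[abs_def] algebra_simps)
      qed
    qed (use a False in auto)
    then obtain t where t: "if x < c then x < t \<and> t < c else c < t \<and> t < x"
      "x powr - p = (\<Sum>m<n. (df m c / fact m) * (x - c) ^ m) + (df n t / fact n) * (x - c) ^ n" by blast
    then have "a \<le> t" using a by (auto split: if_splits)
    moreover have "x powr - p = T + powr_coeff p n * t powr (- p - real n) * (x - c) ^ n"
      unfolding t(2) T_def df_def powr_coeff_def by simp
    ultimately show ?thesis by blast
  qed
  then obtain t where t: "a \<le> t" "x powr - p = T + powr_coeff p n * t powr (- p - real n) * (x - c) ^ n" by blast
  have e: "0 \<le> (x - c) ^ n" using n(2) by (simp add: zero_le_even_power)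
  show "T \<le> x powr - p" unfolding t(2) using nn e by simp
  have "t powr (- p - real n) \<le> a powr (- p - real n)" using t(1) a p by (intro powr_mono2') auto
  then show "x powr - p \<le> T + powr_coeff p n * a powr (- p - real n) * (x - c) ^ n"
    unfolding t(2) using nn e by (intro add_left_mono mult_right_mono mult_left_mono) auto
qed

section \<open>Exact evaluation of moments and Taylor sums\<close>

lemma sum_atMost_numeral:
  "(\<Sum>i\<le>numeral k. f i) = (\<Sum>i\<le>pred_numeral k. f i) + (f (numeral k) :: 'a::comm_monoid_add)"
  "(\<Sum>i\<le>1. f i) = f 0 + (f 1 :: 'a)"
  "(\<Sum>i<numeral k. f i) = (\<Sum>i<pred_numeral k. f i) + (f (pred_numeral k) :: 'a)"
  "(\<Sum>i<1. f i) = (f 0 :: 'a)"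
  by (simp_all add: numeral_eq_Suc)

lemma prod_lessThan_numeral:
  "(\<Prod>i<numeral k. f i) = (\<Prod>i<pred_numeral k. f i) * (f (pred_numeral k) :: 'a::comm_monoid_mult)"
  "(\<Prod>i<1. f i) = (f 0 :: 'a)"
  by (simp_all add: numeral_eq_Suc)

lemma half_fact_conv_values:
  "half_fact_conv 0 = 1" "half_fact_conv (Suc 0) = 4" "half_fact_conv 2 = 28" "half_fact_conv 3 = 288"
  "half_fact_conv 4 = 3984" "half_fact_conv 5 = 70080" "half_fact_conv 6 = 1506240"
  "half_fact_conv 7 = 38384640" "half_fact_conv 8 = 1133072640" "half_fact_conv 9 = 38038533120"
  "half_fact_conv 10 = 1431213235200" "half_fact_conv 11 = 59645279232000"
  "half_fact_conv 12 = 2726781752217600"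
  by (simp_all add: half_fact_conv_def half_fact_def sum_atMost_numeral fact_numeral)

lemma sq_moment3_values:
  "sq_moment3 0 = 1 / 2" "sq_moment3 (Suc 0) = 1 / 4" "sq_moment3 2 = 2 / 15" "sq_moment3 3 = 8 / 105"
  "sq_moment3 4 = 7 / 150" "sq_moment3 5 = 47 / 1540" "sq_moment3 6 = 2224 / 105105"
  "sq_moment3 7 = 463 / 30030" "sq_moment3 8 = 1195 / 102102" "sq_moment3 9 = 26997 / 2939300"
  "sq_moment3 10 = 131662 / 17782765"
  by (simp_all add: sq_moment3_def half_fact_conv_values half_fact_def sum_atMost_numeral fact_numeral)

lemma sq_moment4_values:
  "sq_moment4 0 = 1 / 6" "sq_moment4 (Suc 0) = 1 / 15" "sq_moment4 2 = 1 / 35" "sq_moment4 3 = 5 / 378"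
  "sq_moment4 4 = 691 / 103950" "sq_moment4 5 = 14 / 3861" "sq_moment4 6 = 10102 / 4729725"
  "sq_moment4 7 = 30937 / 22972950" "sq_moment4 8 = 5099 / 5668650" "sq_moment4 9 = 29171 / 46293975"
  "sq_moment4 10 = 909569 / 1982094345" "sq_moment4 11 = 1035917 / 3003173250"
  "sq_moment4 12 = 10940142049 / 41110438619250"
  by (simp_all add: sq_moment4_def half_fact_conv_values sum_atMost_numeral fact_numeral)

definition shifted_moment :: "(nat \<Rightarrow> real) \<Rightarrow> real \<Rightarrow> nat \<Rightarrow> real" where
  "shifted_moment M s j = (\<Sum>k\<le>j. fact j / (fact k * fact (j - k)) * (M k * s ^ (j - k)))"

lemma has_bochner_integral_shifted:
  assumes "\<And>k. has_bochner_integral M (\<lambda>u. f u ^ k) (m k)"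
  shows "has_bochner_integral M (\<lambda>u. (f u + s) ^ j) (shifted_moment m s j :: real)"
  unfolding binomial_fact_ring shifted_moment_def
  by (intro has_bochner_integral_sum has_bochner_integral_mult_right has_bochner_integral_mult_left assms)

text \<open>Taylor sums with centre \<open>25 / 16\<close>, whose half-integral powers are rational.\<close>

lemma taylor_sum4:
  "0.08637573 \<le> (\<Sum>j<12. powr_coeff 2 j * (16 / 25) ^ (j + 2) * shifted_moment sq_moment4 (- 9 / 16) j)"
  "(\<Sum>j<12. powr_coeff 2 j * (16 / 25) ^ (j + 2) * shifted_moment sq_moment4 (- 9 / 16) j)
     + powr_coeff 2 12 * (4 / 5) ^ 14 * shifted_moment sq_moment4 (- 9 / 16) 12 \<le> 0.0863758"
  by (simp_all add: sum_atMost_numeral prod_lessThan_numeral powr_coeff_def shifted_moment_def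
      sq_moment4_values fact_numeral power_divide)

lemma taylor_sum3:
  "0.2756425 \<le> (\<Sum>j<10. powr_coeff (3 / 2) j * (4 / 5) ^ (2 * j + 3) * shifted_moment sq_moment3 (- 9 / 16) j)"
  "(\<Sum>j<10. powr_coeff (3 / 2) j * (4 / 5) ^ (2 * j + 3) * shifted_moment sq_moment3 (- 9 / 16) j)
     + powr_coeff (3 / 2) 10 * (8 / 9) ^ 23 * shifted_moment sq_moment3 (- 9 / 16) 10 < 0.275643"
  by (simp_all add: sum_atMost_numeral prod_lessThan_numeral powr_coeff_def shifted_moment_def
      sq_moment3_values fact_numeral power_divide)

lemma has_bochner_integral_mono:
  fixes x y :: real
  assumes "has_bochner_integral M f x" "has_bochner_integral M g y" "AE u in M. f u \<le> g u"
  shows "x \<le> y"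
  using assms integral_mono_AE[of M f g] by (simp add: has_bochner_integral_iff)

lemma powr_minus_nat: "c powr (- real n) = (1 / c) ^ n" if "0 < c" for c :: real
  unfolding powr_minus powr_realpow[OF that] by (simp only: power_one_over inverse_eq_divide)

lemma powr_even_power: "(c\<^sup>2) powr (- (real n / 2)) = (1 / c) ^ n" if "0 < c" for c :: real
proof -
  have "(c\<^sup>2) powr (- (real n / 2)) = (c powr 2) powr (- (real n / 2))"
    by (simp only: powr_numeral[OF less_imp_le[OF that]])
  also have "\<dots> = c powr (- real n)" unfolding powr_powr by simp
  finally show ?thesis by (simp only: powr_minus_nat[OF that])
qed

lemma simplex_integral4:
  assumes I: "has_bochner_integral simplex_measure4 (\<lambda>u. 1 / (1 + sq_sum4 u)\<^sup>2) I"
  shows "0.08637573 \<le> I" "I \<le> 0.0863758"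
proof -
  define c :: real where "c = 25 / 16"
  define T where "T u = (\<Sum>j<12. powr_coeff 2 j * c powr (- 2 - real j) * (1 + sq_sum4 u - c) ^ j)" for u
  have c: "c powr (- 2 - real j) = (16 / 25) ^ (j + 2)" for j
  proof -
    have e: "- 2 - real j = - (real (2 * (j + 2)) / 2)" and c2: "c = (5 / 4)\<^sup>2"
      by (simp_all add: c_def power_divide field_simps)
    show ?thesis unfolding e c2 by (subst powr_even_power, simp, subst power_mult) (simp add: power_divide)
  qed
  have s: "has_bochner_integral simplex_measure4 (\<lambda>u. (1 + sq_sum4 u - c) ^ j) (shifted_moment sq_moment4 (- 9 / 16) j)" for j
    using has_bochner_integral_shifted[OF sq_sum4_moment, of "- 9 / 16" j] by (simp add: c_def algebra_simps)
  have T: "has_bochner_integral simplex_measure4 T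
      (\<Sum>j<12. powr_coeff 2 j * (16 / 25) ^ (j + 2) * shifted_moment sq_moment4 (- 9 / 16) j)"
    unfolding T_def c by (intro has_bochner_integral_sum has_bochner_integral_mult_right s)
  have R: "has_bochner_integral simplex_measure4 (\<lambda>u. T u + powr_coeff 2 12 * (4 / 5) ^ 14 * (1 + sq_sum4 u - c) ^ 12)
     ((\<Sum>j<12. powr_coeff 2 j * (16 / 25) ^ (j + 2) * shifted_moment sq_moment4 (- 9 / 16) j)
     + powr_coeff 2 12 * (4 / 5) ^ 14 * shifted_moment sq_moment4 (- 9 / 16) 12)"
    by (intro has_bochner_integral_add T has_bochner_integral_mult_right s)
  \<comment> \<open>With coordinate sum 1, the sum of four squares is at least 1/4; so 5/4 may serve
    as the limit \<open>a\<close> in the remainder.\<close>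
  have q: "5 / 4 \<le> 1 + sq_sum4 u" for u
  proof -
    have "0 \<le> (bary4 u $ 1 - 1/4)\<^sup>2 + (bary4 u $ 2 - 1/4)\<^sup>2 + (bary4 u $ 3 - 1/4)\<^sup>2 + (bary4 u $ 4 - 1/4)\<^sup>2" by simp
    then show ?thesis by (simp add: sq_sum4_def bary4_sel power2_eq_square algebra_simps)
  qed
  have inv: "1 / (1 + sq_sum4 u)\<^sup>2 = (1 + sq_sum4 u) powr (- 2)" for u
    using powr_minus_nat[of "1 + sq_sum4 u" 2] q[of u] by (simp add: power_divide)
  have a: "(5 / 4 :: real) powr (- 2 - real 12) = (4 / 5) ^ 14"
  proof -
    have e: "- 2 - real 12 = - real 14" by simp
    show ?thesis unfolding e by (subst powr_minus_nat) simp_all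
  qed
  have "T u \<le> 1 / (1 + sq_sum4 u)\<^sup>2" for u
    unfolding inv T_def using q[of u] by (intro powr_taylor(1)[where a = "5/4"]) (auto simp: c_def)
  then show "0.08637573 \<le> I" using has_bochner_integral_mono[OF T I] taylor_sum4(1) by simp
  have "1 / (1 + sq_sum4 u)\<^sup>2 \<le> T u + powr_coeff 2 12 * (4 / 5) ^ 14 * (1 + sq_sum4 u - c) ^ 12" for u
    unfolding inv T_def a[symmetric] using q[of u] by (intro powr_taylor(2)) (auto simp: c_def)
  then show "I \<le> 0.0863758" using has_bochner_integral_mono[OF I R] taylor_sum4(2) by simp
qed

lemma simplex_integral3:
  assumes I: "has_bochner_integral simplex_measure3 (\<lambda>u. (1 + sq_sum3 u) powr (- (3 / 2))) I"
  shows "0.2756425 \<le> I" "I < 0.275643"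
proof -
  define c :: real where "c = 25 / 16"
  define T where "T u = (\<Sum>j<10. powr_coeff (3 / 2) j * c powr (- (3 / 2) - real j) * (1 + sq_sum3 u - c) ^ j)" for u
  have c: "c powr (- (3 / 2) - real j) = (4 / 5) ^ (2 * j + 3)" for j
  proof -
    have e: "- (3 / 2) - real j = - (real (2 * j + 3) / 2)" and c2: "c = (5 / 4)\<^sup>2"
      by (simp_all add: c_def power_divide add_divide_distrib)
    show ?thesis unfolding e c2 by (subst powr_even_power) simp_all
  qed
  have s: "has_bochner_integral simplex_measure3 (\<lambda>u. (1 + sq_sum3 u - c) ^ j) (shifted_moment sq_moment3 (- 9 / 16) j)" for j
    using has_bochner_integral_shifted[OF sq_sum3_moment, of "- 9 / 16" j] by (simp add: c_def algebra_simps)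
  have T: "has_bochner_integral simplex_measure3 T
      (\<Sum>j<10. powr_coeff (3 / 2) j * (4 / 5) ^ (2 * j + 3) * shifted_moment sq_moment3 (- 9 / 16) j)"
    unfolding T_def c by (intro has_bochner_integral_sum has_bochner_integral_mult_right s)
  have R: "has_bochner_integral simplex_measure3 (\<lambda>u. T u + powr_coeff (3 / 2) 10 * (8 / 9) ^ 23 * (1 + sq_sum3 u - c) ^ 10)
     ((\<Sum>j<10. powr_coeff (3 / 2) j * (4 / 5) ^ (2 * j + 3) * shifted_moment sq_moment3 (- 9 / 16) j)
     + powr_coeff (3 / 2) 10 * (8 / 9) ^ 23 * shifted_moment sq_moment3 (- 9 / 16) 10)"
    by (intro has_bochner_integral_add T has_bochner_integral_mult_right s)
  \<comment> \<open>The minimum is 4/3. The smaller number 81/64 is used instead because it is a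
    rational square, so that its half-integral powers are rational.\<close>
  have q: "(9 / 8)\<^sup>2 \<le> 1 + sq_sum3 u" for u
  proof -
    have "0 \<le> (bary3 u $ 1 - 1/3)\<^sup>2 + (bary3 u $ 2 - 1/3)\<^sup>2 + (bary3 u $ 3 - 1/3)\<^sup>2" by simp
    then show ?thesis by (simp add: sq_sum3_def bary3_sel power2_eq_square algebra_simps)
  qed
  have a: "((9 / 8)\<^sup>2 :: real) powr (- (3 / 2) - real 10) = (8 / 9) ^ 23"
  proof -
    have e: "- (3 / 2) - real 10 = - (real 23 / 2)" by simp
    show ?thesis unfolding e by (subst powr_even_power) simp_all
  qed
  have "T u \<le> (1 + sq_sum3 u) powr (- (3 / 2))" for u
    unfolding T_def using q[of u] by (intro powr_taylor(1)[where a = "(9/8)\<^sup>2"]) (auto simp: c_def power_divide)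
  then show "0.2756425 \<le> I" using has_bochner_integral_mono[OF T I] taylor_sum3(1) by simp
  have "(1 + sq_sum3 u) powr (- (3 / 2)) \<le> T u + powr_coeff (3 / 2) 10 * (8 / 9) ^ 23 * (1 + sq_sum3 u - c) ^ 10" for u
    unfolding T_def a[symmetric] using q[of u] by (intro powr_taylor(2)) (auto simp: c_def power_divide)
  then show "I < 0.275643" using has_bochner_integral_mono[OF I R] taylor_sum3(2) by simp
qed

section \<open>Sign changes and the standard basis\<close>

lemma trunc_cone_lmeasurable:
  fixes v :: "'n::{finite,wellorder} \<Rightarrow> real ^ 'n::_"
  assumes "lin_indep v"
  shows "trunc_cone v \<in> lmeasurable"
  unfolding trunc_cone_eq_image
  by (rule measurable_linear_image[OF linear_combination lmeasurable_coord_body[OF assms]])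

definition sign_vectors :: "('n::finite \<Rightarrow> int) set" where
  "sign_vectors = {e. \<forall>i. e i = 1 \<or> e i = -1}"

lemma sign_vectors_PiE: "(sign_vectors :: ('n::finite \<Rightarrow> int) set) = (UNIV \<rightarrow>\<^sub>E {1, -1})"
  by (auto simp: sign_vectors_def PiE_def extensional_def)

lemma finite_sign_vectors: "finite (sign_vectors :: ('n::finite \<Rightarrow> int) set)"
  unfolding sign_vectors_PiE by (intro finite_PiE) auto

lemma card_sign_vectors: "card (sign_vectors :: ('n::finite \<Rightarrow> int) set) = 2 ^ CARD('n)"
  unfolding sign_vectors_PiE by (simp add: card_PiE numeral_2_eq_2)

lemma lin_indep_sign:
  fixes v :: "'n::finite \<Rightarrow> real ^ 'n"
  assumes "lin_indep v" "e \<in> sign_vectors"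
  shows "lin_indep (\<lambda>i. of_int (e i) *\<^sub>R v i)"
proof -
  have "e i = 1 \<or> e i = -1" for i using assms(2) by (simp add: sign_vectors_def)
  then have "e i \<noteq> 0" for i by (metis zero_neq_one zero_neq_neg_one)
  then have "(\<Prod>i\<in>UNIV. real_of_int (e i)) \<noteq> 0" by simp
  then show ?thesis using assms(1) unfolding lin_indep_iff_fdet fdet_scale by simp
qed

lemma disjoint_trunc_cones:
  fixes v :: "'n::finite \<Rightarrow> real ^ 'n"
  assumes v: "lin_indep v"
  shows "disjoint_family_on (\<lambda>e. trunc_cone (\<lambda>i. of_int (e i) *\<^sub>R v i)) sign_vectors"
  unfolding disjoint_family_on_def
proof (intro ballI impI)
  fix e f :: "'n \<Rightarrow> int" assume ef: "e \<in> sign_vectors" "f \<in> sign_vectors" "e \<noteq> f"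
  have False if "x \<in> trunc_cone (\<lambda>i. of_int (e i) *\<^sub>R v i)" "x \<in> trunc_cone (\<lambda>i. of_int (f i) *\<^sub>R v i)" for x
  proof -
    from that obtain a b where a: "x = (\<Sum>i\<in>UNIV. a i *\<^sub>R of_int (e i) *\<^sub>R v i)" "\<And>i. 0 < a i"
      and b: "x = (\<Sum>i\<in>UNIV. b i *\<^sub>R of_int (f i) *\<^sub>R v i)" "\<And>i. 0 < b i"
      unfolding trunc_cone_def open_cone_def by blast
    have "(\<Sum>i\<in>UNIV. (a i * of_int (e i) - b i * of_int (f i)) *\<^sub>R v i) = x - x"
      by (subst (1) a(1), subst b(1)) (simp add: scaleR_diff_left sum_subtractf)
    then have eq: "a i * of_int (e i) - b i * of_int (f i) = 0" for i
      by (intro lin_indep_sum_zero[OF v]) simp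
    have "e i = f i" for i
    proof -
      have "e i = 1 \<or> e i = -1" "f i = 1 \<or> f i = -1" using ef by (auto simp: sign_vectors_def)
      then show ?thesis using eq[of i] a(2)[of i] b(2)[of i] by auto
    qed
    with ef(3) show False by auto
  qed
  then show "trunc_cone (\<lambda>i. of_int (e i) *\<^sub>R v i) \<inter> trunc_cone (\<lambda>i. of_int (f i) *\<^sub>R v i) = {}" by blast
qed

lemma measure_Union_trunc_cones:
  fixes v :: "'n::{finite,wellorder} \<Rightarrow> real ^ 'n::_"
  assumes v: "lin_indep v"
  shows "measure lebesgue (\<Union>e\<in>sign_vectors. trunc_cone (\<lambda>i. of_int (e i) *\<^sub>R v i))
    = (\<Sum>e\<in>sign_vectors. measure lebesgue (trunc_cone (\<lambda>i. of_int (e i) *\<^sub>R v i)))"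
proof (intro measure_finite_Union image_subsetI fmeasurableD finite_sign_vectors
      disjoint_trunc_cones[OF v] trunc_cone_lmeasurable lin_indep_sign[OF v])
  show "emeasure lebesgue (trunc_cone (\<lambda>i. of_int (e i) *\<^sub>R v i)) \<noteq> \<infinity>" if "e \<in> sign_vectors" for e
    using fmeasurableD2[OF trunc_cone_lmeasurable[OF lin_indep_sign[OF v that]]] by simp
qed

lemma exists_small_sign:
  fixes v :: "'n::{finite,wellorder} \<Rightarrow> real ^ 'n::_"
  assumes v: "lin_indep v"
  obtains e where "e \<in> sign_vectors"
    "2 ^ CARD('n) * measure lebesgue (trunc_cone (\<lambda>i. of_int (e i) *\<^sub>R v i)) \<le> measure lebesgue (cball 0 1 :: (real ^ 'n::_) set)"
proof -
  let ?m = "\<lambda>e. measure lebesgue (trunc_cone (\<lambda>i. of_int (e i) *\<^sub>R v i))"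
  let ?B = "measure lebesgue (cball 0 1 :: (real ^ 'n::_) set)"
  have "(\<Union>e\<in>sign_vectors. trunc_cone (\<lambda>i. of_int (e i) *\<^sub>R v i)) \<in> lmeasurable"
    using trunc_cone_lmeasurable[OF lin_indep_sign[OF v]] finite_sign_vectors by (intro fmeasurable.finite_UN) auto
  then have "(\<Sum>e\<in>sign_vectors. ?m e) \<le> ?B"
    unfolding measure_Union_trunc_cones[OF v, symmetric]
    by (intro measure_mono_fmeasurable) (auto simp: trunc_cone_def)
  moreover have "\<exists>e\<in>sign_vectors. 2 ^ CARD('n) * ?m e \<le> ?B" if "(\<Sum>e\<in>sign_vectors. ?m e) \<le> ?B"
  proof (rule ccontr)
    assume "\<not> ?thesis"
    then have gt: "?B / 2 ^ CARD('n) < ?m e" if "e \<in> sign_vectors" for e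
      using that by (auto simp: field_simps not_le)
    have "(\<lambda>_. 1) \<in> (sign_vectors :: ('n \<Rightarrow> int) set)" by (simp add: sign_vectors_def)
    then have "(\<Sum>e\<in>(sign_vectors :: ('n \<Rightarrow> int) set). ?B / 2 ^ CARD('n)) < (\<Sum>e\<in>sign_vectors. ?m e)"
      using gt finite_sign_vectors by (intro sum_strict_mono) auto
    with that show False by (simp add: card_sign_vectors)
  qed
  ultimately show ?thesis using that by blast
qed

section \<open>The standard basis\<close>

lemma lin_indep_standard_basis: "lin_indep (standard_basis :: 'n::finite \<Rightarrow> real ^ 'n)"
  by (rule lin_indepI_dual[of _ standard_basis]) (simp add: dual_pair_def standard_basis_def inner_axis_axis)

lemma sum_standard_basis: "(\<Sum>i\<in>UNIV. c i *\<^sub>R standard_basis i) = (\<chi> i. c i)"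
  by (simp add: standard_basis_def vec_eq_iff axis_def if_distrib[of "\<lambda>x. _ * x"] cong: if_cong)

text \<open>The orthants have equal volume and cover the ball up to the coordinate hyperplanes, so
  the averaging of \<open>exists_small_sign\<close> is an equality here.\<close>

lemma solid_angle_standard_basis:
  "2 ^ CARD('n) * solid_angle (standard_basis :: 'n::{finite,wellorder} \<Rightarrow> real ^ 'n::_)
    = CARD('n) * measure lebesgue (cball 0 1 :: (real ^ 'n::_) set)"
proof -
  let ?s = "standard_basis :: 'n \<Rightarrow> real ^ 'n::_"
  let ?w = "\<lambda>e :: 'n \<Rightarrow> int. \<lambda>i. of_int (e i) *\<^sub>R ?s i"
  have one: "(\<lambda>_. 1) \<in> (sign_vectors :: ('n \<Rightarrow> int) set)" by (simp add: sign_vectors_def)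
  have same: "measure lebesgue (trunc_cone (?w e)) = measure lebesgue (trunc_cone ?s)" if e: "e \<in> sign_vectors" for e
  proof -
    have a: "\<bar>real_of_int (e i)\<bar> = 1" for i
    proof -
      have "e i = 1 \<or> e i = -1" using e by (simp add: sign_vectors_def)
      then show ?thesis by auto
    qed
    have "norm (\<Sum>i\<in>UNIV. x $ i *\<^sub>R ?w e i) = norm (\<Sum>i\<in>UNIV. x $ i *\<^sub>R ?s i)" for x :: "real ^ 'n::_"
    proof -
      have "(\<Sum>i\<in>UNIV. x $ i *\<^sub>R ?w e i) = (\<chi> i. x $ i * of_int (e i))"
        by (simp add: sum_standard_basis)
      then show ?thesis
        by (simp only: sum_standard_basis norm_vec_def vec_lambda_beta real_norm_def abs_mult a mult_1_right)
    qed
    then have "coord_body (?w e) = coord_body ?s" by (simp add: coord_body_def)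
    moreover have "\<bar>fdet (?w e)\<bar> = \<bar>fdet ?s\<bar>"
      unfolding fdet_scale by (simp add: abs_mult abs_prod a)
    ultimately have "solid_angle (?w e) = solid_angle ?s"
      by (simp add: solid_angle_coord_body[OF lin_indep_sign[OF lin_indep_standard_basis e]]
        solid_angle_coord_body[OF lin_indep_standard_basis])
    then show ?thesis
      by (simp add: solid_angle_trunc_cone[OF lin_indep_sign[OF lin_indep_standard_basis e]]
        solid_angle_trunc_cone[OF lin_indep_standard_basis])
  qed
  define U where "U = (\<Union>e\<in>sign_vectors. trunc_cone (?w e))"
  have "cball 0 1 - U \<subseteq> (\<Union>i. {x. x $ i = 0})"
  proof
    fix x assume x: "x \<in> cball 0 1 - U"
    show "x \<in> (\<Union>i. {x. x $ i = 0})"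
    proof (rule ccontr)
      assume "\<not> ?thesis"
      then have nz: "x $ i \<noteq> 0" for i by auto
      define e :: "'n \<Rightarrow> int" where "e i = (if 0 < x $ i then 1 else -1)" for i
      have "e \<in> sign_vectors" by (simp add: sign_vectors_def e_def)
      moreover have "x = (\<Sum>i\<in>UNIV. \<bar>x $ i\<bar> *\<^sub>R ?w e i)"
        by (simp add: sum_standard_basis vec_eq_iff e_def)
      then have "x \<in> trunc_cone (?w e)"
        using x nz unfolding trunc_cone_def open_cone_def by (auto intro!: exI[of _ "\<lambda>i. \<bar>x $ i\<bar>"])
      ultimately show False using x by (auto simp: U_def)
    qed
  qed
  moreover have "negligible (\<Union>i. {x :: real ^ 'n::_. x $ i = 0})"
    by (intro negligible_Union) (auto intro: negligible_standard_hyperplane_cart)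
  ultimately have "negligible (cball 0 1 - U)" by (rule negligible_subset[rotated])
  moreover have "U - cball 0 1 = {}" by (auto simp: U_def trunc_cone_def)
  moreover have "U \<in> lmeasurable"
    unfolding U_def using trunc_cone_lmeasurable[OF lin_indep_sign[OF lin_indep_standard_basis]] finite_sign_vectors
    by (intro fmeasurable.finite_UN) auto
  ultimately have "measure lebesgue (cball 0 1 :: (real ^ 'n::_) set) = measure lebesgue U"
    by (intro measure_negligible_symdiff) auto
  also have "\<dots> = (\<Sum>e\<in>sign_vectors. measure lebesgue (trunc_cone (?w e)))"
    unfolding U_def by (rule measure_Union_trunc_cones[OF lin_indep_standard_basis])
  also have "\<dots> = 2 ^ CARD('n) * measure lebesgue (trunc_cone ?s)"
    by (simp add: same card_sign_vectors)
  finally show ?thesis by (simp add: solid_angle_trunc_cone[OF lin_indep_standard_basis])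
qed

lemma solid_angle_scale:
  assumes "\<And>i. 0 < c i"
  shows "solid_angle (\<lambda>i. c i *\<^sub>R v i) = solid_angle v"
proof -
  have "open_cone (\<lambda>i. c i *\<^sub>R v i) = open_cone v"
  proof (intro equalityI subsetI)
    fix x assume "x \<in> open_cone (\<lambda>i. c i *\<^sub>R v i)"
    then obtain a where "x = (\<Sum>i\<in>UNIV. a i *\<^sub>R c i *\<^sub>R v i)" "\<forall>i. 0 < a i" by (auto simp: open_cone_def)
    then show "x \<in> open_cone v" using assms
      unfolding open_cone_def by (auto intro!: exI[of _ "\<lambda>i. a i * c i"])
  next
    fix x assume "x \<in> open_cone v"
    then obtain a where "x = (\<Sum>i\<in>UNIV. a i *\<^sub>R v i)" "\<forall>i. 0 < a i" by (auto simp: open_cone_def)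
    then show "x \<in> open_cone (\<lambda>i. c i *\<^sub>R v i)" using assms
      unfolding open_cone_def by (auto intro!: exI[of _ "\<lambda>i. a i / c i"] sum.cong simp: less_imp_neq[symmetric])
  qed
  then show ?thesis by (simp add: solid_angle_def)
qed

lemma minimal_basis_lin_indep: "minimal_basis L v \<Longrightarrow> lin_indep v"
  by (simp add: minimal_basis_def lattice_basis_def)

lemma lin_indep_nonzero: "lin_indep v \<Longrightarrow> v i \<noteq> 0" for v :: "'n::finite \<Rightarrow> real ^ 'n"
  using dual_pair_exists dual_pair_nonzero by metis

text \<open>For \<open>i < j\<close> the vector \<open>v j - v i\<close> is not shorter than
  \<open>v j\<close>. This bounds twice the inner product by the squared norm of \<open>v i\<close>,
  hence by the product of the two norms, as norms increase with the index.\<close>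

lemma minimal_basis_inner:
  fixes v :: "'n::{finite,linorder} \<Rightarrow> real ^ 'n::_"
  assumes mb: "minimal_basis L v" and ne: "i \<noteq> j"
  shows "(v i \<bullet> v j) / (norm (v i) * norm (v j)) \<le> 1 / 2"
proof -
  have lt: "v i \<bullet> v j \<le> norm (v i) * norm (v j) / 2" if ij: "i < j" for i j
  proof -
    have "norm (v j) \<le> norm (\<Sum>k\<in>UNIV. of_int (if k = j then 1 else if k = i then -1 else 0) *\<^sub>R v k)"
      by (rule minimal_basis_le[OF mb order_refl]) simp
    also have "(\<Sum>k\<in>UNIV. of_int (if k = j then 1 else if k = i then -1 else 0) *\<^sub>R v k)
       = (\<Sum>k\<in>UNIV. (if k = j then v k else 0) + (if k = i then - v k else 0))"
      using ij by (intro sum.cong) auto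
    also have "\<dots> = v j - v i" by (simp add: sum.distrib)
    finally have "2 * (v i \<bullet> v j) \<le> v i \<bullet> v i" unfolding norm_diff_ge_inner by (simp add: inner_commute)
    also have "\<dots> = norm (v i) * norm (v i)" by (simp add: power2_norm_eq_inner[symmetric] power2_eq_square)
    also have "\<dots> \<le> norm (v i) * norm (v j)" using minimal_basis_mono[OF mb, of i j] ij by (intro mult_left_mono) auto
    finally show ?thesis by simp
  qed
  have "v i \<bullet> v j \<le> norm (v i) * norm (v j) / 2"
    using lt[of i j] lt[of j i] ne by (cases i j rule: linorder_cases) (auto simp: inner_commute mult.commute)
  moreover have "0 < norm (v i) * norm (v j)"
    using lin_indep_nonzero[OF minimal_basis_lin_indep[OF mb]] by simp
  ultimately show ?thesis by (simp add: field_simps)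
qed

section \<open>The lower bound\<close>

definition normalized :: "('n \<Rightarrow> real ^ 'n) \<Rightarrow> 'n \<Rightarrow> real ^ 'n" where
  "normalized v i = (1 / norm (v i)) *\<^sub>R v i"

lemma solid_angle_normalized: "lin_indep v \<Longrightarrow> solid_angle (normalized v) = solid_angle v"
  for v :: "'n::finite \<Rightarrow> real ^ 'n"
  using solid_angle_scale[of "\<lambda>i. 1 / norm (v i)" v] lin_indep_nonzero[of v]
  by (simp add: normalized_def[abs_def])

lemma fdet_normalized: "(fdet (normalized v))\<^sup>2 = (fdet v)\<^sup>2 / (\<Prod>i\<in>UNIV. (norm (v i))\<^sup>2)"
  unfolding normalized_def[abs_def] fdet_scale
  by (simp add: power_mult_distrib prod_power_distrib power_divide prod_dividef)

lemma minimal_basis_normalized: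
  fixes v :: "'n::{finite,linorder} \<Rightarrow> real ^ 'n::_"
  assumes mb: "minimal_basis L v"
  shows "normalized v i \<bullet> normalized v i = 1" "i \<noteq> j \<Longrightarrow> normalized v i \<bullet> normalized v j \<le> 1 / 2"
  using lin_indep_nonzero[OF minimal_basis_lin_indep[OF mb], of i] minimal_basis_inner[OF mb, of i j]
  by (auto simp: normalized_def power2_norm_eq_inner[symmetric] power2_eq_square mult.commute)

lemma fdet_alternating_3: "alternating_system v \<Longrightarrow> (fdet v)\<^sup>2 = 1 / 2" for v :: "3 \<Rightarrow> real ^ 3"
  unfolding power2_eq_square fdet_mult unfolding det_3 by (simp add: alternating_system_inner)

lemma fdet_alternating_4: "alternating_system v \<Longrightarrow> (fdet v)\<^sup>2 = 5 / 16" for v :: "4 \<Rightarrow> real ^ 4"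
  unfolding power2_eq_square fdet_mult unfolding det_4 by (simp add: alternating_system_inner)

lemma norm_sum_sq: "(norm (\<Sum>i\<in>UNIV. x i *\<^sub>R v i))\<^sup>2 = (\<Sum>i\<in>UNIV. \<Sum>j\<in>UNIV. x i * x j * (v i \<bullet> v j))"
  for v :: "'n::finite \<Rightarrow> real ^ 'n"
  unfolding power2_norm_eq_inner by (simp add: inner_sum_left inner_sum_right sum_distrib_left mult_ac)
    (intro sum.cong refl, simp add: inner_commute)

lemma solid_angle_lower_3:
  fixes u a :: "3 \<Rightarrow> real ^ 3"
  assumes a: "alternating_system a"
    and u: "\<And>i. u i \<bullet> u i = 1" "\<And>i j. i \<noteq> j \<Longrightarrow> u i \<bullet> u j \<le> 1 / 2" and det: "1 / 2 \<le> (fdet u)\<^sup>2"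
  shows "solid_angle a \<le> solid_angle u"
proof -
  have la: "lin_indep a" using a by (rule alternating_system_lin_indep)
  have lu: "lin_indep u" using det by (auto simp: lin_indep_iff_fdet)
  have "coord_body a \<subseteq> coord_body u"
  proof
    fix x assume x: "x \<in> coord_body a"
    then have pos: "\<And>i. 0 < x $ i" by (simp add: coord_body_def)
    have le: "(norm (\<Sum>i\<in>UNIV. x $ i *\<^sub>R u i))\<^sup>2 \<le> (norm (\<Sum>i\<in>UNIV. x $ i *\<^sub>R a i))\<^sup>2"
      unfolding norm_sum_sq
    proof (intro sum_mono mult_left_mono)
      show "u i \<bullet> u j \<le> a i \<bullet> a j" for i j
        using u(1)[of i] u(2)[of i j] by (cases "i = j") (simp_all add: alternating_system_inner[OF a])
      show "0 \<le> x $ i * x $ j" for i j using pos by (simp add: less_imp_le)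
    qed
    from x have "(norm (\<Sum>i\<in>UNIV. x $ i *\<^sub>R a i))\<^sup>2 \<le> 1" by (simp only: coord_body_def mem_Collect_eq)
    with le have "(norm (\<Sum>i\<in>UNIV. x $ i *\<^sub>R u i))\<^sup>2 \<le> 1" by (rule order_trans)
    then show "x \<in> coord_body u" using pos by (simp only: coord_body_def mem_Collect_eq) blast
  qed
  then have "measure lebesgue (coord_body a) \<le> measure lebesgue (coord_body u)"
    using lmeasurable_coord_body[OF lu] lmeasurable_coord_body[OF la] by (intro measure_mono_fmeasurable fmeasurableD)
  moreover have "(fdet a)\<^sup>2 \<le> (fdet u)\<^sup>2" using det by (simp add: fdet_alternating_3[OF a])
  then have "\<bar>fdet a\<bar> \<le> \<bar>fdet u\<bar>" by (simp add: abs_le_square_iff)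
  ultimately show ?thesis
    unfolding solid_angle_coord_body[OF la] solid_angle_coord_body[OF lu] by (intro mult_left_mono mult_mono) auto
qed

section \<open>Volume and determinant near the alternating Gram matrix\<close>

text \<open>The tangent of the convex function \<open>1 / x^2\<close> at \<open>y\<close>; cleared
  of denominators it says \<open>(y - x)^2 * (y + 2*x) >= 0\<close>.\<close>

lemma tangent_inverse_square:
  fixes x y :: real
  assumes "0 < x" "0 < y"
  shows "1 / y\<^sup>2 + 2 * (y - x) / y ^ 3 \<le> 1 / x\<^sup>2"
proof -
  have "0 \<le> (y - x)\<^sup>2 * (y + 2 * x)" using assms by simp
  then have "x\<^sup>2 * (y + 2 * (y - x)) \<le> y ^ 3" by (simp add: power2_eq_square power3_eq_cube algebra_simps)
  then have "(y + 2 * (y - x)) / y ^ 3 \<le> 1 / x\<^sup>2" using assms by (simp add: divide_simps mult.commute)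
  moreover have "y / y ^ 3 = 1 / y\<^sup>2" using assms by (simp add: power2_eq_square power3_eq_cube)
  then have "(y + 2 * (y - x)) / y ^ 3 = 1 / y\<^sup>2 + 2 * (y - x) / y ^ 3" by (simp only: add_divide_distrib)
  ultimately show ?thesis by simp
qed

text \<open>The tangent at \<open>7 / 5\<close>, near the mean of \<open>1 + sq_sum4\<close> with respect to the weights in
  \<open>edge_moments4\<close>.\<close>

lemma tangent_inverse_cube:
  fixes t :: real
  assumes "0 < t"
  shows "4 * (5 / 7) ^ 3 - 3 * (5 / 7) ^ 4 * t \<le> 1 / t ^ 3"
proof -
  have "0 \<le> (t - 7 / 5)\<^sup>2 * (3 * t\<^sup>2 + 14 / 5 * t + 49 / 25)" using assms by (intro mult_nonneg_nonneg add_nonneg_nonneg) auto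
  then have "(4 * (5 / 7) ^ 3 - 3 * (5 / 7) ^ 4 * t) * t ^ 3 \<le> 1"
    by (simp add: power2_eq_square power3_eq_cube power4_eq_xxxx algebra_simps)
  then show ?thesis using assms by (simp add: pos_le_divide_eq)
qed

text \<open>With \<open>d i j = 1/2 - u i \<bullet> u j\<close> for unit vectors \<open>u\<close>,
  twice this sum is the amount by which the quadratic form falls short of that of the alternating
  basis.\<close>

definition edge_sum4 :: "(4 \<Rightarrow> 4 \<Rightarrow> real) \<Rightarrow> real ^ 4 \<Rightarrow> real" where
  "edge_sum4 d x = d 1 2 * (x $ 1 * x $ 2) + d 1 3 * (x $ 1 * x $ 3) + d 1 4 * (x $ 1 * x $ 4)
     + d 2 3 * (x $ 2 * x $ 3) + d 2 4 * (x $ 2 * x $ 4) + d 3 4 * (x $ 3 * x $ 4)"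

definition edge_total4 :: "(4 \<Rightarrow> 4 \<Rightarrow> real) \<Rightarrow> real" where
  "edge_total4 d = d 1 2 + d 1 3 + d 1 4 + d 2 3 + d 2 4 + d 3 4"

text \<open>The square of the coordinate sum is 1, which turns the cross terms with coefficient 1/2
  into \<open>(1 + sq_sum4 p) / 2\<close>.\<close>

lemma norm_bary4:
  fixes u :: "4 \<Rightarrow> real ^ 4"
  assumes "\<And>i. u i \<bullet> u i = 1"
  shows "(norm (\<Sum>i\<in>UNIV. bary4 p $ i *\<^sub>R u i))\<^sup>2
    = (1 + sq_sum4 p) / 2 - 2 * edge_sum4 (\<lambda>i j. 1 / 2 - u i \<bullet> u j) (bary4 p)"
proof -
  have c: "u 2 \<bullet> u 1 = u 1 \<bullet> u 2" "u 3 \<bullet> u 1 = u 1 \<bullet> u 3" "u 4 \<bullet> u 1 = u 1 \<bullet> u 4"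
    "u 3 \<bullet> u 2 = u 2 \<bullet> u 3" "u 4 \<bullet> u 2 = u 2 \<bullet> u 4" "u 4 \<bullet> u 3 = u 3 \<bullet> u 4" by (simp_all only: inner_commute)
  have s: "bary4 p $ 4 = 1 - (bary4 p $ 1 + bary4 p $ 2 + bary4 p $ 3)" by (simp add: bary4_sel)
  show ?thesis
    unfolding norm_sum_sq unfolding sum_4 edge_sum4_def sq_sum4_def assms c s
    by (simp add: field_simps power2_eq_square)
qed

lemma norm_bary3:
  fixes u :: "3 \<Rightarrow> real ^ 3"
  assumes "alternating_system u"
  shows "(norm (\<Sum>i\<in>UNIV. bary3 p $ i *\<^sub>R u i))\<^sup>2 = (1 + sq_sum3 p) / 2"
proof -
  have s: "bary3 p $ 3 = 1 - (bary3 p $ 1 + bary3 p $ 2)" by (simp add: bary3_sel)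
  show ?thesis
    unfolding norm_sum_sq unfolding sum_3 sq_sum3_def s alternating_system_inner[OF assms]
    by (simp add: field_simps power2_eq_square)
qed

text \<open>Writing the product as a monomial with explicit exponents treats all six pairs alike.
  The first value is 1/5!. In the second, two monomials contribute 3!/7! and two contribute 2!/7!,
  which makes 16/5040.\<close>

lemma edge_moments4:
  assumes "(i, j) \<in> {(1, 2), (1, 3), (1, 4), (2, 3), (2, 4), (3, 4 :: 4)}"
  shows "has_bochner_integral simplex_measure4 (\<lambda>p. bary4 p $ i * bary4 p $ j) (1 / 120)"
    "has_bochner_integral simplex_measure4 (\<lambda>p. bary4 p $ i * bary4 p $ j * sq_sum4 p) (1 / 315)"
proof -
  let ?m = "\<lambda>a b c d p. bary4 p $ 1 ^ a * bary4 p $ 2 ^ b * bary4 p $ 3 ^ c * bary4 p $ 4 ^ d"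
  have 1: "\<exists>a b c d. (\<forall>p. bary4 p $ i * bary4 p $ j = ?m a b c d p) \<and>
      fact a * fact b * fact c * fact d / fact (a + b + c + d + 3) = (1 / 120 :: real) \<and>
      (\<forall>p. bary4 p $ i * bary4 p $ j * sq_sum4 p = ?m (a + 2) b c d p + ?m a (b + 2) c d p + ?m a b (c + 2) d p + ?m a b c (d + 2) p) \<and>
      fact (a + 2) * fact b * fact c * fact d / fact ((a + 2) + b + c + d + 3) +
      fact a * fact (b + 2) * fact c * fact d / fact (a + (b + 2) + c + d + 3) +
      fact a * fact b * fact (c + 2) * fact d / fact (a + b + (c + 2) + d + 3) +
      fact a * fact b * fact c * fact (d + 2) / fact (a + b + c + (d + 2) + 3) = (1 / 315 :: real)"
  proof -
    note S = sq_sum4_def fact_numeral power2_eq_square algebra_simps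
    consider "i = 1" "j = 2" | "i = 1" "j = 3" | "i = 1" "j = 4" | "i = 2" "j = 3" | "i = 2" "j = 4" | "i = 3" "j = 4"
      using assms by auto
    then show ?thesis
    proof cases
      case 1 show ?thesis unfolding 1 by (rule exI[of _ 1], rule exI[of _ 1], rule exI[of _ 0], rule exI[of _ 0])
        (simp add: S)
    next
      case 2 show ?thesis unfolding 2 by (rule exI[of _ 1], rule exI[of _ 0], rule exI[of _ 1], rule exI[of _ 0])
        (simp add: S)
    next
      case 3 show ?thesis unfolding 3 by (rule exI[of _ 1], rule exI[of _ 0], rule exI[of _ 0], rule exI[of _ 1])
        (simp add: S)
    next
      case 4 show ?thesis unfolding 4 by (rule exI[of _ 0], rule exI[of _ 1], rule exI[of _ 1], rule exI[of _ 0])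
        (simp add: S)
    next
      case 5 show ?thesis unfolding 5 by (rule exI[of _ 0], rule exI[of _ 1], rule exI[of _ 0], rule exI[of _ 1])
        (simp add: S)
    next
      case 6 show ?thesis unfolding 6 by (rule exI[of _ 0], rule exI[of _ 0], rule exI[of _ 1], rule exI[of _ 1])
        (simp add: S)
    qed
  qed
  then obtain a b c d where m: "\<And>p. bary4 p $ i * bary4 p $ j = ?m a b c d p"
      "fact a * fact b * fact c * fact d / fact (a + b + c + d + 3) = (1 / 120 :: real)"
    and m2: "\<And>p. bary4 p $ i * bary4 p $ j * sq_sum4 p = ?m (a + 2) b c d p + ?m a (b + 2) c d p + ?m a b (c + 2) d p + ?m a b c (d + 2) p"
      "fact (a + 2) * fact b * fact c * fact d / fact ((a + 2) + b + c + d + 3) +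
      fact a * fact (b + 2) * fact c * fact d / fact (a + (b + 2) + c + d + 3) +
      fact a * fact b * fact (c + 2) * fact d / fact (a + b + (c + 2) + d + 3) +
      fact a * fact b * fact c * fact (d + 2) / fact (a + b + c + (d + 2) + 3) = (1 / 315 :: real)"
    by blast
  show "has_bochner_integral simplex_measure4 (\<lambda>p. bary4 p $ i * bary4 p $ j) (1 / 120)"
    unfolding m(1) m(2)[symmetric] by (rule simplex_moment4)
  show "has_bochner_integral simplex_measure4 (\<lambda>p. bary4 p $ i * bary4 p $ j * sq_sum4 p) (1 / 315)"
    unfolding m2(1) m2(2)[symmetric] by (intro has_bochner_integral_add simplex_moment4)
qed

text \<open>The tangent is affine in \<open>sq_sum4\<close>, so two moments per pair suffice. They
  are the same for every pair, and only \<open>edge_total4 d\<close> remains of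
  \<open>d\<close>.\<close>

lemma edge_sum4_integral:
  defines "\<tau> \<equiv> \<lambda>p. 4 * (5 / 7) ^ 3 - 3 * (5 / 7) ^ 4 * (1 + sq_sum4 p)"
  shows "has_bochner_integral simplex_measure4 (\<lambda>p. 8 * (edge_sum4 d (bary4 p) * \<tau> p))
     (8 * ((4 * (5 / 7) ^ 3 - 3 * (5 / 7) ^ 4) * (1 / 120) - 3 * (5 / 7) ^ 4 * (1 / 315)) * edge_total4 d)"
proof -
  define K :: real where "K = (4 * (5 / 7) ^ 3 - 3 * (5 / 7) ^ 4) * (1 / 120) - 3 * (5 / 7) ^ 4 * (1 / 315)"
  have e: "has_bochner_integral simplex_measure4 (\<lambda>p. d i j * (bary4 p $ i * bary4 p $ j * \<tau> p)) (d i j * K)"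
    if "(i, j) \<in> {(1, 2), (1, 3), (1, 4), (2, 3), (2, 4), (3, 4 :: 4)}" for i j
  proof -
    have "has_bochner_integral simplex_measure4
        (\<lambda>p. (4 * (5 / 7) ^ 3 - 3 * (5 / 7) ^ 4) * (bary4 p $ i * bary4 p $ j) - 3 * (5 / 7) ^ 4 * (bary4 p $ i * bary4 p $ j * sq_sum4 p))
        ((4 * (5 / 7) ^ 3 - 3 * (5 / 7) ^ 4) * (1 / 120) - 3 * (5 / 7) ^ 4 * (1 / 315))"
      using edge_moments4[OF that] by (intro has_bochner_integral_diff has_bochner_integral_mult_right)
    also have "(\<lambda>p. (4 * (5 / 7) ^ 3 - 3 * (5 / 7) ^ 4) * (bary4 p $ i * bary4 p $ j) - 3 * (5 / 7) ^ 4 * (bary4 p $ i * bary4 p $ j * sq_sum4 p))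
        = (\<lambda>p. bary4 p $ i * bary4 p $ j * \<tau> p)"
      by (simp add: \<tau>_def fun_eq_iff algebra_simps)
    finally have "has_bochner_integral simplex_measure4 (\<lambda>p. bary4 p $ i * bary4 p $ j * \<tau> p) K" unfolding K_def .
    then show ?thesis by (rule has_bochner_integral_mult_right)
  qed
  have "has_bochner_integral simplex_measure4
     (\<lambda>p. 8 * (d 1 2 * (bary4 p $ 1 * bary4 p $ 2 * \<tau> p) + d 1 3 * (bary4 p $ 1 * bary4 p $ 3 * \<tau> p) + d 1 4 * (bary4 p $ 1 * bary4 p $ 4 * \<tau> p)
     + d 2 3 * (bary4 p $ 2 * bary4 p $ 3 * \<tau> p) + d 2 4 * (bary4 p $ 2 * bary4 p $ 4 * \<tau> p) + d 3 4 * (bary4 p $ 3 * bary4 p $ 4 * \<tau> p)))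
     (8 * (d 1 2 * K + d 1 3 * K + d 1 4 * K + d 2 3 * K + d 2 4 * K + d 3 4 * K))"
    by (intro has_bochner_integral_mult_right has_bochner_integral_add e) auto
  then show ?thesis
    unfolding edge_sum4_def edge_total4_def K_def[symmetric] by (simp add: algebra_simps)
qed

lemma edge_sum4_alternating: "alternating_system a \<Longrightarrow> edge_sum4 (\<lambda>i j. 1 / 2 - a i \<bullet> a j) x = 0"
  by (simp add: edge_sum4_def alternating_system_inner)

lemma sq_sum4_nonneg: "0 \<le> sq_sum4 p" and sq_sum3_nonneg: "0 \<le> sq_sum3 q"
  by (simp_all add: sq_sum4_def sq_sum3_def)

lemma alternating_integral4:
  fixes a :: "4 \<Rightarrow> real ^ 4"
  assumes a: "alternating_system a"
  shows "has_bochner_integral simplex_measure4 (\<lambda>p. 1 / (1 + sq_sum4 p)\<^sup>2) (measure lebesgue (coord_body a))"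
proof -
  have one: "a i \<bullet> a i = 1" for i by (simp add: alternating_system_inner[OF a])
  have "norm (\<Sum>i\<in>UNIV. bary4 p $ i *\<^sub>R a i) ^ 4 = ((1 + sq_sum4 p) / 2)\<^sup>2" for p
  proof -
    have "norm (\<Sum>i\<in>UNIV. bary4 p $ i *\<^sub>R a i) ^ 4 = ((norm (\<Sum>i\<in>UNIV. bary4 p $ i *\<^sub>R a i))\<^sup>2)\<^sup>2" by simp
    also have "(norm (\<Sum>i\<in>UNIV. bary4 p $ i *\<^sub>R a i))\<^sup>2 = (1 + sq_sum4 p) / 2"
      unfolding norm_bary4[OF one] edge_sum4_alternating[OF a] by simp
    finally show ?thesis .
  qed
  then have "1 / (4 * norm (\<Sum>i\<in>UNIV. bary4 p $ i *\<^sub>R a i) ^ 4) = 1 / (1 + sq_sum4 p)\<^sup>2" for p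
    by (simp add: power_divide mult.commute)
  then show ?thesis using measure_coord_body_4[OF alternating_system_lin_indep[OF a]] by simp
qed

text \<open>The factor compensates the 1/3 of the cone section and the halving in the quadratic
  form. With the determinant \<open>sqrt (1/2)\<close>, the solid angle is then twice this
  integral.\<close>

lemma alternating_integral3:
  fixes a :: "3 \<Rightarrow> real ^ 3"
  assumes a: "alternating_system a"
  shows "has_bochner_integral simplex_measure3 (\<lambda>p. (1 + sq_sum3 p) powr (- (3 / 2)))
     (3 / (2 * sqrt 2) * measure lebesgue (coord_body a))"
proof -
  have "3 / (2 * sqrt 2) * (1 / (3 * norm (\<Sum>i\<in>UNIV. bary3 p $ i *\<^sub>R a i) ^ 3)) = (1 + sq_sum3 p) powr (- (3 / 2))" for p
  proof -
    define n where "n = norm (\<Sum>i\<in>UNIV. bary3 p $ i *\<^sub>R a i)"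
    have n2: "n\<^sup>2 = (1 + sq_sum3 p) / 2" unfolding n_def by (rule norm_bary3[OF a])
    then have n0: "0 < n" using sq_sum3_nonneg[of p] by (cases "n = 0") (auto simp: n_def)
    have "1 + sq_sum3 p = (sqrt 2 * n)\<^sup>2" by (simp add: n2 power_mult_distrib)
    then have "(1 + sq_sum3 p) powr (- (3 / 2)) = (1 / (sqrt 2 * n)) ^ 3"
      using powr_even_power[of "sqrt 2 * n" 3] n0 by simp
    also have "\<dots> = 1 / ((sqrt 2 * n) ^ 3)" by (simp add: power_divide)
    also have "(sqrt 2 * n) ^ 3 = 2 * sqrt 2 * n ^ 3" by (simp add: power3_eq_cube)
    finally show ?thesis using n0 by (simp add: n_def)
  qed
  then show ?thesis
    using has_bochner_integral_mult_right[OF measure_coord_body_3[OF alternating_system_lin_indep[OF a]], of "3 / (2 * sqrt 2)"]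
    by simp
qed

text \<open>The tangent of the inverse square at the alternating form isolates the linear effect of
  the deviations, and the tangent of the inverse cube makes its integral computable from moments.
  The resulting coefficient \<open>?K\<close> exceeds 0.28 times the upper estimate for the
  alternating volume, which is where 0.28 comes from.\<close>

lemma coord_body_4_ge:
  fixes u a :: "4 \<Rightarrow> real ^ 4"
  assumes a: "alternating_system a" and lu: "lin_indep u"
    and u: "\<And>i. u i \<bullet> u i = 1" "\<And>i j. i \<noteq> j \<Longrightarrow> u i \<bullet> u j \<le> 1 / 2"
  shows "measure lebesgue (coord_body a) * (1 + 0.28 * edge_total4 (\<lambda>i j. 1 / 2 - u i \<bullet> u j)) \<le> measure lebesgue (coord_body u)"
proof -
  define d where "d i j = 1 / 2 - u i \<bullet> u j" for i j
  define I where "I = measure lebesgue (coord_body a)"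
  have d0: "0 \<le> d i j" if "i \<noteq> j" for i j using u(2)[OF that] by (simp add: d_def)
  have t0: "0 \<le> edge_total4 d" unfolding edge_total4_def by (intro add_nonneg_nonneg d0) auto
  let ?K = "8 * ((4 * (5 / 7) ^ 3 - 3 * (5 / 7) ^ 4) * (1 / 120) - 3 * (5 / 7) ^ 4 * (1 / 315)) :: real"
  let ?g = "\<lambda>p. 1 / (1 + sq_sum4 p)\<^sup>2 + 8 * (edge_sum4 d (bary4 p) * (4 * (5 / 7) ^ 3 - 3 * (5 / 7) ^ 4 * (1 + sq_sum4 p)))"
  have I: "has_bochner_integral simplex_measure4 (\<lambda>p. 1 / (1 + sq_sum4 p)\<^sup>2) I"
    unfolding I_def by (rule alternating_integral4[OF a])
  have g: "has_bochner_integral simplex_measure4 ?g (I + ?K * edge_total4 d)"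
    by (intro has_bochner_integral_add I edge_sum4_integral)
  have "AE p in simplex_measure4. ?g p \<le> 1 / (4 * norm (\<Sum>i\<in>UNIV. bary4 p $ i *\<^sub>R u i) ^ 4)"
    using AE_simplex_measure4
  proof eventually_elim
    case (elim p)
    then have pos: "0 < bary4 p $ i" for i using bary4_pos_iff by blast
    define x where "x = (norm (\<Sum>i\<in>UNIV. bary4 p $ i *\<^sub>R u i))\<^sup>2"
    define y where "y = (1 + sq_sum4 p) / 2"
    define E where "E = edge_sum4 d (bary4 p)"
    have x0: "0 < x" unfolding x_def using quadratic_form_props(3)[OF lu] pos by blast
    have y0: "0 < y" using sq_sum4_nonneg[of p] by (simp add: y_def)
    have xy: "y - x = 2 * E" unfolding x_def y_def E_def d_def by (subst norm_bary4[OF u(1)]) simp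
    have E0: "0 \<le> E" unfolding E_def edge_sum4_def
      using pos by (intro add_nonneg_nonneg mult_nonneg_nonneg d0) (auto simp: less_imp_le)
    have "1 / (1 + sq_sum4 p)\<^sup>2 = 1 / y\<^sup>2 / 4" by (simp add: y_def power_divide)
    moreover have "8 * (E * (4 * (5 / 7) ^ 3 - 3 * (5 / 7) ^ 4 * (1 + sq_sum4 p))) \<le> 8 * (E * (1 / (1 + sq_sum4 p) ^ 3))"
      using tangent_inverse_cube[of "1 + sq_sum4 p"] sq_sum4_nonneg[of p] E0 by (intro mult_left_mono) auto
    moreover have "8 * (E * (1 / (1 + sq_sum4 p) ^ 3)) = 2 * (y - x) / y ^ 3 / 4"
      unfolding xy by (simp add: y_def power_divide)
    moreover have "(1 / y\<^sup>2 + 2 * (y - x) / y ^ 3) / 4 \<le> 1 / x\<^sup>2 / 4"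
      using tangent_inverse_square[OF x0 y0] by (intro divide_right_mono) auto
    moreover have "1 / (4 * norm (\<Sum>i\<in>UNIV. bary4 p $ i *\<^sub>R u i) ^ 4) = 1 / x\<^sup>2 / 4" by (simp add: x_def)
    ultimately show ?case by (simp add: E_def add_divide_distrib)
  qed
  from has_bochner_integral_mono[OF g measure_coord_body_4[OF lu] this]
  have le: "I + ?K * edge_total4 d \<le> measure lebesgue (coord_body u)" .
  have "I * 0.28 \<le> 0.0863758 * 0.28" using simplex_integral4(2)[OF I] by (intro mult_right_mono) auto
  also have "\<dots> \<le> ?K" by (simp add: power_divide)
  finally have "I * 0.28 * edge_total4 d \<le> ?K * edge_total4 d" using t0 by (rule mult_right_mono)
  then show ?thesis using le unfolding I_def[symmetric] d_def[abs_def, symmetric] by (simp add: algebra_simps)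
qed

text \<open>The variables of \<open>gram4_near_alternating\<close> are twice the deviations summed
  here; its condition that they add up to at most 1 becomes the threshold 1/2.\<close>

lemma unit_fdet_4_near_alternating:
  fixes u :: "4 \<Rightarrow> real ^ 4"
  assumes u: "\<And>i. u i \<bullet> u i = 1" "\<And>i j. i \<noteq> j \<Longrightarrow> u i \<bullet> u j \<le> 1 / 2"
    and t: "edge_total4 (\<lambda>i j. 1 / 2 - u i \<bullet> u j) \<le> 1 / 2"
  shows "5 - 2 * edge_total4 (\<lambda>i j. 1 / 2 - u i \<bullet> u j) \<le> 16 * (fdet u)\<^sup>2"
proof -
  have c: "u 2 \<bullet> u 1 = u 1 \<bullet> u 2" "u 3 \<bullet> u 1 = u 1 \<bullet> u 3" "u 4 \<bullet> u 1 = u 1 \<bullet> u 4"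
    "u 3 \<bullet> u 2 = u 2 \<bullet> u 3" "u 4 \<bullet> u 2 = u 2 \<bullet> u 4" "u 4 \<bullet> u 3 = u 3 \<bullet> u 4" by (simp_all only: inner_commute)
  let ?e = "\<lambda>i j. 1 - 2 * (u i \<bullet> u j)"
  have e0: "0 \<le> ?e i j" if "i \<noteq> j" for i j using u(2)[OF that] by simp
  have h: "(1 - ?e i j) / 2 = u i \<bullet> u j" for i j by simp
  have f: "(fdet u)\<^sup>2 = det (\<chi> i j. u i \<bullet> u j)" by (simp only: power2_eq_square fdet_mult)
  have "5 - (?e 1 2 + ?e 1 3 + ?e 1 4 + ?e 2 3 + ?e 2 4 + ?e 3 4) \<le> 16 * (fdet u)\<^sup>2"
  proof (rule gram4_near_alternating)
    show "?e 1 2 + ?e 1 3 + ?e 1 4 + ?e 2 3 + ?e 2 4 + ?e 3 4 \<le> 1" using t by (simp add: edge_total4_def)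
    show "(fdet u)\<^sup>2 = (let p = (1 - ?e 1 2) / 2; q = (1 - ?e 1 3) / 2; r = (1 - ?e 1 4) / 2; x = (1 - ?e 2 3) / 2; y = (1 - ?e 2 4) / 2; z = (1 - ?e 3 4) / 2 in
        1 - p\<^sup>2 - q\<^sup>2 - r\<^sup>2 - x\<^sup>2 - y\<^sup>2 - z\<^sup>2 + 2*p*q*x + 2*p*r*y + 2*q*r*z + 2*x*y*z
          + p\<^sup>2*z\<^sup>2 + q\<^sup>2*y\<^sup>2 + r\<^sup>2*x\<^sup>2 - 2*p*q*y*z - 2*p*r*x*z - 2*q*r*x*y)"
      unfolding h Let_def f unfolding det_4 by (simp only: vec_lambda_beta u(1) c) (simp add: power2_eq_square algebra_simps)
  qed (rule e0, simp)+
  then show ?thesis by (simp add: edge_total4_def)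
qed

lemma solid_angle_lower_4:
  fixes u a :: "4 \<Rightarrow> real ^ 4"
  assumes a: "alternating_system a"
    and u: "\<And>i. u i \<bullet> u i = 1" "\<And>i j. i \<noteq> j \<Longrightarrow> u i \<bullet> u j \<le> 1 / 2" and det: "1 / 4 \<le> (fdet u)\<^sup>2"
  shows "solid_angle a \<le> solid_angle u"
proof -
  have la: "lin_indep a" using a by (rule alternating_system_lin_indep)
  have lu: "lin_indep u" using det by (auto simp: lin_indep_iff_fdet)
  define t where "t = edge_total4 (\<lambda>i j. 1 / 2 - u i \<bullet> u j)"
  have "0 \<le> 1 / 2 - u i \<bullet> u j" if "i \<noteq> j" for i j using u(2)[OF that] by simp
  then have t0: "0 \<le> t" unfolding t_def edge_total4_def by (intro add_nonneg_nonneg) simp_all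
  have "5 / 16 \<le> (fdet u)\<^sup>2 * (1 + 0.28 * t)\<^sup>2"
  proof (cases "t \<le> 1 / 2")
    case True
    have "5 - 2 * t \<le> 16 * (fdet u)\<^sup>2" using unit_fdet_4_near_alternating[OF u] True by (simp add: t_def)
    moreover have "5 \<le> (5 - 2 * t) * (1 + 0.28 * t)\<^sup>2"
    proof -
      \<comment> \<open>The linear coefficient is \<open>5 * 0.56 - 2 = 0.8\<close>. Part of it is
        grouped with the negative higher terms into multiples of
        \<open>t * (1/2 - t)\<close>.\<close>
      have "(5 - 2 * t) * (1 + 0.28 * t)\<^sup>2 - 5 = t * (1 / 2 - t) * (0.728 + 0.1568 * t) + 0.0784 * (t * (1 / 2 - t)) + 0.3968 * t"
        by (simp add: power2_eq_square field_simps)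
      also have "\<dots> \<ge> 0" using t0 True by (intro add_nonneg_nonneg mult_nonneg_nonneg) auto
      finally show ?thesis by simp
    qed
    ultimately have "5 \<le> 16 * (fdet u)\<^sup>2 * (1 + 0.28 * t)\<^sup>2"
      by (meson mult_right_mono order_trans zero_le_power2)
    then show ?thesis by simp
  next
    case False
    then have "1.14\<^sup>2 \<le> (1 + 0.28 * t)\<^sup>2" by (intro power_mono) auto
    then have "1 / 4 * 1.14\<^sup>2 \<le> (fdet u)\<^sup>2 * (1 + 0.28 * t)\<^sup>2" using det by (intro mult_mono) auto
    then show ?thesis by (simp add: power2_eq_square)
  qed
  then have "(fdet a)\<^sup>2 \<le> (\<bar>fdet u\<bar> * (1 + 0.28 * t))\<^sup>2"
    by (simp add: fdet_alternating_4[OF a] power_mult_distrib)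
  then have "\<bar>fdet a\<bar> \<le> \<bar>\<bar>fdet u\<bar> * (1 + 0.28 * t)\<bar>" by (simp only: abs_le_square_iff)
  then have "\<bar>fdet a\<bar> \<le> \<bar>fdet u\<bar> * (1 + 0.28 * t)" using t0 by simp
  then have "\<bar>fdet a\<bar> * measure lebesgue (coord_body a) \<le> \<bar>fdet u\<bar> * (1 + 0.28 * t) * measure lebesgue (coord_body a)"
    by (intro mult_right_mono) auto
  also have "\<dots> = \<bar>fdet u\<bar> * (measure lebesgue (coord_body a) * (1 + 0.28 * t))" by (simp only: mult_ac)
  also have "\<dots> \<le> \<bar>fdet u\<bar> * measure lebesgue (coord_body u)"
    unfolding t_def by (intro mult_left_mono coord_body_4_ge[OF a lu u]) auto
  finally show ?thesis
    unfolding solid_angle_coord_body[OF la] solid_angle_coord_body[OF lu] by (intro mult_left_mono) auto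
qed

section \<open>The theorem\<close>

lemma measure_unit_cball:
  "measure lebesgue (cball 0 1 :: (real ^ 3) set) = 4 / 3 * pi"
  "measure lebesgue (cball 0 1 :: (real ^ 4) set) = pi\<^sup>2 / 2"
  by (simp_all add: measure_completion content_cball unit_ball_vol_3 unit_ball_vol_4)

lemma solid_angle_standard_3: "solid_angle (standard_basis :: 3 \<Rightarrow> real ^ 3) = pi / 2"
  using solid_angle_standard_basis[where 'n = 3] by (simp add: measure_unit_cball)

lemma solid_angle_standard_4: "solid_angle (standard_basis :: 4 \<Rightarrow> real ^ 4) = pi\<^sup>2 / 8"
  using solid_angle_standard_basis[where 'n = 4] by (simp add: measure_unit_cball)

lemma solid_angle_alternating_3:
  "0.551285 \<le> solid_angle (alternating_basis :: 3 \<Rightarrow> real ^ 3)"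
  "solid_angle (alternating_basis :: 3 \<Rightarrow> real ^ 3) < 0.551286"
proof -
  let ?a = "alternating_basis :: 3 \<Rightarrow> real ^ 3"
  have a: "alternating_system ?a" by (rule alternating_system_alternating_basis)
  define I where "I = 3 / (2 * sqrt 2) * measure lebesgue (coord_body ?a)"
  have I: "0.2756425 \<le> I" "I < 0.275643"
    unfolding I_def using simplex_integral3[OF alternating_integral3[OF a]] by auto
  have "\<bar>fdet ?a\<bar> = sqrt (1 / 2)" unfolding fdet_alternating_3[OF a, symmetric] by simp
  then have "solid_angle ?a = 3 * (sqrt (1 / 2) * measure lebesgue (coord_body ?a))"
    using solid_angle_coord_body[OF alternating_system_lin_indep[OF a]] by simp
  also have "\<dots> = 2 * I" by (simp add: I_def real_sqrt_divide)
  finally show "0.551285 \<le> solid_angle ?a" "solid_angle ?a < 0.551286" using I by simp_all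
qed

lemma solid_angle_alternating_4:
  "0.193142 \<le> solid_angle (alternating_basis :: 4 \<Rightarrow> real ^ 4)"
  "solid_angle (alternating_basis :: 4 \<Rightarrow> real ^ 4) < 0.193143"
proof -
  let ?a = "alternating_basis :: 4 \<Rightarrow> real ^ 4"
  have a: "alternating_system ?a" by (rule alternating_system_alternating_basis)
  define I where "I = measure lebesgue (coord_body ?a)"
  have I: "0.08637573 \<le> I" "I \<le> 0.0863758"
    unfolding I_def using simplex_integral4[OF alternating_integral4[OF a]] by auto
  have "\<bar>fdet ?a\<bar> = sqrt (5 / 16)" unfolding fdet_alternating_4[OF a, symmetric] by simp
  then have s: "solid_angle ?a = sqrt 5 * I"
    using solid_angle_coord_body[OF alternating_system_lin_indep[OF a]] by (simp add: I_def real_sqrt_divide)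
  \<comment> \<open>The solid angle exceeds 0.193142 by less than 2/10^7, whence the many digits on
    this side; the upper bound has more room.\<close>
  have "2.236067977 \<le> sqrt 5" by (rule real_le_rsqrt) (simp add: power2_eq_square)
  then have "2.236067977 * 0.08637573 \<le> sqrt 5 * I" using I(1) by (intro mult_mono) auto
  then show "0.193142 \<le> solid_angle ?a" unfolding s by simp
  have "sqrt 5 \<le> 2.236068" by (rule real_le_lsqrt) (simp_all add: power2_eq_square)
  then have "sqrt 5 * I \<le> 2.236068 * 0.0863758" using I by (intro mult_mono) auto
  then show "solid_angle ?a < 0.193143" unfolding s by simp
qed

section \<open>Lattices similar to the model lattices\<close>

lemma similar_int_span_basis:
  fixes b :: "'n::finite \<Rightarrow> real ^ 'n"
  assumes b: "lin_indep b" and sim: "similar L (int_span b)"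
  obtains f c where "orthogonal_transformation f" "c \<noteq> 0" "lattice_basis L (\<lambda>i. c *\<^sub>R f (b i))"
proof -
  obtain f c where f: "orthogonal_transformation f" "c \<noteq> 0" and L: "L = (\<lambda>x. c *\<^sub>R f x) ` int_span b"
    using sim unfolding similar_def by blast
  have lf: "linear f" using f(1) by (rule orthogonal_transformation_linear)
  obtain w where w: "dual_pair b w" using dual_pair_exists[OF b] .
  have "dual_pair (\<lambda>i. c *\<^sub>R f (b i)) (\<lambda>i. (1 / c) *\<^sub>R f (w i))"
    using w f by (simp add: dual_pair_def orthogonal_transformation_def)
  then have "lin_indep (\<lambda>i. c *\<^sub>R f (b i))" by (rule lin_indepI_dual)
  moreover have "L = int_span (\<lambda>i. c *\<^sub>R f (b i))"
  proof -
    have "c *\<^sub>R f (\<Sum>i\<in>UNIV. of_int (x i) *\<^sub>R b i) = (\<Sum>i\<in>UNIV. of_int (x i) *\<^sub>R c *\<^sub>R f (b i))" for x :: "'n \<Rightarrow> int"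
      by (simp add: linear_sum[OF lf] linear_scale[OF lf] scaleR_sum_right mult.commute)
    then show ?thesis unfolding L int_span_def by (auto simp: image_def)
  qed
  ultimately show ?thesis using f that by (simp add: lattice_basis_def)
qed

text \<open>If every basis vector is a shortest nonzero lattice vector, Minkowski's condition holds
  at each index, and a similarity preserves this.\<close>

lemma similar_minimal_basis:
  fixes b :: "'n::{finite,wellorder} \<Rightarrow> real ^ 'n::_"
  assumes b: "lin_indep b" and sim: "similar L (int_span b)"
    and short: "\<And>k x. (\<exists>i. x i \<noteq> (0 :: int)) \<Longrightarrow> norm (b k) \<le> norm (\<Sum>i\<in>UNIV. of_int (x i) *\<^sub>R b i)"
  shows "\<exists>v. minimal_basis L v \<and> solid_angle v = solid_angle b"
proof -
  obtain f c where f: "orthogonal_transformation f" "c \<noteq> 0" and lb: "lattice_basis L (\<lambda>i. c *\<^sub>R f (b i))"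
    using similar_int_span_basis[OF b sim] by blast
  have lf: "linear f" using f(1) by (rule orthogonal_transformation_linear)
  have nf: "norm (f x) = norm x" for x using f(1) by (rule orthogonal_transformation_norm)
  have "minimal_basis L (\<lambda>i. c *\<^sub>R f (b i))"
    unfolding minimal_basis_def
  proof (intro conjI allI impI lb)
    fix k and x :: "'n \<Rightarrow> int" assume g: "(GCD i\<in>{k..}. x i) = 1"
    have "\<exists>i. x i \<noteq> 0"
    proof (rule ccontr)
      assume "\<not> ?thesis"
      then have "(GCD i\<in>{k..}. x i) = 0" by auto
      with g show False by simp
    qed
    from short[OF this, of k] have "\<bar>c\<bar> * norm (b k) \<le> \<bar>c\<bar> * norm (\<Sum>i\<in>UNIV. of_int (x i) *\<^sub>R b i)"
      by (intro mult_left_mono) auto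
    also have "\<dots> = norm (c *\<^sub>R f (\<Sum>i\<in>UNIV. of_int (x i) *\<^sub>R b i))" by (simp add: nf)
    also have "c *\<^sub>R f (\<Sum>i\<in>UNIV. of_int (x i) *\<^sub>R b i) = (\<Sum>i\<in>UNIV. of_int (x i) *\<^sub>R c *\<^sub>R f (b i))"
      by (simp add: linear_sum[OF lf] linear_scale[OF lf] scaleR_sum_right mult.commute)
    finally show "norm (c *\<^sub>R f (b k)) \<le> norm (\<Sum>i\<in>UNIV. of_int (x i) *\<^sub>R c *\<^sub>R f (b i))" by (simp add: nf)
  qed
  moreover have "solid_angle (\<lambda>i. c *\<^sub>R f (b i)) = solid_angle b"
  proof -
    \<comment> \<open>A negative factor is absorbed into the orthogonal map; the positive factor
      that is left does not change the cone.\<close>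
    define h where "h x = sgn c *\<^sub>R f x" for x
    have "sgn c * sgn c = 1" using f(2) by (simp add: sgn_if)
    then have "orthogonal_transformation h"
      using f(1) by (auto simp: h_def[abs_def] orthogonal_transformation_def mult.assoc[symmetric] intro: linear_compose_scale_right)
    from solid_angle_orthogonal_transformation[OF this, of b]
    have "solid_angle (\<lambda>i. h (b i)) = solid_angle b" by (simp add: comp_def)
    moreover have "(\<lambda>i. c *\<^sub>R f (b i)) = (\<lambda>i. \<bar>c\<bar> *\<^sub>R h (b i))"
      by (simp add: h_def abs_mult_sgn)
    ultimately show ?thesis using solid_angle_scale[of "\<lambda>_. \<bar>c\<bar>" "\<lambda>i. h (b i)"] f(2) by simp
  qed
  ultimately show ?thesis by blast
qed

lemma standard_basis_short:
  fixes x :: "'n::finite \<Rightarrow> int"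
  assumes "\<exists>i. x i \<noteq> 0"
  shows "norm (standard_basis k :: real ^ 'n) \<le> norm (\<Sum>i\<in>UNIV. of_int (x i) *\<^sub>R (standard_basis i :: real ^ 'n))"
proof -
  obtain i where "x i \<noteq> 0" using assms by blast
  then have "1 \<le> \<bar>x i\<bar>" by linarith
  then have "1 \<le> \<bar>real_of_int (x i)\<bar>" by linarith
  also have "\<dots> = \<bar>(\<Sum>i\<in>UNIV. of_int (x i) *\<^sub>R (standard_basis i :: real ^ 'n)) $ i\<bar>"
    by (simp add: sum_standard_basis)
  also have "\<dots> \<le> norm (\<Sum>i\<in>UNIV. of_int (x i) *\<^sub>R (standard_basis i :: real ^ 'n))" by (rule component_le_norm_cart)
  finally show ?thesis by (simp add: standard_basis_def)
qed

text \<open>Twice the squared norm equals the square of the coefficient sum plus the sum of squared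
  coefficients. This is an even positive integer, hence at least 2.\<close>

lemma alternating_system_short:
  fixes a :: "'n::finite \<Rightarrow> real ^ 'n" and x :: "'n \<Rightarrow> int"
  assumes a: "alternating_system a" and x: "\<exists>i. x i \<noteq> 0"
  shows "norm (a k) \<le> norm (\<Sum>i\<in>UNIV. of_int (x i) *\<^sub>R a i)"
proof -
  have "2 * (norm (\<Sum>i\<in>UNIV. of_int (x i) *\<^sub>R a i))\<^sup>2
      = (\<Sum>i\<in>UNIV. \<Sum>j\<in>UNIV. of_int (x i) * of_int (x j) + (if i = j then of_int (x i) * of_int (x j) else 0))"
    unfolding norm_sum_sq sum_distrib_left
    by (intro sum.cong refl) (simp add: alternating_system_inner[OF a])
  also have "\<dots> = of_int ((\<Sum>i\<in>UNIV. x i) * (\<Sum>i\<in>UNIV. x i) + (\<Sum>i\<in>UNIV. x i * x i))"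
    by (simp add: sum.distrib sum_product)
  finally have eq: "2 * (norm (\<Sum>i\<in>UNIV. of_int (x i) *\<^sub>R a i))\<^sup>2
      = of_int ((\<Sum>i\<in>UNIV. x i) * (\<Sum>i\<in>UNIV. x i) + (\<Sum>i\<in>UNIV. x i * x i))" (is "_ = of_int ?n") .
  have "even (\<Sum>i\<in>A. x i * x i) \<longleftrightarrow> even (\<Sum>i\<in>A. x i)" if "finite A" for A
    using that by (induction A) auto
  then have "even ?n" by simp
  moreover have "0 < ?n"
  proof -
    obtain i where "x i \<noteq> 0" using x by blast
    then have "0 < (\<Sum>i\<in>UNIV. x i * x i)"
      by (intro sum_pos2[of UNIV i]) (auto simp: zero_less_mult_iff)
    then show ?thesis by (simp add: add_nonneg_pos)
  qed
  moreover have "2 \<le> n" if "even n" "0 < n" for n :: int using that by presburger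
  ultimately have "2 \<le> ?n" by blast
  then have "2 \<le> 2 * (norm (\<Sum>i\<in>UNIV. of_int (x i) *\<^sub>R a i))\<^sup>2" unfolding eq by linarith
  then have "1\<^sup>2 \<le> (norm (\<Sum>i\<in>UNIV. of_int (x i) *\<^sub>R a i))\<^sup>2" by simp
  then have "1 \<le> norm (\<Sum>i\<in>UNIV. of_int (x i) *\<^sub>R a i)" by (rule power2_le_imp_le) simp
  then show ?thesis using a by (simp add: alternating_system_def)
qed

section \<open>The bounds for an arbitrary lattice\<close>

lemma small_minimal_basis:
  fixes L :: "(real ^ 'n::{finite,wellorder}) set"
  assumes "full_rank_lattice L"
  obtains v where "minimal_basis L v" "solid_angle v \<le> solid_angle (standard_basis :: 'n \<Rightarrow> real ^ 'n::_)"
proof -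
  obtain v0 where "lattice_basis L v0" using assms by (auto simp: full_rank_lattice_def)
  then obtain v where v: "minimal_basis L v" by (rule minimal_basis_exists)
  obtain e where e: "e \<in> sign_vectors"
    "2 ^ CARD('n) * measure lebesgue (trunc_cone (\<lambda>i. of_int (e i) *\<^sub>R v i)) \<le> measure lebesgue (cball 0 1 :: (real ^ 'n::_) set)"
    using exists_small_sign[OF minimal_basis_lin_indep[OF v]] by blast
  let ?w = "\<lambda>i. of_int (e i) *\<^sub>R v i"
  have w: "minimal_basis L ?w" using v e(1) by (intro minimal_basis_sign) (auto simp: sign_vectors_def)
  have "2 ^ CARD('n) * solid_angle ?w = CARD('n) * (2 ^ CARD('n) * measure lebesgue (trunc_cone ?w))"
    by (simp add: solid_angle_trunc_cone[OF minimal_basis_lin_indep[OF w]])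
  also have "\<dots> \<le> 2 ^ CARD('n) * solid_angle (standard_basis :: 'n \<Rightarrow> real ^ 'n::_)"
    unfolding solid_angle_standard_basis using e(2) by (intro mult_left_mono) auto
  finally have "solid_angle ?w \<le> solid_angle (standard_basis :: 'n \<Rightarrow> real ^ 'n::_)" by simp
  with w show ?thesis by (rule that)
qed

lemma minimal_basis_lower_3:
  fixes v :: "3 \<Rightarrow> real ^ 3"
  assumes v: "minimal_basis L v"
  shows "solid_angle (alternating_basis :: 3 \<Rightarrow> real ^ 3) \<le> solid_angle v"
proof -
  have li: "lin_indep v" using v by (rule minimal_basis_lin_indep)
  have "0 < (\<Prod>i\<in>UNIV. (norm (v i))\<^sup>2)" using lin_indep_nonzero[OF li] by (intro prod_pos) auto
  then have "1 / 2 \<le> (fdet (normalized v))\<^sup>2"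
    unfolding fdet_normalized using minimal_basis_det_3[OF v] by (simp add: pos_le_divide_eq)
  from solid_angle_lower_3[OF alternating_system_alternating_basis minimal_basis_normalized[OF v] this]
  show ?thesis by (simp add: solid_angle_normalized[OF li])
qed

lemma minimal_basis_lower_4:
  fixes v :: "4 \<Rightarrow> real ^ 4"
  assumes v: "minimal_basis L v"
  shows "solid_angle (alternating_basis :: 4 \<Rightarrow> real ^ 4) \<le> solid_angle v"
proof -
  have li: "lin_indep v" using v by (rule minimal_basis_lin_indep)
  have "0 < (\<Prod>i\<in>UNIV. (norm (v i))\<^sup>2)" using lin_indep_nonzero[OF li] by (intro prod_pos) auto
  then have "1 / 4 \<le> (fdet (normalized v))\<^sup>2"
    unfolding fdet_normalized using minimal_basis_det_4[OF v] by (simp add: pos_le_divide_eq)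
  from solid_angle_lower_4[OF alternating_system_alternating_basis minimal_basis_normalized[OF v] this]
  show ?thesis by (simp add: solid_angle_normalized[OF li])
qed

lemma similar_rectangular:
  fixes L :: "(real ^ 'n::{finite,wellorder}) set"
  assumes "similar L rectangular_lattice"
  shows "\<exists>v. minimal_basis L v \<and> solid_angle v = solid_angle (standard_basis :: 'n \<Rightarrow> real ^ 'n::_)"
  using assms unfolding rectangular_lattice_def
  by (rule similar_minimal_basis[OF lin_indep_standard_basis _ standard_basis_short])

lemma similar_alternating:
  fixes L :: "(real ^ 'n::{finite,wellorder}) set"
  assumes "similar L alternating_lattice"
  shows "\<exists>v. minimal_basis L v \<and> solid_angle v = solid_angle (alternating_basis :: 'n \<Rightarrow> real ^ 'n::_)"
  using assms unfolding alternating_lattice_def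
  by (rule similar_minimal_basis[OF alternating_system_lin_indep[OF alternating_system_alternating_basis] _
        alternating_system_short[OF alternating_system_alternating_basis]])

theorem theorem2:
  shows
    "(\<forall>L :: (real ^ 3) set. full_rank_lattice L \<longrightarrow>
        (\<exists>v. minimal_basis L v \<and>
           solid_angle (alternating_basis :: 3 \<Rightarrow> real ^ 3) \<le> solid_angle v \<and>
           solid_angle v \<le> solid_angle (standard_basis :: 3 \<Rightarrow> real ^ 3))) \<and>
     0.551285 \<le> solid_angle (alternating_basis :: 3 \<Rightarrow> real ^ 3) \<and>
     solid_angle (alternating_basis :: 3 \<Rightarrow> real ^ 3) < 0.551286 \<and>
     solid_angle (standard_basis :: 3 \<Rightarrow> real ^ 3) = pi / 2 \<and>
     (\<forall>L :: (real ^ 4) set. full_rank_lattice L \<longrightarrow>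
        (\<exists>v. minimal_basis L v \<and>
           solid_angle (alternating_basis :: 4 \<Rightarrow> real ^ 4) \<le> solid_angle v \<and>
           solid_angle v \<le> solid_angle (standard_basis :: 4 \<Rightarrow> real ^ 4))) \<and>
     0.193142 \<le> solid_angle (alternating_basis :: 4 \<Rightarrow> real ^ 4) \<and>
     solid_angle (alternating_basis :: 4 \<Rightarrow> real ^ 4) < 0.193143 \<and>
     solid_angle (standard_basis :: 4 \<Rightarrow> real ^ 4) = pi\<^sup>2 / 8 \<and>
     (\<forall>L :: (real ^ 3) set. similar L rectangular_lattice \<longrightarrow>
        (\<exists>v. minimal_basis L v \<and>
           solid_angle v = solid_angle (standard_basis :: 3 \<Rightarrow> real ^ 3))) \<and>
     (\<forall>L :: (real ^ 4) set. similar L rectangular_lattice \<longrightarrow>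
        (\<exists>v. minimal_basis L v \<and>
           solid_angle v = solid_angle (standard_basis :: 4 \<Rightarrow> real ^ 4))) \<and>
     (\<forall>L :: (real ^ 3) set. similar L alternating_lattice \<longrightarrow>
        (\<exists>v. minimal_basis L v \<and>
           solid_angle v = solid_angle (alternating_basis :: 3 \<Rightarrow> real ^ 3))) \<and>
     (\<forall>L :: (real ^ 4) set. similar L alternating_lattice \<longrightarrow>
        (\<exists>v. minimal_basis L v \<and>
           solid_angle v = solid_angle (alternating_basis :: 4 \<Rightarrow> real ^ 4)))"
  by (intro conjI allI impI)
    (rule solid_angle_alternating_3 solid_angle_alternating_4 solid_angle_standard_3 solid_angle_standard_4
      | erule similar_rectangular similar_alternating
      | (erule small_minimal_basis, blast intro: minimal_basis_lower_3 minimal_basis_lower_4))+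

end
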